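(* Let $\Gamma$ be a non-circular standard weighted graph, let $B$ be its set of branching points, and let $\Gamma_0$ be the subgraph of $\Gamma$ that is the union of $B$ and of all linear segments of $\Gamma$ of type $[[0_{2k+1}]]$ ($k\ge 0$), including the edges that join these segments with $B$. Then $\Gamma$ is unique in its birational equivalence class up to reversion of its linear segments and the change of weights of branching points described by the following procedure, applied to the connected components $G$ of $\Gamma_0$: (1) if $G$ contains an end-vertex of $\Gamma$ (a vertex of degree $1$ in $\Gamma$), then the weights of the points of $G\cap B$ can be chosen arbitrarily; (2) if $G$ does not contain any end-vertex of $\Gamma$, then the weights of the points of $G\cap B$ can be chosen arbitrarily modulo preservation of the sum of the weights at these branching points. That is: (i) every standard weighted graph birationally equivalent to $\Gamma$ is, up to isomorphism, obtained from $\Gamma$ by reversions of some of its linear segments together with a change of the integer weights of the branching points such that, for every connected component $G$ of $\Gamma_0$ containing no end-vertex of $\Gamma$, the sum of the weights of the points of $G\cap B$ is unchanged; and (ii) conversely, every such change of the integer weights of the branching points (arbitrary on $G\cap B$ in case (1), arbitrary with the same sum over $G\cap B$ in case (2)) yields a standard weighted graph birationally equivalent to $\Gamma$. In particular, staying in the birational equivalence class, one can change the weights of $\Gamma$ in such a way that for every connected component $G$ of $\Gamma_0$ the new weights of the points of $G\cap B$ are all zero in case (1), and are all zero with one exception in case (2), with the new weight in this exceptional position equal to the sum of the (original) weights of the points of $G\cap B$.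
   Context: Weighted graphs. A weighted graph is a finite nonempty graph (multiple edges and loops allowed) with an integer weight attached to each vertex. The degree of a vertex is the number of edge-ends at it (a loop counts twice). A vertex of degree $\ge 3$ is a branching vertex (branching point); $B=B(\Gamma)$ is the set of branching vertices. Isomorphisms of weighted graphs are graph isomorphisms preserving weights. Birational equivalence. An outer blowup at a vertex $v$ adds a new vertex of weight $-1$ joined by one edge to $v$ and lowers the weight of $v$ by $1$. An inner blowup at an edge $e$ joining $u$ and $v$ replaces $e$ by a new vertex of weight $-1$ joined by one edge to $u$ and by one edge to $v$, and lowers the weights of $u$ and $v$ by $1$ each if $u\ne v$ (if $e$ is a loop at $u=v$, the new vertex is joined to $u$ by two edges and the weight of $u$ is lowered by $4$). A blowdown is the inverse of a blowup; thus it contracts a vertex of weight $-1$ and degree $1$ or $2$. A birational transformation is a finite sequence of blowups and blowdowns (and isomorphisms); two weighted graphs are birationally equivalent if there is a birational transformation between them. Linear and circular graphs. $[[w_1,\dots,w_n]]$ denotes the linear weighted graph (chain) with consecutive weights $w_1,\dots,w_n$; $0_m$ stands for a string of $m$ zero weights. A connected weighted graph is circular if it is a cycle (one vertex with a loop, two vertices joined by two edges, or a cycle of length $\ge 3$), and non-circular otherwise. Segments. For a connected non-circular $\Gamma$, let $\Gamma\ominus B$ be the graph obtained by deleting the branching vertices and all edges incident to them. Its connected components are chains, called the (linear) segments of $\Gamma$. (If $B=\emptyset$, then $\Gamma$ itself is a chain and is its only segment.) Edges of $\Gamma$ joining branching points directly do not belong to $\Gamma_0$; for instance, if $\Gamma$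 has no segments of type $[[0_{2k+1}]]$, then $\Gamma_0=B$. Standard graphs. A chain is standard if, read in one of the two directions, it is $[[0_{2k},w_1,\dots,w_n]]$ with $k,n\ge 0$ and all $w_i\le -2$, or $[[0_{2k+1}]]$ with $k\ge 0$. A non-circular weighted graph is standard if it is connected and all its segments are standard. A circular graph is standard if it has one of the forms (listing cyclically consecutive weights) $((0_{2k},w_1,\dots,w_n))$, $((0_l,w))$, $((0_{2k},-1,-1))$ with $k,l\ge 0$, $n>0$, $w\le 0$ and all $w_i\le -2$. Standard graphs are always assumed connected. Reversion. Let $L$ be a standard linear segment of $\Gamma$ with consecutive vertices $v_1,\dots,v_m$ having weights $(0_{2k},w_1,\dots,w_n)$ with all $w_i\le -2$. The reversion of $L$ replaces these weights by $(w_1,\dots,w_n,0_{2k})$ on $v_1,\dots,v_m$ (as an abstract chain this is $[[0_{2k},w_n,\dots,w_1]]$), leaving the underlying graph and the weights of all other vertices unchanged; the inverse operation is also called reversion. For $L=[[0_{2k+1}]]$ the reversion changes nothing. *)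

theory Defs
  imports "HOL-Library.Multiset" "HOL-Library.Infinite_Typeclass"
begin

(* A finite multigraph with loops: the edges form a multiset of two-element multisets of
   vertices, a loop at v being {#v, v#}. Weights outside the vertex set are irrelevant.
   The record type itself also contains the empty graph, which occurs as a subgraph
   (e.g. when all vertices are branching and get deleted). *)

record 'a wgraph =
  verts :: "'a set"
  edges :: "'a multiset multiset"
  weight :: "'a \<Rightarrow> int"

definition weighted_graph :: "'a wgraph \<Rightarrow> bool" where
  "weighted_graph \<Gamma> \<longleftrightarrow> finite (verts \<Gamma>) \<and> verts \<Gamma> \<noteq> {} \<and>
     (\<forall>e\<in>#edges \<Gamma>. size e = 2 \<and> set_mset e \<subseteq> verts \<Gamma>)"

(* count e v is 2 if e is a loop at v *)
definition degree :: "'a wgraph \<Rightarrow> 'a \<Rightarrow> nat" where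
  "degree \<Gamma> v = (\<Sum>e\<in>#edges \<Gamma>. count e v)"

definition branching :: "'a wgraph \<Rightarrow> 'a set" where
  "branching \<Gamma> = {v \<in> verts \<Gamma>. degree \<Gamma> v \<ge> 3}"

definition end_vertices :: "'a wgraph \<Rightarrow> 'a set" where
  "end_vertices \<Gamma> = {v \<in> verts \<Gamma>. degree \<Gamma> v = 1}"

(* The vertices are a subset of an ambient type and parallel edges are indistinguishable,
   so a graph isomorphism is determined here by its action on vertices. *)
definition isomorphic :: "'a wgraph \<Rightarrow> 'b wgraph \<Rightarrow> bool" where
  "isomorphic \<Gamma> \<Gamma>' \<longleftrightarrow> (\<exists>f. bij_betw f (verts \<Gamma>) (verts \<Gamma>') \<and>
     image_mset (image_mset f) (edges \<Gamma>) = edges \<Gamma>' \<and>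
     (\<forall>v\<in>verts \<Gamma>. weight \<Gamma>' (f v) = weight \<Gamma> v))"

definition outer_blowup :: "'a wgraph \<Rightarrow> 'a wgraph \<Rightarrow> bool" where
  "outer_blowup \<Gamma> \<Gamma>' \<longleftrightarrow> (\<exists>v x. v \<in> verts \<Gamma> \<and> x \<notin> verts \<Gamma> \<and>
     verts \<Gamma>' = insert x (verts \<Gamma>) \<and>
     edges \<Gamma>' = edges \<Gamma> + {# {#v, x#} #} \<and>
     weight \<Gamma>' = (weight \<Gamma>)(v := weight \<Gamma> v - 1, x := -1))"

definition inner_blowup :: "'a wgraph \<Rightarrow> 'a wgraph \<Rightarrow> bool" where
  "inner_blowup \<Gamma> \<Gamma>' \<longleftrightarrow> (\<exists>u v x. {#u, v#} \<in># edges \<Gamma> \<and> x \<notin> verts \<Gamma> \<and>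
     verts \<Gamma>' = insert x (verts \<Gamma>) \<and>
     edges \<Gamma>' = edges \<Gamma> - {# {#u, v#} #} + {# {#u, x#}, {#x, v#} #} \<and>
     weight \<Gamma>' =
       (if u \<noteq> v then (weight \<Gamma>)(u := weight \<Gamma> u - 1, v := weight \<Gamma> v - 1, x := -1)
        else (weight \<Gamma>)(u := weight \<Gamma> u - 4, x := -1)))"

definition blowup :: "'a wgraph \<Rightarrow> 'a wgraph \<Rightarrow> bool" where
  "blowup \<Gamma> \<Gamma>' \<longleftrightarrow> weighted_graph \<Gamma> \<and> weighted_graph \<Gamma>' \<and>
     (outer_blowup \<Gamma> \<Gamma>' \<or> inner_blowup \<Gamma> \<Gamma>')"

definition blowdown :: "'a wgraph \<Rightarrow> 'a wgraph \<Rightarrow> bool" where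
  "blowdown \<Gamma> \<Gamma>' \<longleftrightarrow> blowup \<Gamma>' \<Gamma>"

definition birational_step :: "'a wgraph \<Rightarrow> 'a wgraph \<Rightarrow> bool" where
  "birational_step \<Gamma> \<Gamma>' \<longleftrightarrow> blowup \<Gamma> \<Gamma>' \<or> blowdown \<Gamma> \<Gamma>' \<or>
     (weighted_graph \<Gamma> \<and> weighted_graph \<Gamma>' \<and> isomorphic \<Gamma> \<Gamma>')"

(* Meaningful only over an infinite vertex type, where a fresh vertex is always available. *)
definition birationally_equivalent :: "'a::infinite wgraph \<Rightarrow> 'a wgraph \<Rightarrow> bool" where
  "birationally_equivalent = birational_step\<^sup>*\<^sup>*"

definition adjacent :: "'a wgraph \<Rightarrow> 'a \<Rightarrow> 'a \<Rightarrow> bool" where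
  "adjacent \<Gamma> u v \<longleftrightarrow> {#u, v#} \<in># edges \<Gamma>"

definition connected_graph :: "'a wgraph \<Rightarrow> bool" where
  "connected_graph \<Gamma> \<longleftrightarrow> (\<forall>u\<in>verts \<Gamma>. \<forall>v\<in>verts \<Gamma>. (adjacent \<Gamma>)\<^sup>*\<^sup>* u v)"

definition induced :: "'a wgraph \<Rightarrow> 'a set \<Rightarrow> 'a wgraph" where
  "induced \<Gamma> S = \<Gamma>\<lparr>verts := verts \<Gamma> \<inter> S,
                 edges := {#e \<in># edges \<Gamma>. set_mset e \<subseteq> S#}\<rparr>"

definition components :: "'a wgraph \<Rightarrow> 'a wgraph set" where
  "components \<Gamma> = (\<lambda>u. induced \<Gamma> {v. (adjacent \<Gamma>)\<^sup>*\<^sup>* u v}) ` verts \<Gamma>"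

(* vs lists the consecutive vertices of the chain; rev vs reads it in the other direction *)
definition chain :: "'a wgraph \<Rightarrow> 'a list \<Rightarrow> bool" where
  "chain \<Gamma> vs \<longleftrightarrow> vs \<noteq> [] \<and> distinct vs \<and> verts \<Gamma> = set vs \<and>
     edges \<Gamma> = mset (map (\<lambda>(u, v). {#u, v#}) (zip vs (tl vs)))"

(* a single loop for length 1, a double edge for length 2 *)
definition cycle :: "'a wgraph \<Rightarrow> 'a list \<Rightarrow> bool" where
  "cycle \<Gamma> vs \<longleftrightarrow> vs \<noteq> [] \<and> distinct vs \<and> verts \<Gamma> = set vs \<and>
     edges \<Gamma> = mset (map (\<lambda>(u, v). {#u, v#}) (zip vs (rotate1 vs)))"

definition circular :: "'a wgraph \<Rightarrow> bool" where
  "circular \<Gamma> \<longleftrightarrow> (\<exists>vs. cycle \<Gamma> vs)"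

definition segments :: "'a wgraph \<Rightarrow> 'a wgraph set" where
  "segments \<Gamma> = components (induced \<Gamma> (verts \<Gamma> - branching \<Gamma>))"

definition standard_chain :: "'a wgraph \<Rightarrow> bool" where
  "standard_chain L \<longleftrightarrow> (\<exists>vs. chain L vs \<and>
     ((\<exists>k ws. map (weight L) vs = replicate (2 * k) 0 @ ws \<and> (\<forall>w\<in>set ws. w \<le> -2)) \<or>
      (\<exists>k. map (weight L) vs = replicate (2 * k + 1) 0)))"

definition standard_cycle :: "'a wgraph \<Rightarrow> bool" where
  "standard_cycle \<Gamma> \<longleftrightarrow> (\<exists>vs. cycle \<Gamma> vs \<and>
     ((\<exists>k ws. map (weight \<Gamma>) vs = replicate (2 * k) 0 @ ws \<and> ws \<noteq> [] \<and> (\<forall>w\<in>set ws. w \<le> -2)) \<or>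
      (\<exists>l w. map (weight \<Gamma>) vs = replicate l 0 @ [w] \<and> w \<le> 0) \<or>
      (\<exists>k. map (weight \<Gamma>) vs = replicate (2 * k) 0 @ [-1, -1])))"

definition standard :: "'a wgraph \<Rightarrow> bool" where
  "standard \<Gamma> \<longleftrightarrow> weighted_graph \<Gamma> \<and> connected_graph \<Gamma> \<and>
     (if circular \<Gamma> then standard_cycle \<Gamma> else \<forall>L\<in>segments \<Gamma>. standard_chain L)"

(* The inverse operation needs no separate clause: it is this operation for the list rev vs. *)
definition reversion :: "'a wgraph \<Rightarrow> 'a wgraph \<Rightarrow> bool" where
  "reversion \<Gamma> \<Gamma>' \<longleftrightarrow> (\<exists>L\<in>segments \<Gamma>. \<exists>vs k ws. chain L vs \<and>
     map (weight \<Gamma>) vs = replicate (2 * k) 0 @ ws \<and> (\<forall>w\<in>set ws. w \<le> -2) \<and>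
     verts \<Gamma>' = verts \<Gamma> \<and> edges \<Gamma>' = edges \<Gamma> \<and>
     map (weight \<Gamma>') vs = ws @ replicate (2 * k) 0 \<and>
     (\<forall>v. v \<notin> set vs \<longrightarrow> weight \<Gamma>' v = weight \<Gamma> v))"

definition odd_zero_segments :: "'a wgraph \<Rightarrow> 'a wgraph set" where
  "odd_zero_segments \<Gamma> = {L \<in> segments \<Gamma>.
     \<exists>vs k. chain L vs \<and> map (weight L) vs = replicate (2 * k + 1) 0}"

(* The subgraph of branching vertices and odd zero segments; edges with both ends branching
   are left out, all other edges between its vertices lie in a segment or join one to a
   branching vertex. *)
definition zero_part :: "'a wgraph \<Rightarrow> 'a wgraph" where
  "zero_part \<Gamma> =
     (let V = branching \<Gamma> \<union> (\<Union>L\<in>odd_zero_segments \<Gamma>. verts L)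
      in \<Gamma>\<lparr>verts := V,
           edges := {#e \<in># edges \<Gamma>. set_mset e \<subseteq> V \<and> \<not> set_mset e \<subseteq> branching \<Gamma>#}\<rparr>)"

definition has_end_vertex :: "'a wgraph \<Rightarrow> 'a wgraph \<Rightarrow> bool" where
  "has_end_vertex \<Gamma> G \<longleftrightarrow> verts G \<inter> end_vertices \<Gamma> \<noteq> {}"

definition branching_weight_change :: "'a wgraph \<Rightarrow> 'a wgraph \<Rightarrow> bool" where
  "branching_weight_change \<Gamma> \<Gamma>' \<longleftrightarrow>
     verts \<Gamma>' = verts \<Gamma> \<and> edges \<Gamma>' = edges \<Gamma> \<and>
     (\<forall>v. v \<notin> branching \<Gamma> \<longrightarrow> weight \<Gamma>' v = weight \<Gamma> v) \<and>
     (\<forall>G\<in>components (zero_part \<Gamma>). \<not> has_end_vertex \<Gamma> G \<longrightarrow>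
        (\<Sum>b\<in>verts G \<inter> branching \<Gamma>. weight \<Gamma>' b) = (\<Sum>b\<in>verts G \<inter> branching \<Gamma>. weight \<Gamma> b))"

end

theory Submission
  imports Defs
begin

text \<open>Let \<open>\<tau>\<close>, \<open>\<sigma>\<close> be the elements \<open>shear 1\<close> and \<open>link\<close> of \<open>SL\<^sub>2(\<int>) \<times> \<int>\<close>, which satisfy
  \<open>\<sigma> \<tau>\<^sup>-\<^sup>1 \<sigma> = \<tau> \<sigma> \<tau>\<close>. Reading an edge as \<open>\<sigma>\<close> and a vertex of weight \<open>w\<close> and degree 2 as \<open>\<tau>\<^sup>w\<close>, a
  chain between two branching vertices becomes one edge labelled by a group element; the relation
  is the invariance under inner blowups. A power of \<open>\<tau>\<close> at the end of a label may be traded for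
  the weight of the vertex there (gauge), and a free end is an edge to \<open>\<infinity>\<close>, where the gauge is
  free. Suppressing the vertices of degree at most 2 and deleting the contractible ends
  \<open>\<tau>\<^sup>m \<sigma> \<tau>\<^sup>n\<close> at branching vertices is a terminating rewriting system that is confluent modulo gauge,
  and birationally equivalent graphs have the same normal form. The labels of a standard graph can
  be read off from its normal form: \<open>[[0\<^sub>2\<^sub>k, w\<^sub>1, \<dots>, w\<^sub>n]]\<close> gives the \<open>k\<close>-th power of the central
  element \<open>\<sigma>\<^sup>2\<close> times a Hirzebruch-Jung continued fraction (so its reversion is invisible), and
  \<open>[[0\<^sub>2\<^sub>k\<^sub>+\<^sub>1]]\<close> gives the central element \<open>\<sigma>\<^sup>2\<^sup>k\<^sup>+\<^sup>2\<close>, across which weights are moved by the gauge.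
  Conversely, these moves of weights are elementary transformations at 0-vertices.\<close>

section \<open>Edge labels and the rewriting system\<close>

text \<open>The integer factor is there because \<sigma>^2 is minus the identity matrix: matrices
  alone would show the number of pairs of zeros only modulo 2. The value 3 of this coordinate at
  \<sigma>, against 1 at \<tau>, is forced by the relation: 2 s - 1 = s + 2. The obstacle to
  confluence is a vertex of degree 3 with two contractible ends. Whichever is deleted, the other
  becomes part of the remaining edge to \<infinity>, and the two results differ by a power of \<tau>
  there; hence uniqueness can only hold modulo gauge. A Newman argument still works, because each
  reduction step is matched by exactly one step from any gauge-equivalent state. A normal form does
  not fix the weights of its vertices. What gauge preserves is the double coset of each label modulo
  powers of \<tau>, and certain sums of weights. If the lower left entry of a label is nonzero, the
  powers of \<tau> at its two ends are determined separately and no weight can pass; if it is zero,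
  the label commutes with \<tau> and weight passes freely. So sums are preserved over sets of
  vertices that no label of the second kind leaves, and among standard segments only the odd chains
  of zeros have such labels.\<close>

datatype lab = Lab int int int int int

instantiation lab :: monoid_mult
begin

definition one_lab :: lab where
  "1 = Lab 1 0 0 1 0"

fun times_lab :: "lab \<Rightarrow> lab \<Rightarrow> lab" where
  "Lab p q r s n * Lab p' q' r' s' n' =
     Lab (p * p' + q * r') (p * q' + q * s') (r * p' + s * r') (r * q' + s * s') (n + n')"

instance
proof
  fix a b c :: lab
  show "a * b * c = a * (b * c)"
    by (cases a; cases b; cases c) (simp add: algebra_simps)
  show "1 * a = a" "a * 1 = a"
    by (cases a; simp add: one_lab_def)+
qed

end

definition shear :: "int \<Rightarrow> lab" where
  "shear k = Lab 1 k 0 1 k"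

definition link :: lab where
  "link = Lab 0 1 (-1) 0 3"

text \<open>The label of the path read backwards: transposition in the antidiagonal, the
  anti-automorphism that fixes \<open>link\<close> and all shears.\<close>

fun star :: "lab \<Rightarrow> lab" where
  "star (Lab p q r s n) = Lab s q r p n"

lemma star_star [simp]: "star (star g) = g"
  by (cases g) simp

lemma star_mult [simp]: "star (g * h) = star h * star g"
  by (cases g; cases h) (simp add: algebra_simps)

lemma star_shear [simp]: "star (shear k) = shear k"
  by (simp add: shear_def)

lemma star_link [simp]: "star link = link"
  by (simp add: link_def)

lemma shear_mult [simp]: "shear a * shear b = shear (a + b)"
  by (simp add: shear_def)

lemma shear_mult_left [simp]: "shear a * (shear b * g) = shear (a + b) * g"
  by (simp add: mult.assoc [symmetric])

lemma shear_0 [simp]: "shear 0 = 1"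
  by (simp add: shear_def one_lab_def)

lemma link_shear_link: "link * shear (-1) * link = shear 1 * link * shear 1"
  by (simp add: shear_def link_def)

text \<open>The exponents are determined by a contractible label, so the weight correction made by
  rule \<open>triv\<close> is unambiguous.\<close>

lemma shear_link_shear_eq_iff:
  "shear m * link * shear n = shear m' * link * shear n' \<longleftrightarrow> m = m' \<and> n = n'"
  by (auto simp: shear_def link_def)

section \<open>Labelled graphs, their reduction and their gauge\<close>

type_synonym 'a dart = "'a option \<times> lab \<times> 'a option"
type_synonym 'a state = "'a set \<times> ('a \<Rightarrow> int) \<times> 'a dart multiset multiset"

text \<open>Both orientations are stored, which makes an unoriented edge a single value. The end
  \<open>None\<close> is the point at infinity.\<close>

definition ledge :: "'a option \<Rightarrow> lab \<Rightarrow> 'a option \<Rightarrow> 'a dart multiset" where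
  "ledge p g q = {#(p, g, q), (q, star g, p)#}"

lemma ledge_sym: "ledge p g q = ledge q (star g) p"
  by (simp add: ledge_def add_mset_commute)

lemma ledge_eq_iff:
  "ledge p g q = ledge p' g' q' \<longleftrightarrow>
     p = p' \<and> g = g' \<and> q = q' \<or> p = q' \<and> g = star g' \<and> q = p'"
  unfolding ledge_def by (auto simp: add_eq_conv_ex)

definition ends_at :: "'a \<Rightarrow> 'a dart multiset \<Rightarrow> nat" where
  "ends_at x e = count (image_mset fst e) (Some x)"

lemma ends_at_ledge [simp]:
  "ends_at x (ledge p g q) = (if p = Some x then 1 else 0) + (if q = Some x then 1 else 0)"
  by (simp add: ends_at_def ledge_def)

definition ldeg :: "'a \<Rightarrow> 'a dart multiset multiset \<Rightarrow> nat" where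
  "ldeg x M = (\<Sum>e\<in>#M. ends_at x e)"

lemma ldeg_simps [simp]:
  "ldeg x {#} = 0"
  "ldeg x (add_mset e M) = ends_at x e + ldeg x M"
  "ldeg x (M + N) = ldeg x M + ldeg x N"
  by (simp_all add: ldeg_def)

lemma ldeg_eq_0_iff: "ldeg x M = 0 \<longleftrightarrow> (\<forall>e\<in>#M. ends_at x e = 0)"
  by (simp add: ldeg_def)

text \<open>\<open>rl x \<beta> A B D \<beta>' Q\<close>: at a vertex \<open>x\<close> of weight \<open>\<beta>\<close> the edges \<open>A\<close> are replaced by \<open>B\<close>, the
  vertices \<open>D\<close> are removed and the weight of \<open>x\<close> becomes \<open>\<beta>'\<close>; \<open>Q\<close> is the condition on the number
  of ends of the other edges at \<open>x\<close>. The rules bring the degree of \<open>x\<close> to 2 by means of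
  ends that can be contracted and then suppress \<open>x\<close>.\<close>

inductive rl :: "'a \<Rightarrow> int \<Rightarrow> 'a dart multiset multiset \<Rightarrow> 'a dart multiset multiset \<Rightarrow> 'a set \<Rightarrow> int
    \<Rightarrow> (nat \<Rightarrow> bool) \<Rightarrow> bool" where
  triv: "rl x \<beta> {#ledge (Some x) (shear m * link * shear n) None#} {#} {} (\<beta> + m) (\<lambda>d. d \<ge> 2)"
| cap: "rl x \<beta> {#} {#ledge (Some x) link None#} {} \<beta> (\<lambda>d. d \<le> 1)"
| elim: "u \<noteq> Some x \<Longrightarrow> v \<noteq> Some x \<Longrightarrow>
    rl x \<beta> {#ledge u g (Some x), ledge (Some x) h v#} {#ledge u (g * shear \<beta> * h) v#} {x} 0
      (\<lambda>d. d = 0)"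
| circ: "rl x \<beta> {#ledge (Some x) g (Some x)#} {#} {x} 0 (\<lambda>d. d = 0)"

text \<open>The rules that remove x also set its weight to 0, so that states reached by different
  routes agree as functions on the whole type.\<close>

inductive red :: "'a state \<Rightarrow> 'a state \<Rightarrow> bool" where
  redI: "x \<in> V \<Longrightarrow> rl x (b x) A B D \<beta>' Q \<Longrightarrow> Q (ldeg x M) \<Longrightarrow>
    red (V, b, M + A) (V - D, b(x := \<beta>'), M + B)"

definition bump :: "('a \<Rightarrow> int) \<Rightarrow> 'a option \<Rightarrow> int \<Rightarrow> 'a \<Rightarrow> int" where
  "bump b p k = (case p of None \<Rightarrow> b | Some x \<Rightarrow> b(x := b x + k))"

lemma bump_None [simp]: "bump b None k = b"
  and bump_Some [simp]: "bump b (Some x) k = b(x := b x + k)"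
  by (simp_all add: bump_def)

inductive gauge :: "'a state \<Rightarrow> 'a state \<Rightarrow> bool" where
  gaugeI: "gauge (V, b, add_mset (ledge p g q) M)
    (V, bump b p k, add_mset (ledge p (shear (-k) * g) q) M)"

lemma gauge_sym: "gauge X Y \<Longrightarrow> gauge Y X"
proof (induction rule: gauge.induct)
  case (gaugeI V b p g q M k)
  have "bump (bump b p k) p (-k) = b"
    by (cases p) auto
  then show ?case
    using gauge.gaugeI[of V "bump b p k" p "shear (-k) * g" q M "-k"] by simp
qed

lemma gauges_sym: "gauge\<^sup>*\<^sup>* X Y \<Longrightarrow> gauge\<^sup>*\<^sup>* Y X"
  by (induction rule: rtranclp_induct) (auto intro: gauge_sym converse_rtranclp_into_rtranclp)

definition wf_state :: "'a state \<Rightarrow> bool" where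
  "wf_state = (\<lambda>(V, b, M). finite V \<and> (\<forall>e\<in>#M. \<exists>p g q. e = ledge p g q))"

lemma wf_state_red: "red X Y \<Longrightarrow> wf_state X \<Longrightarrow> wf_state Y"
proof (induction rule: red.induct)
  case (redI x V b A B D \<beta>' Q M)
  have "\<exists>p g q. e = ledge p g q" if "e \<in># B" for e
    using redI(2) that by (cases rule: rl.cases) auto
  then show ?case
    using redI(4) by (auto simp: wf_state_def)
qed

lemma wf_state_gauge: "gauge X Y \<Longrightarrow> wf_state X \<Longrightarrow> wf_state Y"
  by (induction rule: gauge.induct) (auto simp: wf_state_def)

lemma wf_state_reds: "red\<^sup>*\<^sup>* X Y \<Longrightarrow> wf_state X \<Longrightarrow> wf_state Y"
  by (induction rule: rtranclp_induct) (auto intro: wf_state_red)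

lemma wf_state_gauges: "gauge\<^sup>*\<^sup>* X Y \<Longrightarrow> wf_state X \<Longrightarrow> wf_state Y"
  by (induction rule: rtranclp_induct) (auto intro: wf_state_gauge)

lemma rl_ldeg_other: "rl x \<beta> A B D \<beta>' Q \<Longrightarrow> y \<noteq> x \<Longrightarrow> ldeg y A = ldeg y B"
  by (induction rule: rl.induct) auto

lemma rl_subset: "rl x \<beta> A B D \<beta>' Q \<Longrightarrow> D \<subseteq> {x}"
  by (induction rule: rl.induct) auto

lemma rl_incident: "rl x \<beta> A B D \<beta>' Q \<Longrightarrow> e \<in># A \<Longrightarrow> ends_at x e > 0"
  by (induction rule: rl.induct) auto

section \<open>Termination\<close>

fun mu :: "'a state \<Rightarrow> nat" where
  "mu (V, b, M) = (\<Sum>x\<in>V. 1 + nat \<bar>int (ldeg x M) - 2\<bar>)"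

text \<open>A step at x either deletes x or moves its degree one closer to 2, and no other vertex
  changes its degree.\<close>

lemma mu_red: "red X Y \<Longrightarrow> wf_state X \<Longrightarrow> mu Y < mu X"
proof (induction rule: red.induct)
  case (redI x V b A B D \<beta>' Q M)
  let ?f = "\<lambda>N y. 1 + nat \<bar>int (ldeg y N) - 2\<bar>"
  have fin: "finite V"
    using redI by (simp add: wf_state_def)
  have other: "(\<Sum>y\<in>V - {x}. ?f (M + A) y) = (\<Sum>y\<in>V - {x}. ?f (M + B) y)"
    using rl_ldeg_other[OF redI(2)] by (intro sum.cong) auto
  have mu0: "mu (V, b, M + A) = ?f (M + A) x + (\<Sum>y\<in>V - {x}. ?f (M + A) y)"
    using fin redI(1) by (simp add: sum.remove)
  have mu1: "mu (V - {x}, b', M + B) = (\<Sum>y\<in>V - {x}. ?f (M + B) y)" for b'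
    by simp
  have mu2: "mu (V, b', M + B) = ?f (M + B) x + (\<Sum>y\<in>V - {x}. ?f (M + B) y)" for b'
    using fin redI(1) by (simp add: sum.remove)
  show ?case
  proof (cases "D = {x}")
    case True
    then show ?thesis
      unfolding mu0 True mu1 other by simp
  next
    case False
    then have D: "D = {}"
      using rl_subset[OF redI(2)] by auto
    have "?f (M + B) x < ?f (M + A) x"
      using redI(2,3) D by (cases rule: rl.cases) auto
    then show ?thesis
      unfolding mu0 D Diff_empty mu2 other by simp
  qed
qed

section \<open>Local confluence modulo gauge\<close>

definition joinable :: "'a state \<Rightarrow> 'a state \<Rightarrow> bool" where
  "joinable X Y \<longleftrightarrow> (\<exists>X' Y'. red\<^sup>*\<^sup>* X X' \<and> red\<^sup>*\<^sup>* Y Y' \<and> gauge\<^sup>*\<^sup>* X' Y')"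

lemma joinable_refl: "joinable X X"
  unfolding joinable_def by blast

lemma joinable_red: "red X Z \<Longrightarrow> red Y Z \<Longrightarrow> joinable X Y"
  unfolding joinable_def by blast

lemma redI':
  assumes "rl x (b x) A B D \<beta>' Q" "x \<in> V" "Q (ldeg x M)"
    "X = (V, b, M + A)" "Y = (V - D, b(x := \<beta>'), M + B)"
  shows "red X Y"
  using assms by (auto intro: redI)

text \<open>The side condition at y depends only on the degree of y, which a step at x preserves.
  Hence steps consuming disjoint sets of edges commute, even at adjacent vertices.\<close>

lemma joinable_disjoint:
  assumes 1: "x \<in> V" "rl x (b x) A1 B1 D1 \<beta>1 Q1" "Q1 (ldeg x (N + A2))"
    and 2: "y \<in> V" "rl y (b y) A2 B2 D2 \<beta>2 Q2" "Q2 (ldeg y (N + A1))"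
    and xy: "x \<noteq> y"
  shows "joinable (V - D1, b(x := \<beta>1), N + A2 + B1) (V - D2, b(y := \<beta>2), N + A1 + B2)"
proof (rule joinable_red)
  let ?Z = "(V - D1 - D2, b(x := \<beta>1, y := \<beta>2), N + B1 + B2)"
  show "red (V - D1, b(x := \<beta>1), N + A2 + B1) ?Z"
  proof (rule redI')
    show "rl y ((b(x := \<beta>1)) y) A2 B2 D2 \<beta>2 Q2"
      using 2 xy by simp
    show "y \<in> V - D1"
      using 2 xy rl_subset[OF 1(2)] by auto
    show "Q2 (ldeg y (N + B1))"
      using 2 xy rl_ldeg_other[OF 1(2), of y] by simp
  qed (auto simp: ac_simps)
  show "red (V - D2, b(y := \<beta>2), N + A1 + B2) ?Z"
  proof (rule redI')
    show "rl x ((b(y := \<beta>2)) x) A1 B1 D1 \<beta>1 Q1"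
      using 1 xy by simp
    show "x \<in> V - D2"
      using 1 xy rl_subset[OF 2(2)] by auto
    show "Q1 (ldeg x (N + B2))"
      using 1 xy rl_ldeg_other[OF 2(2), of x] by simp
  qed (use xy in \<open>auto simp: ac_simps fun_upd_twist\<close>)
qed

text \<open>The two edges at x may be listed in either order; reversing the fused label by
  \<open>star\<close> gives the same unoriented edge.\<close>

lemma elim_swap:
  assumes "rl x \<beta> {#ledge u g (Some x), ledge (Some x) h v#} B D \<beta>' Q" "u \<noteq> Some x" "v \<noteq> Some x"
  shows "B = {#ledge u (g * shear \<beta> * h) v#}"
  using assms(1)
proof (cases rule: rl.cases)
  case (elim u' v' g' h')
  then show ?thesis
    using assms(2,3)
    by (auto simp: add_eq_conv_ex ledge_eq_iff mult.assoc)
qed auto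

lemma rl_unique_zero:
  assumes "rl x \<beta> A B1 D1 \<beta>1 Q1" "rl x \<beta> A B2 D2 \<beta>2 Q2" "Q1 0" "Q2 0" "ldeg x A = 2"
  shows "B1 = B2 \<and> D1 = D2 \<and> \<beta>1 = \<beta>2"
  using assms(1)
proof (cases rule: rl.cases)
  case (elim u v g h)
  from assms(2) have "D2 = {x} \<and> \<beta>2 = 0"
    using elim assms(4,5) by (cases rule: rl.cases) auto
  then show ?thesis
    using elim_swap assms elim by metis
next
  case (circ g)
  from assms(2) show ?thesis
    using circ assms(4,5) by (cases rule: rl.cases) (auto simp: add_eq_conv_ex ledge_eq_iff)
qed (use assms in auto)

lemma filter_incident:
  assumes "ldeg x M = 0" "\<And>e. e \<in># A \<Longrightarrow> ends_at x e > 0"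
  shows "filter_mset (\<lambda>e. ends_at x e > 0) (M + A) = A"
proof -
  have "filter_mset (\<lambda>e. ends_at x e > 0) M = {#}"
    using assms(1) by (auto simp: ldeg_eq_0_iff filter_mset_eq_conv)
  moreover have "filter_mset (\<lambda>e. ends_at x e > 0) A = A"
    using assms(2) by (auto simp: filter_mset_eq_conv)
  ultimately show ?thesis
    by simp
qed

lemma ledge_of_incident:
  assumes "\<exists>p g q. e = ledge p g q" "ends_at x e = 1"
  obtains u g where "e = ledge u g (Some x)" "u \<noteq> Some x"
  using assms by (auto split: if_splits) (metis ledge_sym)+

text \<open>The total degree of x selects the rule: at most 1 allows only \<open>cap\<close>,
  exactly 2 only \<open>elim\<close> or \<open>circ\<close>, at least 3 only \<open>triv\<close>. A
  real choice exists only in the last case, between two contractible ends.\<close>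

lemma joinable_same:
  assumes wf: "wf_state (V, b, M1 + A1)" and x: "x \<in> V"
    and 1: "rl x (b x) A1 B1 D1 \<beta>1 Q1" "Q1 (ldeg x M1)"
    and 2: "rl x (b x) A2 B2 D2 \<beta>2 Q2" "Q2 (ldeg x M2)"
    and eq: "M1 + A1 = M2 + A2"
  shows "joinable (V - D1, b(x := \<beta>1), M1 + B1) (V - D2, b(x := \<beta>2), M2 + B2)"
proof -
  have deg: "ldeg x M1 + ldeg x A1 = ldeg x M2 + ldeg x A2"
    using eq by (metis ldeg_simps(3))
  consider (low) "ldeg x (M1 + A1) \<le> 1" | (two) "ldeg x (M1 + A1) = 2"
    | (high) "ldeg x (M1 + A1) \<ge> 3"
    by linarith
  then show ?thesis
  proof cases
    case low
    have "A1 = {#} \<and> B1 = {#ledge (Some x) link None#} \<and> D1 = {} \<and> \<beta>1 = b x"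
      using 1 low by (cases rule: rl.cases) auto
    moreover have "A2 = {#} \<and> B2 = {#ledge (Some x) link None#} \<and> D2 = {} \<and> \<beta>2 = b x"
      using 2 low deg by (cases rule: rl.cases) auto
    ultimately show ?thesis
      using eq by (auto intro: joinable_refl)
  next
    case two
    have z1: "ldeg x M1 = 0 \<and> Q1 0"
      using 1 two by (cases rule: rl.cases) auto
    have z2: "ldeg x M2 = 0 \<and> Q2 0"
      using 2 two deg by (cases rule: rl.cases) auto
    have "A1 = A2"
      using filter_incident[of x M1 A1] filter_incident[of x M2 A2] z1 z2 rl_incident[OF 1(1)]
        rl_incident[OF 2(1)] eq by auto
    moreover from this have "M1 = M2"
      using eq by simp
    moreover have "ldeg x A1 = 2"
      using two z1 by simp
    ultimately show ?thesis
      using rl_unique_zero[OF 1(1), of B2 D2 \<beta>2 Q2] 2 z1 z2 by (auto intro: joinable_refl)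
  next
    case high
    obtain m n where A1: "A1 = {#ledge (Some x) (shear m * link * shear n) None#}"
      and B1: "B1 = {#}" "D1 = {}" "\<beta>1 = b x + m"
      using 1 high by (cases rule: rl.cases) auto
    obtain m' n' where A2: "A2 = {#ledge (Some x) (shear m' * link * shear n') None#}"
      and B2: "B2 = {#}" "D2 = {}" "\<beta>2 = b x + m'"
      using 2 high deg by (cases rule: rl.cases) auto
    let ?e1 = "ledge (Some x) (shear m * link * shear n) None"
    let ?e2 = "ledge (Some x) (shear m' * link * shear n') None"
    from eq consider "M1 = M2 \<and> ?e1 = ?e2" | N where "M1 = add_mset ?e2 N" "M2 = add_mset ?e1 N"
      unfolding A1 A2 by (auto simp: add_eq_conv_ex)
    then show ?thesis
    proof cases
      case 1
      then show ?thesis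
        by (simp add: ledge_eq_iff shear_link_shear_eq_iff B1 B2 joinable_refl)
    next
      case N: 2
      have "ldeg x N \<ge> 1"
        using high by (simp add: A1 N)
      show ?thesis
      proof (cases "ldeg x N \<ge> 2")
        case True
        let ?Z = "(V, b(x := b x + m + m'), N)"
        have "red (V, b(x := b x + m), M1) ?Z"
          using x True by (intro redI'[OF rl.triv[of x _ m' n'], where V = V]) (auto simp: N)
        moreover have "red (V, b(x := b x + m'), M2) ?Z"
          using x True by (intro redI'[OF rl.triv[of x _ m n], where V = V]) (auto simp: N)
        ultimately show ?thesis
          unfolding B1 B2 by (auto intro: joinable_red)
      next
        case False
        then have one: "ldeg x N = 1"
          using \<open>ldeg x N \<ge> 1\<close> by simp
        then obtain f where f: "f \<in># N" "ends_at x f > 0"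
          by (metis ldeg_eq_0_iff neq0_conv zero_neq_one)
        then obtain N' where N': "N = add_mset f N'"
          by (meson multi_member_split)
        have "ends_at x f = 1" and zero: "ldeg x N' = 0"
          using one f N' by simp_all
        moreover have "\<exists>p g q. f = ledge p g q"
          using wf f by (auto simp: wf_state_def A1 N)
        ultimately obtain u g where fe: "f = ledge u g (Some x)" "u \<noteq> Some x"
          using ledge_of_incident by metis
        \<comment> \<open>Degree 3: once one end is contracted, x is suppressed with the other end
          as its second edge. The two orders produce the same edge to infinity except for the last
          exponent, \<open>n'\<close> or \<open>n\<close>, which a gauge step at \<open>None\<close>
          absorbs.\<close>
        let ?Z = "\<lambda>k. (V - {x}, b(x := 0), add_mset (ledge u (g * shear (b x + m + m') * link * shear k) None) N')"
        have "red (V, b(x := b x + m), M1) (?Z n')"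
          using x zero fe(2)
          by (intro redI'[OF rl.elim[of u x None _ g "shear m' * link * shear n'"], where V = V])
            (auto simp: N N' fe mult.assoc add_mset_commute)
        moreover have "red (V, b(x := b x + m'), M2) (?Z n)"
          using x zero fe(2)
          by (intro redI'[OF rl.elim[of u x None _ g "shear m * link * shear n"], where V = V])
            (auto simp: N N' fe mult.assoc add_mset_commute ac_simps)
        moreover have "gauge (?Z n') (?Z n)"
        proof -
          have *: "ledge u (g * shear (b x + m + m') * link * shear k) None =
            ledge None (shear k * (link * (shear (b x + m + m') * star g))) u" for k
            by (subst ledge_sym) (simp add: mult.assoc)
          show ?thesis
            unfolding * using gauge.gaugeI[of "V - {x}" "b(x := 0)" None
                "shear n' * (link * (shear (b x + m + m') * star g))" u N' "n' - n"]
            by simp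
        qed
        ultimately show ?thesis
          unfolding B1 B2 joinable_def by (metis (no_types, lifting) Diff_empty add.right_neutral r_into_rtranclp)
      qed
    qed
  qed
qed

text \<open>Two neighbouring vertices of degree 2 can be suppressed in either order; if they form a
  cycle, both orders lead to a vertex with a loop, which the rule \<open>circ\<close> removes.\<close>

lemma joinable_shared:
  assumes xy: "x \<in> V" "y \<in> V" "x \<noteq> y"
    and ends: "u \<noteq> Some x" "v \<noteq> Some y"
    and zero: "ldeg x M1 = 0" "ldeg y M2 = 0"
    and eq: "add_mset (ledge u g (Some x)) M1 = add_mset (ledge (Some y) k v) M2"
  shows "joinable
    (V - {x}, b(x := 0), add_mset (ledge u (g * shear (b x) * h) (Some y)) M1)
    (V - {y}, b(y := 0), add_mset (ledge (Some x) (h * shear (b y) * k) v) M2)"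
proof -
  from eq consider (same) "M1 = M2" "ledge u g (Some x) = ledge (Some y) k v"
    | (diff) N where "M1 = add_mset (ledge (Some y) k v) N" "M2 = add_mset (ledge u g (Some x)) N"
    by (auto simp: add_eq_conv_ex)
  then show ?thesis
  proof cases
    case same
    then have uv: "u = Some y" "v = Some x" "k = g"
      using xy by (auto simp: ledge_eq_iff ends)
    let ?Z = "(V - {x} - {y}, b(x := 0, y := 0), M1)"
    have "red (V - {x}, b(x := 0), add_mset (ledge u (g * shear (b x) * h) (Some y)) M1) ?Z"
      using xy zero same
      by (intro redI'[OF rl.circ[of y _ "g * shear (b x) * h"], where V = "V - {x}"]) (auto simp: uv)
    moreover have "red (V - {y}, b(y := 0), add_mset (ledge (Some x) (h * shear (b y) * k) v) M2) ?Z"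
      using xy zero same
      by (intro redI'[OF rl.circ[of x _ "h * shear (b y) * k"], where V = "V - {y}"])
        (auto simp: uv fun_upd_twist)
    ultimately show ?thesis
      by (rule joinable_red)
  next
    case diff
    have uy: "u \<noteq> Some y" and vx: "v \<noteq> Some x" and zN: "ldeg x N = 0" "ldeg y N = 0"
      using zero xy by (auto simp: diff split: if_splits)
    let ?Z = "(V - {x} - {y}, b(x := 0, y := 0),
      add_mset (ledge u (g * shear (b x) * h * shear (b y) * k) v) N)"
    have "red (V - {x}, b(x := 0), add_mset (ledge u (g * shear (b x) * h) (Some y)) M1) ?Z"
      using xy zN ends uy
      by (intro redI'[OF rl.elim[of u y v _ "g * shear (b x) * h" k], where V = "V - {x}"])
        (auto simp: diff add_mset_commute mult.assoc)
    moreover have "red (V - {y}, b(y := 0), add_mset (ledge (Some x) (h * shear (b y) * k) v) M2) ?Z"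
      using xy zN ends vx
      by (intro redI'[OF rl.elim[of u x v _ g "h * shear (b y) * k"], where V = "V - {y}"])
        (auto simp: diff add_mset_commute mult.assoc fun_upd_twist)
    ultimately show ?thesis
      by (rule joinable_red)
  qed
qed

text \<open>Only \<open>elim\<close> consumes an edge that leads to another vertex: a contractible
  end runs to infinity and \<open>circ\<close> consumes a loop. The edges are oriented so that the
  shared one comes second.\<close>

lemma rl_shared_edge:
  assumes "rl x \<beta> A B D \<beta>' Q" "e \<in># A" "ends_at y e > 0" "x \<noteq> y"
  obtains u g h where "e = ledge (Some x) h (Some y)" "A = {#ledge u g (Some x), e#}"
    "B = {#ledge u (g * shear \<beta> * h) (Some y)#}" "D = {x}" "\<beta>' = 0" "Q = (\<lambda>d. d = 0)" "u \<noteq> Some x"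
  using assms(1)
proof (cases rule: rl.cases)
  case (elim u v g h)
  consider "e = ledge u g (Some x)" | "e = ledge (Some x) h v"
    using elim assms(2) by auto
  then show ?thesis
  proof cases
    case 1
    then have u: "u = Some y"
      using assms(3,4) by (auto split: if_splits)
    show ?thesis
    proof (rule that[of "star g" v "star h"])
      show "e = ledge (Some x) (star g) (Some y)"
        by (subst ledge_sym) (simp add: 1 u)
      show "A = {#ledge v (star h) (Some x), e#}"
        by (subst ledge_sym) (simp add: 1 elim add_mset_commute)
      show "B = {#ledge v (star h * shear \<beta> * star g) (Some y)#}"
        by (subst ledge_sym) (simp add: elim u mult.assoc)
    qed (use elim in auto)
  next
    case 2
    then have "v = Some y"
      using assms(3,4) by (auto split: if_splits)
    then show ?thesis
      using that elim 2 by blast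
  qed
qed (use assms in auto)

text \<open>Two steps interfere only if they act at the same vertex, or if two neighbours are being
  suppressed and share an edge. All other pairs commute.\<close>

lemma local_confluence:
  assumes "wf_state X" "red X Y1" "red X Y2"
  shows "joinable Y1 Y2"
  using assms(2)
proof (cases rule: red.cases)
  case 1: (redI x V b A1 B1 D1 \<beta>1 Q1 M1)
  from assms(3) show ?thesis
  proof (cases rule: red.cases)
    case 2: (redI y V' b' A2 B2 D2 \<beta>2 Q2 M2)
    have eq: "V' = V" "b' = b" "M1 + A1 = M2 + A2"
      using 1 2 by auto
    show ?thesis
    proof (cases "x = y")
      case True
      then show ?thesis
        using joinable_same[of V b M1 A1 x B1 D1 \<beta>1 Q1 A2 B2 D2 \<beta>2 Q2 M2] 1 2 eq assms(1) by auto
    next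
      case xy: False
      show ?thesis
      proof (cases "A1 \<inter># A2 = {#}")
        case True
        have "A2 \<subseteq># A1 + M1"
          using eq(3) by (metis add.commute mset_subset_eq_add_left)
        then have "A2 \<subseteq># M1"
          using True by (metis (no_types, lifting) add_diff_cancel_left'
              diff_empty diff_intersect_right_idem inter_subset_eq_union
              subset_eq_diff_conv subset_mset.inf.commute union_commute)
        then obtain N where N: "M1 = N + A2"
          by (metis subset_mset.diff_add)
        then have "M2 = N + A1"
          using eq(3) by (metis add.assoc add.commute add_right_cancel)
        then show ?thesis
          using joinable_disjoint[of x V b A1 B1 D1 \<beta>1 Q1 N A2 y B2 D2 \<beta>2 Q2] 1 2 eq xy N by auto
      next
        case False
        then obtain e where e: "e \<in># A1" "e \<in># A2"
          by (metis disjunct_not_in)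
        obtain u g h where s1: "e = ledge (Some x) h (Some y)" "A1 = {#ledge u g (Some x), e#}"
          "B1 = {#ledge u (g * shear (b x) * h) (Some y)#}" "D1 = {x}" "\<beta>1 = 0"
          "Q1 = (\<lambda>d. d = 0)" "u \<noteq> Some x"
          using rl_shared_edge[OF 1(4) e(1), of y] rl_incident[of y "b' y" A2] 2 e xy by metis
        obtain v k h' where s2: "e = ledge (Some y) h' (Some x)" "A2 = {#ledge v k (Some y), e#}"
          "B2 = {#ledge v (k * shear (b y) * h') (Some x)#}" "D2 = {y}" "\<beta>2 = 0"
          "Q2 = (\<lambda>d. d = 0)" "v \<noteq> Some y"
          using rl_shared_edge[of y "b y" A2 B2 D2 \<beta>2 Q2 e x] rl_incident[OF 1(4)] 2 e xy eq by metis
        have h': "h' = star h"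
          using s1(1) s2(1) xy by (auto simp: ledge_eq_iff)
        have B2: "B2 = {#ledge (Some x) (h * shear (b y) * star k) v#}"
          unfolding s2(3) by (subst ledge_sym) (simp add: h' mult.assoc)
        have A2: "A2 = {#ledge (Some y) (star k) v, e#}"
          unfolding s2(2) by (subst ledge_sym) simp
        have "add_mset (ledge u g (Some x)) M1 = add_mset (ledge (Some y) (star k) v) M2"
          using eq(3) unfolding s1(2) A2 by simp
        then show ?thesis
          using joinable_shared[of x V y u v M1 M2 g "star k" b h] 1 2 eq xy s1 s2 B2 by auto
      qed
    qed
  qed
qed

section \<open>Unique normal forms\<close>

lemma rl_at_edge:
  assumes "rl x \<beta> A B D \<beta>' Q" "Q 0" "e \<in># A" "ends_at x e = 1"
  obtains u g h v where "e = ledge u g (Some x)" "A = {#ledge u g (Some x), ledge (Some x) h v#}"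
    "B = {#ledge u (g * shear \<beta> * h) v#}" "D = {x}" "\<beta>' = 0" "Q = (\<lambda>d. d = 0)"
    "u \<noteq> Some x" "v \<noteq> Some x"
  using assms(1)
proof (cases rule: rl.cases)
  case (elim u v g h)
  consider "e = ledge u g (Some x)" | "e = ledge (Some x) h v"
    using elim assms(3) by auto
  then show ?thesis
  proof cases
    case 1
    then show ?thesis
      using that elim by blast
  next
    case 2
    show ?thesis
    proof (rule that[of v "star h" "star g" u])
      show "e = ledge v (star h) (Some x)"
        by (subst ledge_sym) (simp add: 2)
      show "A = {#ledge v (star h) (Some x), ledge (Some x) (star g) u#}"
        unfolding elim(1) by (subst (2) ledge_sym, subst ledge_sym) (simp add: add_mset_commute)
      show "B = {#ledge v (star h * shear \<beta> * star g) u#}"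
        unfolding elim(2) by (subst ledge_sym) (simp add: mult.assoc)
    qed (use elim in auto)
  qed
qed (use assms in auto)

text \<open>When further edges are present at x, the rule is \<open>triv\<close> or
  \<open>cap\<close>. These add a constant to the weight of x, hence commute with any change of
  it.\<close>

lemma rl_keep:
  assumes "rl x \<beta> A B D \<beta>' Q" "Q d" "d > 0"
  shows "D = {}" "rl x (\<beta> + k) A B D (\<beta>' + k) Q"
proof -
  show "D = {}"
    using assms by (cases rule: rl.cases) auto
  show "rl x (\<beta> + k) A B D (\<beta>' + k) Q"
    using assms
  proof (cases rule: rl.cases)
    case (triv m n)
    then show ?thesis
      using rl.triv[of x "\<beta> + k" m n] by (simp add: ac_simps)
  next
    case cap
    show ?thesis
      unfolding cap by (rule rl.cap)
  qed (use assms(2,3) in auto)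
qed

lemma bump_upd [simp]: "p \<noteq> Some x \<Longrightarrow> bump (b(x := c)) p k = (bump b p k)(x := c)"
  by (cases p) auto

lemma bump_other [simp]: "p \<noteq> Some x \<Longrightarrow> bump b p k x = b x"
  by (cases p) auto

text \<open>One step is matched by exactly one step. This makes irreducibility gauge-invariant and
  allows a step to be carried along a whole gauge path.\<close>

lemma red_gauge:
  assumes "red X Y" "gauge X X'"
  shows "\<exists>Y'. red X' Y' \<and> gauge\<^sup>*\<^sup>* Y Y'"
  using assms(1)
proof (cases rule: red.cases)
  case 1: (redI x V b A B D \<beta>' Q M)
  from assms(2) obtain p g q N k where
    eq: "M + A = add_mset (ledge p g q) N" and
    X': "X' = (V, bump b p k, add_mset (ledge p (shear (-k) * g) q) N)"
    by (cases rule: gauge.cases) (use 1 in auto)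
  let ?e = "ledge p g q" and ?e' = "ledge p (shear (-k) * g) q"
  have "?e \<in># M + A"
    by (simp add: eq)
  then consider (rest) "?e \<in># M" | (act) "?e \<in># A"
    by auto
  then show ?thesis
  proof cases
    case rest
    then obtain M' where M: "M = add_mset ?e M'"
      by (meson multi_member_split)
    then have N: "N = M' + A"
      using eq by simp
    show ?thesis
    proof (cases "p = Some x")
      case False
      have "red X' (V - D, bump (b(x := \<beta>')) p k, add_mset ?e' M' + B)"
        using 1 False by (intro redI'[of x "bump b p k" A B D \<beta>' Q V "add_mset ?e' M'"])
          (auto simp: X' N M)
      moreover have "gauge Y (V - D, bump (b(x := \<beta>')) p k, add_mset ?e' M' + B)"
        using gauge.gaugeI[of "V - D" "b(x := \<beta>')" p g q "M' + B" k] 1 by (simp add: M)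
      ultimately show ?thesis
        by blast
    next
      case True
      have "ldeg x M > 0"
        by (simp add: M True)
      note keep = rl_keep(1)[OF 1(4,5) this] rl_keep(2)[OF 1(4,5) this, of k]
      have "red X' (V - D, b(x := \<beta>' + k), add_mset ?e' M' + B)"
        using 1 True keep by (intro redI'[of x "bump b p k" A B D "\<beta>' + k" Q V "add_mset ?e' M'"])
          (auto simp: X' N M)
      moreover have "gauge Y (V - D, b(x := \<beta>' + k), add_mset ?e' M' + B)"
        using gauge.gaugeI[of "V - D" "b(x := \<beta>')" p g q "M' + B" k] 1 by (simp add: M True)
      ultimately show ?thesis
        by blast
    qed
  next
    case act
    then obtain A' where A: "A = add_mset ?e A'"
      by (meson multi_member_split)
    then have N: "N = M + A'"
      using eq by simp
    from 1(4) show ?thesis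
    proof (cases rule: rl.cases)
      \<comment> \<open>The gauge step either trades k between the weight of x and the exponent m,
        keeping \<open>b x + m\<close>, or changes only the exponent at infinity, which is discarded
        by the contraction.\<close>
      case (triv m n)
      then have A': "A' = {#}" and e: "?e = ledge (Some x) (shear m * link * shear n) None"
        using A by auto
      from e consider "p = Some x" "g = shear m * link * shear n" "q = None"
        | "p = None" "g = shear n * link * shear m" "q = Some x"
        by (auto simp: ledge_eq_iff mult.assoc)
      then have "red X' Y"
      proof cases
        case a: 1
        show ?thesis
          using 1 triv a
          by (intro redI'[OF rl.triv[of x _ "m - k" n], where V = V])
            (auto simp: X' N A' mult.assoc)
      next
        case a: 2
        have "ledge None (shear (-k) * g) (Some x) = ledge (Some x) (shear m * link * shear (n - k)) None"
          by (subst ledge_sym) (simp add: a mult.assoc)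
        then show ?thesis
          using 1 triv a
          by (intro redI'[OF rl.triv[of x _ m "n - k"], where V = V]) (auto simp: X' N A')
      qed
      then show ?thesis
        by blast
    next
      case cap
      then show ?thesis
        using act by simp
    next
      case (elim u v g' h)
      then have "\<forall>e\<in>#A. ends_at x e = 1"
        by auto
      then have "ends_at x ?e = 1"
        using act by blast
      then obtain u g1 h v where e: "?e = ledge u g1 (Some x)"
        and A2: "A = {#ledge u g1 (Some x), ledge (Some x) h v#}"
        and B: "B = {#ledge u (g1 * shear (b x) * h) v#}" and D: "D = {x}" "\<beta>' = 0"
        and Q: "Q = (\<lambda>d. d = 0)" and uv: "u \<noteq> Some x" "v \<noteq> Some x"
        using rl_at_edge[OF 1(4) _ act] elim by (metis (full_types))
      have A': "A' = {#ledge (Some x) h v#}"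
        using A A2 e by simp
      \<comment> \<open>A gauge step at the far end u survives as one on the fused edge; a gauge
        step at x cancels inside the product \<open>g * shear \<beta> * h\<close>.\<close>
      from e uv consider "p = u" "g = g1" "q = Some x" | "p = Some x" "g = star g1" "q = u"
        by (auto simp: ledge_eq_iff)
      then show ?thesis
      proof cases
        case a: 1
        have "red X' (V - D, bump (b(x := 0)) u k, add_mset (ledge u (shear (-k) * (g1 * shear (b x) * h)) v) M)"
          using 1 a uv D Q by (intro redI'[OF rl.elim[of u x v _ "shear (-k) * g1" h], where V = V])
            (auto simp: X' N A' mult.assoc)
        moreover have "gauge Y (V - D, bump (b(x := 0)) u k, add_mset (ledge u (shear (-k) * (g1 * shear (b x) * h)) v) M)"
          using gauge.gaugeI[of "V - D" "b(x := 0)" u "g1 * shear (b x) * h" v M k] 1 B D by simp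
        ultimately show ?thesis
          by blast
      next
        case a: 2
        have "ledge (Some x) (shear (-k) * star g1) u = ledge u (g1 * shear (-k)) (Some x)"
          by (subst ledge_sym) simp
        then have "red X' Y"
          using 1 a uv D Q B by (intro redI'[OF rl.elim[of u x v _ "g1 * shear (-k)" h], where V = V])
            (auto simp: X' N A' mult.assoc)
        then show ?thesis
          by blast
      qed
    next
      case (circ g1)
      then have "p = Some x" "q = Some x" "A' = {#}"
        using A by (auto simp: ledge_eq_iff)
      then have "red X' Y"
        using 1 circ by (intro redI'[where b = "bump b p k", OF rl.circ[of x _ "shear (-k) * g"], where V = V]) (auto simp: X' N)
      then show ?thesis
        by blast
    qed
  qed
qed

lemma red_gauges:
  assumes "gauge\<^sup>*\<^sup>* X X'" "red X Y"
  shows "\<exists>Y'. red X' Y' \<and> gauge\<^sup>*\<^sup>* Y Y'"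
  using assms
proof (induction rule: rtranclp_induct)
  case (step X1 X2)
  then show ?case
    by (meson red_gauge rtranclp_trans)
qed blast

section \<open>Renaming of vertices\<close>

definition ren_edge :: "('a \<Rightarrow> 'b) \<Rightarrow> 'a dart multiset \<Rightarrow> 'b dart multiset" where
  "ren_edge \<pi> = image_mset (\<lambda>(p, g, q). (map_option \<pi> p, g, map_option \<pi> q))"

fun ren :: "('a \<Rightarrow> 'a) \<Rightarrow> 'a state \<Rightarrow> 'a state" where
  "ren \<pi> (V, b, M) = (\<pi> ` V, b \<circ> inv \<pi>, image_mset (ren_edge \<pi>) M)"

lemma ren_edge_ledge [simp]:
  "ren_edge \<pi> (ledge p g q) = ledge (map_option \<pi> p) g (map_option \<pi> q)"
  by (simp add: ren_edge_def ledge_def)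

lemma ends_at_ren_edge:
  assumes "inj \<pi>"
  shows "ends_at (\<pi> x) (ren_edge \<pi> e) = ends_at x e"
proof -
  have *: "image_mset fst (ren_edge \<pi> e) = image_mset (map_option \<pi>) (image_mset fst e)"
    by (simp add: ren_edge_def multiset.map_comp comp_def case_prod_beta)
  have "count (image_mset (map_option \<pi>) N) (Some (\<pi> x)) = count N (Some x)" for N
    using assms by (induction N) (auto dest: injD)
  then show ?thesis
    unfolding ends_at_def * .
qed

lemma ldeg_ren:
  "inj \<pi> \<Longrightarrow> ldeg (\<pi> x) (image_mset (ren_edge \<pi>) M) = ldeg x M"
  by (simp add: ldeg_def multiset.map_comp comp_def ends_at_ren_edge)

lemma rl_ren:
  assumes "inj \<pi>" "rl x \<beta> A B D \<beta>' Q"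
  shows "rl (\<pi> x) \<beta> (image_mset (ren_edge \<pi>) A) (image_mset (ren_edge \<pi>) B) (\<pi> ` D) \<beta>' Q"
  using assms(2)
proof (cases rule: rl.cases)
  case triv
  then show ?thesis
    by (auto intro: rl.triv)
next
  case cap
  then show ?thesis
    using rl.cap[of "\<pi> x" \<beta>] by simp
next
  case (elim u v g h)
  then show ?thesis
    using rl.elim[of "map_option \<pi> u" "\<pi> x" "map_option \<pi> v" \<beta> g h]
    by (auto dest: injD[OF assms(1)])
next
  case circ
  then show ?thesis
    by (auto intro: rl.circ)
qed

lemma red_ren:
  assumes "bij \<pi>" "red X Y"
  shows "red (ren \<pi> X) (ren \<pi> Y)"
  using assms(2)
proof (cases rule: red.cases)
  case (redI x V b A B D \<beta>' Q M)
  have inj: "inj \<pi>"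
    using assms(1) by (simp add: bij_is_inj)
  have "b(x := \<beta>') \<circ> inv \<pi> = (b \<circ> inv \<pi>)(\<pi> x := \<beta>')"
    using assms(1) by (auto simp: fun_eq_iff inv_f_f[OF inj] surj_f_inv_f[OF bij_is_surj])
  then show ?thesis
    using redI rl_ren[OF inj, of x "b x"] inj
    by (intro redI'[of "\<pi> x" "b \<circ> inv \<pi>" "image_mset (ren_edge \<pi>) A" "image_mset (ren_edge \<pi>) B"
          "\<pi> ` D" \<beta>' Q "\<pi> ` V" "image_mset (ren_edge \<pi>) M"])
      (auto simp: ldeg_ren image_set_diff)
qed

lemma gauge_ren:
  assumes "bij \<pi>" "gauge X Y"
  shows "gauge (ren \<pi> X) (ren \<pi> Y)"
  using assms(2)
proof (cases rule: gauge.cases)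
  case (gaugeI V b p g q M k)
  have inj: "inj \<pi>"
    using assms(1) by (simp add: bij_is_inj)
  have "bump b p k \<circ> inv \<pi> = bump (b \<circ> inv \<pi>) (map_option \<pi> p) k"
    using assms(1)
    by (cases p) (auto simp: fun_eq_iff inv_f_f[OF inj] surj_f_inv_f[OF bij_is_surj])
  then show ?thesis
    using gaugeI gauge.intros[of "\<pi> ` V" "b \<circ> inv \<pi>" "map_option \<pi> p" g "map_option \<pi> q"
        "image_mset (ren_edge \<pi>) M" k] by simp
qed

lemma gauges_ren: "gauge\<^sup>*\<^sup>* X Y \<Longrightarrow> bij \<pi> \<Longrightarrow> gauge\<^sup>*\<^sup>* (ren \<pi> X) (ren \<pi> Y)"
  by (induction rule: rtranclp_induct) (auto intro: gauge_ren rtranclp.rtrancl_into_rtrancl)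

lemma ren_edge_comp: "ren_edge \<pi> (ren_edge \<sigma> e) = ren_edge (\<pi> \<circ> \<sigma>) e"
  by (auto simp: ren_edge_def multiset.map_comp comp_def case_prod_beta option.map_comp
      intro!: image_mset_cong)

lemma ren_edge_id: "ren_edge id e = e"
  by (simp add: ren_edge_def option.map_id)

lemma ren_comp: "bij \<pi> \<Longrightarrow> bij \<sigma> \<Longrightarrow> ren \<pi> (ren \<sigma> X) = ren (\<pi> \<circ> \<sigma>) X"
  by (cases X) (simp add: ren_edge_comp multiset.map_comp comp_assoc o_inv_distrib image_comp
      comp_def[of "ren_edge \<pi>"])

lemma ren_id [simp]: "ren id X = X"
  by (cases X) (simp add: ren_edge_id[abs_def])

definition equ :: "'a state \<Rightarrow> 'a state \<Rightarrow> bool" where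
  "equ X Y \<longleftrightarrow> (\<exists>\<pi>. bij \<pi> \<and> gauge\<^sup>*\<^sup>* (ren \<pi> X) Y)"

lemma equE:
  assumes "equ X Y"
  obtains \<pi> where "bij \<pi>" "gauge\<^sup>*\<^sup>* (ren \<pi> X) Y"
  using assms unfolding equ_def by (elim exE conjE)

lemma equI: "bij \<pi> \<Longrightarrow> gauge\<^sup>*\<^sup>* (ren \<pi> X) Y \<Longrightarrow> equ X Y"
  unfolding equ_def by (intro exI conjI)

lemma equ_gauges: "gauge\<^sup>*\<^sup>* X Y \<Longrightarrow> equ X Y"
  unfolding equ_def by (rule exI[of _ id]) simp

lemma equ_ren: "bij \<pi> \<Longrightarrow> equ X (ren \<pi> X)"
  unfolding equ_def by blast

lemma equ_refl: "equ X X"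
  by (rule equ_gauges) simp

lemma equ_trans:
  assumes "equ X Y" "equ Y Z"
  shows "equ X Z"
proof -
  obtain \<pi> where \<pi>: "bij \<pi>" "gauge\<^sup>*\<^sup>* (ren \<pi> X) Y"
    using assms(1) by (rule equE)
  obtain \<sigma> where \<sigma>: "bij \<sigma>" "gauge\<^sup>*\<^sup>* (ren \<sigma> Y) Z"
    using assms(2) by (rule equE)
  have "gauge\<^sup>*\<^sup>* (ren (\<sigma> \<circ> \<pi>) X) (ren \<sigma> Y)"
    using gauges_ren[OF \<pi>(2) \<sigma>(1)] ren_comp[OF \<sigma>(1) \<pi>(1)] by simp
  then show ?thesis
    using equI[of "\<sigma> \<circ> \<pi>"] \<pi>(1) \<sigma> bij_comp rtranclp_trans by metis
qed

lemma equ_sym: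
  assumes "equ X Y"
  shows "equ Y X"
proof -
  obtain \<pi> where \<pi>: "bij \<pi>" "gauge\<^sup>*\<^sup>* (ren \<pi> X) Y"
    using assms by (rule equE)
  have "gauge\<^sup>*\<^sup>* (ren (inv \<pi>) Y) (ren (inv \<pi>) (ren \<pi> X))"
    by (rule gauges_ren[OF gauges_sym[OF \<pi>(2)] bij_imp_bij_inv[OF \<pi>(1)]])
  moreover have "ren (inv \<pi>) (ren \<pi> X) = X"
    using \<pi>(1) by (simp add: ren_comp bij_imp_bij_inv bij_is_inj)
  ultimately show ?thesis
    using equI[of "inv \<pi>"] \<pi>(1) bij_imp_bij_inv by metis
qed

lemma red_equ:
  assumes "equ X X'" "red X Y"
  obtains Y' where "red X' Y'" "equ Y Y'"
proof -
  obtain \<pi> where \<pi>: "bij \<pi>" "gauge\<^sup>*\<^sup>* (ren \<pi> X) X'"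
    using assms(1) by (rule equE)
  obtain Y' where "red X' Y'" "gauge\<^sup>*\<^sup>* (ren \<pi> Y) Y'"
    using red_gauges[OF \<pi>(2) red_ren[OF \<pi>(1) assms(2)]] by (elim exE conjE)
  then show ?thesis
    using that[OF _ equI[OF \<pi>(1)]] by simp
qed

lemma reds_equ:
  assumes "red\<^sup>*\<^sup>* X Y" "equ X X'"
  shows "\<exists>Y'. red\<^sup>*\<^sup>* X' Y' \<and> equ Y Y'"
  using assms
proof (induction rule: rtranclp_induct)
  case (step Y Z)
  then show ?case
    by (meson red_equ rtranclp.rtrancl_into_rtrancl)
qed blast

lemma wf_state_ren:
  assumes "wf_state X"
  shows "wf_state (ren \<pi> X)"
proof -
  obtain V b M where X: "X = (V, b, M)"
    by (cases X)
  have "\<exists>p g q. ren_edge \<pi> e = ledge p g q" if "e \<in># M" for e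
    using assms that by (fastforce simp: X wf_state_def)
  then show ?thesis
    using assms by (auto simp: X wf_state_def)
qed

lemma wf_state_equ: "equ X Y \<Longrightarrow> wf_state X \<Longrightarrow> wf_state Y"
  unfolding equ_def using wf_state_ren wf_state_gauges by blast

section \<open>Existence and uniqueness of normal forms\<close>

definition nf :: "'a state \<Rightarrow> 'a state \<Rightarrow> bool" where
  "nf X N \<longleftrightarrow> red\<^sup>*\<^sup>* X N \<and> (\<nexists>Y. red N Y)"

lemma nf_exists:
  assumes "wf_state X"
  shows "\<exists>N. nf X N"
  using assms
proof (induction "mu X" arbitrary: X rule: less_induct)
  case less
  show ?case
  proof (cases "\<exists>Y. red X Y")
    case True
    then obtain Y where Y: "red X Y"
      by blast
    then obtain N where "nf Y N"
      using less mu_red wf_state_red by blast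
    then show ?thesis
      using Y unfolding nf_def by (meson converse_rtranclp_into_rtranclp)
  next
    case False
    then show ?thesis
      unfolding nf_def by blast
  qed
qed

lemma nf_equ:
  assumes "nf X N" "equ X X'"
  obtains N' where "nf X' N'" "equ N N'"
proof -
  obtain N' where N': "red\<^sup>*\<^sup>* X' N'" "equ N N'"
    using assms reds_equ unfolding nf_def by blast
  have "\<nexists>Y. red N' Y"
    using assms(1) equ_sym[OF N'(2)] red_equ unfolding nf_def by metis
  then show ?thesis
    using that N' unfolding nf_def by blast
qed

lemma nf_reds: "red\<^sup>*\<^sup>* X Y \<Longrightarrow> nf Y N \<Longrightarrow> nf X N"
  unfolding nf_def by auto

text \<open>Newman's lemma modulo \<open>equ\<close>, by induction on the measure. The first step
  from X' is transported back to X by \<open>red_equ\<close>, so that both reductions start with a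
  step from X and local confluence applies to this pair.\<close>

lemma nf_unique:
  assumes "wf_state X" "equ X X'" "nf X N" "nf X' N'"
  shows "equ N N'"
  using assms
proof (induction "mu X" arbitrary: X X' N N' rule: less_induct)
  case less
  have red': "\<exists>Y. red X Y" if "red X' Y'" for Y'
    using red_equ[OF equ_sym[OF less.prems(2)] that] by metis
  show ?case
  proof (cases "\<exists>Y. red X Y")
    case False
    then have "N = X" "N' = X'"
      using less.prems(3,4) red' unfolding nf_def by (metis converse_rtranclpE)+
    then show ?thesis
      using less.prems by simp
  next
    case True
    then have "X \<noteq> N"
      using less.prems(3) unfolding nf_def by blast
    then obtain Y1 where Y1: "red X Y1" "nf Y1 N"
      using less.prems(3) unfolding nf_def by (metis converse_rtranclpE)
    have "X' \<noteq> N'"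
      using less.prems(2,4) True red_equ unfolding nf_def by metis
    then obtain Y2' where Y2': "red X' Y2'" "nf Y2' N'"
      using less.prems(4) unfolding nf_def by (metis converse_rtranclpE)
    obtain Y2 where Y2: "red X Y2" "equ Y2' Y2"
      using red_equ[OF equ_sym[OF less.prems(2)] Y2'(1)] .
    have wf: "wf_state Y1" "wf_state Y2"
      using Y1(1) Y2(1) less.prems(1) wf_state_red by blast+
    have mu: "mu Y1 < mu X" "mu Y2 < mu X"
      using Y1(1) Y2(1) less.prems(1) mu_red by blast+
    obtain Z1 Z2 where Z: "red\<^sup>*\<^sup>* Y1 Z1" "red\<^sup>*\<^sup>* Y2 Z2" "gauge\<^sup>*\<^sup>* Z1 Z2"
      using local_confluence[OF less.prems(1) Y1(1) Y2(1)] unfolding joinable_def by blast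
    obtain W1 where W1: "nf Z1 W1"
      using nf_exists wf_state_reds Z(1) wf(1) by blast
    obtain W2 where W2: "nf Z2 W2" "equ W1 W2"
      using nf_equ[OF W1 equ_gauges[OF Z(3)]] .
    have "equ N W1"
      using less.hyps[OF mu(1) wf(1) equ_refl Y1(2)] nf_reds[OF Z(1) W1] by blast
    moreover have "equ W2 N'"
      using less.hyps[OF mu(2) wf(2) equ_sym[OF Y2(2)]] nf_reds[OF Z(2) W2(1)] Y2'(2) by blast
    ultimately show ?thesis
      using W2(2) equ_trans by blast
  qed
qed

definition sim :: "'a state \<Rightarrow> 'a state \<Rightarrow> bool" where
  "sim X Y \<longleftrightarrow> wf_state X \<and> wf_state Y \<and> (\<exists>N N'. nf X N \<and> nf Y N' \<and> equ N N')"

lemma simD: "sim X Y \<Longrightarrow> nf X N \<Longrightarrow> nf Y N' \<Longrightarrow> equ N N'"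
  unfolding sim_def by (meson equ_refl equ_sym equ_trans nf_unique)

lemma sim_trans: "sim X Y \<Longrightarrow> sim Y Z \<Longrightarrow> sim X Z"
  by (meson sim_def simD equ_trans)

lemma sim_sym: "sim X Y \<Longrightarrow> sim Y X"
  unfolding sim_def using equ_sym by blast

lemma sim_equ:
  assumes "wf_state X" "equ X Y"
  shows "sim X Y"
  using assms nf_exists nf_equ wf_state_equ unfolding sim_def by metis

lemma sim_refl: "wf_state X \<Longrightarrow> sim X X"
  by (rule sim_equ[OF _ equ_refl])

lemma sim_reds:
  assumes "wf_state X" "red\<^sup>*\<^sup>* X Y"
  shows "sim X Y"
  unfolding sim_def using assms nf_exists nf_reds wf_state_reds equ_refl by metis

section \<open>From graphs to labelled graphs\<close>

text \<open>The other end is recovered by \<open>THE\<close>, for a loop as well, so no order of the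
  two ends of an edge has to be chosen.\<close>

definition iedge :: "'a multiset \<Rightarrow> 'a dart multiset" where
  "iedge e = image_mset (\<lambda>u. (Some u, link, Some (THE v. e = {#u, v#}))) e"

lemma pair_mset_eq_iff: "{#a, b#} = {#c, d#} \<longleftrightarrow> a = c \<and> b = d \<or> a = d \<and> b = c"
  by (auto simp: add_eq_conv_ex)

lemma iedge_pair [simp]: "iedge {#u, v#} = ledge (Some u) link (Some v)"
proof -
  have "(THE w. {#u, v#} = {#u, w#}) = v" "(THE w. {#u, v#} = {#v, w#}) = u"
    by (auto simp: pair_mset_eq_iff)
  then show ?thesis
    by (simp add: iedge_def ledge_def)
qed

lemma size_2_pair:
  assumes "size e = 2"
  obtains u v where "e = {#u, v#}"
proof -
  obtain u N where e: "e = add_mset u N"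
    using assms by (cases e) auto
  then have "size N = 1"
    using assms by simp
  then obtain v where "N = {#v#}"
    using size_1_singleton_mset by blast
  then show ?thesis
    using that e by blast
qed

lemma edge_pair:
  assumes "weighted_graph \<Gamma>" "e \<in># edges \<Gamma>"
  obtains u v where "e = {#u, v#}" "u \<in> verts \<Gamma>" "v \<in> verts \<Gamma>"
proof -
  from assms have e: "size e = 2" "set_mset e \<subseteq> verts \<Gamma>"
    unfolding weighted_graph_def by auto
  then show ?thesis
    using that by (elim size_2_pair) auto
qed

text \<open>The weight is corrected by the loops because an inner blowup at a loop lowers it by 4 but
  also removes a loop.\<close>

definition lweight :: "'a wgraph \<Rightarrow> 'a \<Rightarrow> int" where
  "lweight \<Gamma> v = (if v \<in> verts \<Gamma> then weight \<Gamma> v - 2 * int (count (edges \<Gamma>) {#v, v#}) else 0)"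

definition init :: "'a wgraph \<Rightarrow> 'a state" where
  "init \<Gamma> = (verts \<Gamma>, lweight \<Gamma>, image_mset iedge (edges \<Gamma>))"

lemma wf_state_init: "weighted_graph \<Gamma> \<Longrightarrow> wf_state (init \<Gamma>)"
  by (auto simp: wf_state_def init_def weighted_graph_def) (metis iedge_pair size_2_pair)

lemma ldeg_iedge:
  assumes "\<forall>e\<in>#E. size e = 2"
  shows "ldeg x (image_mset iedge E) = (\<Sum>e\<in>#E. count e x)"
  using assms
proof (induction E)
  case (add e E)
  then have "ends_at x (iedge e) = count e x"
    by (auto elim!: size_2_pair)
  then show ?case
    using add by simp
qed simp

lemma ldeg_init:
  assumes "weighted_graph \<Gamma>"
  shows "ldeg x (image_mset iedge (edges \<Gamma>)) = degree \<Gamma> x"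
  using assms by (subst ldeg_iedge) (auto simp: weighted_graph_def degree_def)

lemma degree_outside: "weighted_graph \<Gamma> \<Longrightarrow> x \<notin> verts \<Gamma> \<Longrightarrow> degree \<Gamma> x = 0"
  by (auto simp: weighted_graph_def degree_def not_in_iff[symmetric])

section \<open>Birational invariance of the normal form\<close>

lemma simD_wf: "sim X Y \<Longrightarrow> wf_state X" "sim X Y \<Longrightarrow> wf_state Y"
  by (simp_all add: sim_def)

lemma gauge_two:
  "gauge\<^sup>*\<^sup>* (V, b, add_mset (ledge p g q) M)
    (V, bump (bump b p k) q l, add_mset (ledge p (shear (-k) * g * shear (-l)) q) M)"
proof -
  have *: "ledge p (shear (-k) * g) q = ledge q (star (shear (-k) * g)) p"
    "ledge p (shear (-k) * g * shear (-l)) q = ledge q (shear (-l) * star (shear (-k) * g)) p"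
    by (subst ledge_sym, simp add: mult.assoc)+
  have "gauge (V, bump b p k, add_mset (ledge p (shear (-k) * g) q) M)
    (V, bump (bump b p k) q l, add_mset (ledge p (shear (-k) * g * shear (-l)) q) M)"
    unfolding * by (rule gauge.gaugeI)
  then show ?thesis
    using gauge.gaugeI[of V b p g q M k]
    by (intro converse_rtranclp_into_rtranclp[OF _ r_into_rtranclp])
qed

text \<open>The new vertex is a leaf. Capped and suppressed, it turns by
  \<open>link_shear_link\<close> into a contractible end with both exponents 1, and contracting this
  end gives v its old weight back.\<close>

lemma sim_outer:
  assumes wf: "wf_state (V, b, M)" and x: "x \<notin> V" "b x = 0" "ldeg x M = 0" and v: "v \<in> V"
  shows "sim (V, b, M)
    (insert x V, b(v := b v - 1, x := -1), add_mset (ledge (Some v) link (Some x)) M)"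
proof -
  let ?X = "(insert x V, b(v := b v - 1, x := -1), add_mset (ledge (Some v) link (Some x)) M)"
  let ?e = "ledge (Some v) (shear 1 * link * shear 1) None"
  let ?Z = "(V, b(v := b v - 1), add_mset ?e M)"
  have vx: "v \<noteq> x"
    using x v by auto
  have wfX: "wf_state ?X"
    using wf by (auto simp: wf_state_def)
  have "red ?X (insert x V, b(v := b v - 1, x := -1),
      add_mset (ledge (Some x) link None) (add_mset (ledge (Some v) link (Some x)) M))"
    using x vx by (intro redI'[OF rl.cap[of x], where V = "insert x V"]) auto
  moreover have "red (insert x V, b(v := b v - 1, x := -1),
      add_mset (ledge (Some x) link None) (add_mset (ledge (Some v) link (Some x)) M)) ?Z"
    using x vx
    by (intro redI'[OF rl.elim[of "Some v" x None _ link link], where V = "insert x V" and M = M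
          and b = "b(v := b v - 1, x := -1)"])
      (auto simp: link_shear_link fun_upd_idem add_mset_commute)
  ultimately have XZ: "sim ?X ?Z"
    using wfX by (intro sim_reds) auto
  moreover have "sim (V, b, M) ?Z"
  proof (cases "ldeg v M \<ge> 2")
    case True
    then have "red ?Z (V, b, M)"
      using v by (intro redI'[OF rl.triv[of v _ 1 1], where V = V and M = M]) auto
    then show ?thesis
      using sim_sym[OF sim_reds[OF simD_wf(2)[OF XZ] r_into_rtranclp]] by blast
  next
    case False
    then have "red (V, b, M) (V, b, add_mset (ledge (Some v) link None) M)"
      using v by (intro redI'[OF rl.cap[of v], where V = V and M = M]) auto
    then have 1: "sim (V, b, M) (V, b, add_mset (ledge (Some v) link None) M)"
      using wf by (intro sim_reds) auto
    have "gauge\<^sup>*\<^sup>* (V, b, add_mset (ledge (Some v) link None) M) ?Z"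
      using gauge_two[of V b "Some v" link None M "-1" "-1"] by simp
    then have "sim (V, b, add_mset (ledge (Some v) link None) M) ?Z"
      using simD_wf(2)[OF 1] by (intro sim_equ equ_gauges)
    then show ?thesis
      using 1 sim_trans by blast
  qed
  ultimately show ?thesis
    using sim_trans sim_sym by blast
qed

text \<open>By \<open>link_shear_link\<close> the subdivided edge is the old one with a shear at
  either end, and gauge moves both shears into the weights. For u = v the weight is lowered by 2 in
  all, which is the effect of a blowup at a loop on \<open>lweight\<close>.\<close>

lemma sim_inner:
  assumes wf: "wf_state (V, b, M)" and x: "x \<notin> V" "b x = 0" "ldeg x M = 0"
    and uv: "u \<in> V" "v \<in> V"
  shows "sim (V, b, add_mset (ledge (Some u) link (Some v)) M)
    (insert x V, (bump (bump b (Some u) (-1)) (Some v) (-1))(x := -1),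
      add_mset (ledge (Some u) link (Some x)) (add_mset (ledge (Some x) link (Some v)) M))"
proof -
  let ?b = "bump (bump b (Some u) (-1)) (Some v) (-1)"
  let ?X = "(insert x V, ?b(x := -1),
      add_mset (ledge (Some u) link (Some x)) (add_mset (ledge (Some x) link (Some v)) M))"
  let ?Z = "(V, ?b, add_mset (ledge (Some u) (shear 1 * link * shear 1) (Some v)) M)"
  let ?Y = "(V, b, add_mset (ledge (Some u) link (Some v)) M)"
  have vx: "v \<noteq> x" "u \<noteq> x"
    using x uv by auto
  have wfX: "wf_state ?X" and wfY: "wf_state ?Y"
    using wf by (auto simp: wf_state_def)
  have "red ?X ?Z"
    using x vx
    by (intro redI'[OF rl.elim[of "Some u" x "Some v" _ link link], where V = "insert x V"
          and M = M and b = "?b(x := -1)"])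
      (auto simp: link_shear_link fun_upd_idem add_mset_commute)
  then have "sim ?X ?Z"
    using wfX by (intro sim_reds) auto
  moreover have "gauge\<^sup>*\<^sup>* ?Y ?Z"
    using gauge_two[of V b "Some u" link "Some v" M "-1" "-1"] by simp
  then have "sim ?Y ?Z"
    using wfY by (intro sim_equ equ_gauges)
  ultimately show ?thesis
    using sim_trans sim_sym by blast
qed

text \<open>States are renamed by bijections of the whole type, whereas an isomorphism of graphs is
  given on vertices only.\<close>

lemma finite_bij_extend:
  fixes f :: "'a \<Rightarrow> 'a"
  assumes "bij_betw f A B" "finite A"
  obtains \<pi> where "bij \<pi>" "\<And>x. x \<in> A \<Longrightarrow> \<pi> x = f x"
proof -
  let ?U = "A \<union> B"
  have fin: "finite B" "card A = card B"
    using assms bij_betw_finite bij_betw_same_card by blast+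
  have "card (?U - A) = card (?U - B)"
    using assms(2) fin by (simp add: card_Diff_subset)
  then obtain g where g: "bij_betw g (?U - A) (?U - B)"
    using assms(2) fin(1) by (metis finite_Diff finite_UnI finite_same_card_bij)
  let ?\<pi> = "\<lambda>x. if x \<in> A then f x else if x \<in> ?U - A then g x else x"
  have 1: "bij_betw ?\<pi> A B"
    using assms(1) by (rule bij_betw_cong[THEN iffD1, rotated]) auto
  have 2: "bij_betw ?\<pi> (?U - A) (?U - B)"
    using g by (rule bij_betw_cong[THEN iffD1, rotated]) auto
  have 3: "bij_betw ?\<pi> (- ?U) (- ?U)"
    using bij_betw_id[of "- ?U"] by (rule bij_betw_cong[THEN iffD1, rotated]) auto
  have "bij_betw ?\<pi> (A \<union> (?U - A) \<union> - ?U) (B \<union> (?U - B) \<union> - ?U)"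
    using bij_betw_combine[OF bij_betw_combine[OF 1 2] 3] by auto
  moreover have "A \<union> (?U - A) \<union> - ?U = UNIV" "B \<union> (?U - B) \<union> - ?U = UNIV"
    by auto
  ultimately show ?thesis
    using that[of ?\<pi>] by simp
qed

lemma count_image_mset_inj: "inj f \<Longrightarrow> count (image_mset f N) (f a) = count N a"
  by (induction N) (auto dest: injD)

lemma sim_isomorphic:
  assumes "weighted_graph \<Gamma>" "isomorphic \<Gamma> \<Gamma>'"
  shows "sim (init \<Gamma>) (init \<Gamma>')"
proof -
  obtain f where f: "bij_betw f (verts \<Gamma>) (verts \<Gamma>')"
    "image_mset (image_mset f) (edges \<Gamma>) = edges \<Gamma>'"
    "\<And>v. v \<in> verts \<Gamma> \<Longrightarrow> weight \<Gamma>' (f v) = weight \<Gamma> v"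
    using assms(2) unfolding isomorphic_def by blast
  have "finite (verts \<Gamma>)"
    using assms(1) by (simp add: weighted_graph_def)
  then obtain \<pi> where \<pi>: "bij \<pi>" "\<And>x. x \<in> verts \<Gamma> \<Longrightarrow> \<pi> x = f x"
    using finite_bij_extend[OF f(1)] by metis
  have inj: "inj \<pi>"
    using \<pi>(1) by (simp add: bij_is_inj)
  have V: "verts \<Gamma>' = \<pi> ` verts \<Gamma>"
    using f(1) \<pi>(2) by (auto simp: bij_betw_def image_iff)
  have E: "edges \<Gamma>' = image_mset (image_mset \<pi>) (edges \<Gamma>)"
    unfolding f(2)[symmetric]
  proof (intro image_mset_cong)
    fix e x assume "e \<in># edges \<Gamma>" "x \<in># e"
    then have "x \<in> verts \<Gamma>"
      using assms(1) by (auto simp: weighted_graph_def)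
    then show "f x = \<pi> x"
      using \<pi>(2) by simp
  qed
  have I: "iedge (image_mset \<pi> e) = ren_edge \<pi> (iedge e)" if e: "e \<in># edges \<Gamma>" for e
  proof -
    obtain u v where "e = {#u, v#}"
      by (rule edge_pair[OF assms(1) e])
    then show ?thesis
      by simp
  qed
  have L: "lweight \<Gamma>' (\<pi> v) = lweight \<Gamma> v" for v
  proof -
    have "count (edges \<Gamma>') {#\<pi> v, \<pi> v#} = count (edges \<Gamma>) {#v, v#}"
      using count_image_mset_inj[of "image_mset \<pi>" "edges \<Gamma>" "{#v, v#}"] inj
      by (simp add: E multiset.inj_map)
    moreover have "\<pi> v \<in> verts \<Gamma>' \<longleftrightarrow> v \<in> verts \<Gamma>"
      by (simp add: V inj_image_mem_iff[OF inj])
    moreover have "v \<in> verts \<Gamma> \<Longrightarrow> weight \<Gamma>' (\<pi> v) = weight \<Gamma> v"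
      using f(3) \<pi>(2) by simp
    ultimately show ?thesis
      by (simp add: lweight_def)
  qed
  have "lweight \<Gamma>' = lweight \<Gamma> \<circ> inv \<pi>"
    using L \<pi>(1) by (metis comp_apply ext bij_is_surj surj_f_inv_f)
  then have "init \<Gamma>' = ren \<pi> (init \<Gamma>)"
    using I by (auto simp: init_def V E multiset.map_comp intro!: image_mset_cong)
  then show ?thesis
    using sim_equ[OF wf_state_init[OF assms(1)] equ_ren[OF \<pi>(1)]] by simp
qed

lemma edges_outside: "weighted_graph \<Gamma> \<Longrightarrow> x \<notin> verts \<Gamma> \<Longrightarrow> e \<in># edges \<Gamma> \<Longrightarrow> x \<notin># e"
  by (auto simp: weighted_graph_def)

lemma sim_blowup:
  assumes "blowup \<Gamma> \<Gamma>'"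
  shows "sim (init \<Gamma>) (init \<Gamma>')"
proof -
  have wf: "weighted_graph \<Gamma>" "weighted_graph \<Gamma>'"
    using assms by (auto simp: blowup_def)
  have out: "count (edges \<Gamma>) {#x, x#} = 0" if "x \<notin> verts \<Gamma>" for x
    using edges_outside[OF wf(1) that] by (metis count_eq_zero_iff union_single_eq_member)
  from assms consider "outer_blowup \<Gamma> \<Gamma>'" | "inner_blowup \<Gamma> \<Gamma>'"
    by (auto simp: blowup_def)
  then show ?thesis
  proof cases
    case 1
    then obtain v x where v: "v \<in> verts \<Gamma>" and x: "x \<notin> verts \<Gamma>"
      and G: "verts \<Gamma>' = insert x (verts \<Gamma>)" "edges \<Gamma>' = edges \<Gamma> + {# {#v, x#} #}"
        "weight \<Gamma>' = (weight \<Gamma>)(v := weight \<Gamma> v - 1, x := -1)"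
      unfolding outer_blowup_def by blast
    have "lweight \<Gamma>' y = ((lweight \<Gamma>)(v := lweight \<Gamma> v - 1, x := -1)) y" for y
      using v x out[OF x] by (auto simp: lweight_def G pair_mset_eq_iff)
    then have "lweight \<Gamma>' = (lweight \<Gamma>)(v := lweight \<Gamma> v - 1, x := -1)"
      by (rule ext)
    then have "init \<Gamma>' = (insert x (verts \<Gamma>), (lweight \<Gamma>)(v := lweight \<Gamma> v - 1, x := -1),
      add_mset (ledge (Some v) link (Some x)) (image_mset iedge (edges \<Gamma>)))"
      by (simp add: init_def G)
    then show ?thesis
      using sim_outer[of "verts \<Gamma>" "lweight \<Gamma>" "image_mset iedge (edges \<Gamma>)" x v]
        wf_state_init[OF wf(1)] v x degree_outside[OF wf(1) x] ldeg_init[OF wf(1)]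
      by (simp add: init_def lweight_def)
  next
    case 2
    then obtain u v x where uv: "{#u, v#} \<in># edges \<Gamma>" and x: "x \<notin> verts \<Gamma>"
      and G: "verts \<Gamma>' = insert x (verts \<Gamma>)"
        "edges \<Gamma>' = edges \<Gamma> - {# {#u, v#} #} + {# {#u, x#}, {#x, v#} #}"
        "weight \<Gamma>' = (if u \<noteq> v then (weight \<Gamma>)(u := weight \<Gamma> u - 1, v := weight \<Gamma> v - 1, x := -1)
          else (weight \<Gamma>)(u := weight \<Gamma> u - 4, x := -1))"
      unfolding inner_blowup_def by blast
    obtain E where E: "edges \<Gamma> = add_mset {#u, v#} E"
      using uv by (meson multi_member_split)
    have mem: "u \<in> verts \<Gamma>" "v \<in> verts \<Gamma>"
      using wf(1) uv by (auto simp: weighted_graph_def)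
    have "lweight \<Gamma>' y = ((bump (bump (lweight \<Gamma>) (Some u) (-1)) (Some v) (-1))(x := -1)) y" for y
      using mem x out[OF x] by (auto simp: lweight_def G E pair_mset_eq_iff)
    then have "lweight \<Gamma>' = (bump (bump (lweight \<Gamma>) (Some u) (-1)) (Some v) (-1))(x := -1)"
      by (rule ext)
    then have "init \<Gamma>' = (insert x (verts \<Gamma>),
        (bump (bump (lweight \<Gamma>) (Some u) (-1)) (Some v) (-1))(x := -1),
        add_mset (ledge (Some u) link (Some x)) (add_mset (ledge (Some x) link (Some v))
          (image_mset iedge E)))"
      by (simp add: init_def G E)
    moreover have "init \<Gamma> = (verts \<Gamma>, lweight \<Gamma>,
        add_mset (ledge (Some u) link (Some v)) (image_mset iedge E))"
      by (simp add: init_def E)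
    moreover have "wf_state (verts \<Gamma>, lweight \<Gamma>, image_mset iedge E)"
      using wf_state_init[OF wf(1)] by (auto simp: wf_state_def init_def E)
    moreover have "ldeg x (image_mset iedge E) = 0"
      using degree_outside[OF wf(1) x] ldeg_init[OF wf(1), of x] by (simp add: E)
    ultimately show ?thesis
      using sim_inner[of "verts \<Gamma>" "lweight \<Gamma>" "image_mset iedge E" x u v] mem x
      by (simp add: lweight_def)
  qed
qed

lemma sim_birational:
  assumes "birationally_equivalent \<Gamma> \<Gamma>'" "weighted_graph \<Gamma>"
  shows "sim (init \<Gamma>) (init \<Gamma>')"
  using assms(1) unfolding birationally_equivalent_def
proof (induction rule: rtranclp_induct)
  case base
  then show ?case
    using assms(2) wf_state_init sim_refl by blast
next
  case (step \<Delta> \<Delta>')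
  have "sim (init \<Delta>) (init \<Delta>')"
    using step(2) sim_blowup sim_sym sim_isomorphic
    unfolding birational_step_def blowdown_def by blast
  then show ?case
    using step sim_trans by blast
qed

section \<open>Words of standard chains\<close>

text \<open>There is one \<open>link\<close> more than there are vertices: the chain is attached by
  an edge on both sides, possibly to infinity.\<close>

fun word :: "int list \<Rightarrow> lab" where
  "word [] = link"
| "word (w # ws) = link * shear w * word ws"

lemma word_append: "word (us @ w # vs) = word us * shear w * word vs"
  by (induction us) (auto simp: mult.assoc)

lemma star_word: "star (word ws) = word (rev ws)"
  by (induction ws) (auto simp: word_append[of _ _ "[]", simplified] mult.assoc)

text \<open>For determinant 1 the matrix is then plus or minus a shear; equivalently, g commutes
  with all shears.\<close>

definition is_z :: "lab \<Rightarrow> bool" where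
  "is_z g \<longleftrightarrow> (case g of Lab p q r s n \<Rightarrow> r = 0)"

definition ldet :: "lab \<Rightarrow> int" where
  "ldet g = (case g of Lab p q r s n \<Rightarrow> p * s - q * r)"

text \<open>The power of the shear that splits off on the left: multiplying by
  \<open>shear k\<close> adds k r to p. If r = 0 and the determinant is 1, then s is 1 or -1 and the
  matrix is s times the shear by q s.\<close>

definition lsh :: "lab \<Rightarrow> int" where
  "lsh g = (case g of Lab p q r s n \<Rightarrow> if r = 0 then q * s else p div r)"

lemma ldet_mult [simp]: "ldet (g * h) = ldet g * ldet h"
  by (cases g; cases h) (simp add: ldet_def algebra_simps)

lemma ldet_simps [simp]: "ldet (shear k) = 1" "ldet link = 1" "ldet (star g) = ldet g"
  by (cases g; simp add: ldet_def shear_def link_def)+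

lemma ldet_word [simp]: "ldet (word ws) = 1"
  by (induction ws) auto

lemma is_z_simps [simp]:
  "is_z (shear k * g) = is_z g" "is_z (g * shear k) = is_z g" "is_z (star g) = is_z g"
  by (cases g; simp add: is_z_def shear_def)+

lemma det_one_diag:
  assumes "p * s = (1::int)"
  shows "p = s" "s * s = 1"
  using assms by (auto simp: zmult_eq_1_iff)

lemma lsh_shear_left:
  assumes "ldet g = 1"
  shows "lsh (shear k * g) = lsh g + k"
proof (cases g)
  case (Lab p q r s n)
  show ?thesis
  proof (cases "r = 0")
    case True
    then have "s * s = 1"
      using assms det_one_diag by (auto simp: ldet_def Lab)
    then have "k * s * s = k"
      by (simp add: mult.assoc)
    then show ?thesis
      using True by (simp add: Lab lsh_def shear_def algebra_simps)
  qed (simp add: Lab lsh_def shear_def)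
qed

lemma lsh_shear_right:
  assumes "\<not> is_z g"
  shows "lsh (g * shear k) = lsh g"
  using assms by (cases g) (simp add: lsh_def shear_def is_z_def)

lemma lsh_star:
  assumes "is_z g" "ldet g = 1"
  shows "lsh (star g) = lsh g"
  using assms det_one_diag by (cases g) (auto simp: lsh_def is_z_def ldet_def)

lemma is_z_central:
  assumes "is_z g" "ldet g = 1"
  shows "shear k * g = g * shear k"
  using assms det_one_diag(1) by (cases g) (auto simp: is_z_def ldet_def shear_def)

text \<open>A representative of the double coset of \<open>g\<close> modulo shears.\<close>

definition canon :: "lab \<Rightarrow> lab" where
  "canon g = (if is_z g then shear (- lsh g) * g else shear (- lsh g) * g * shear (- lsh (star g)))"

lemma canon_shear:
  assumes "ldet g = 1"
  shows "canon (shear k * g) = canon g"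
proof (cases "is_z g")
  case False
  then show ?thesis
    using assms lsh_shear_right[of "star g"] by (simp add: canon_def lsh_shear_left mult.assoc)
qed (use assms in \<open>simp add: canon_def lsh_shear_left\<close>)

lemma canon_star:
  assumes "ldet g = 1"
  shows "canon (star g) = star (canon g)"
proof (cases "is_z g")
  case True
  then show ?thesis
    using assms is_z_central[of "star g"] by (simp add: canon_def lsh_star)
qed (simp add: canon_def mult.assoc)

section \<open>Gauge invariants of labelled graphs\<close>

definition canon_edge :: "'a dart multiset \<Rightarrow> 'a dart multiset" where
  "canon_edge = image_mset (\<lambda>(p, g, q). (p, canon g, q))"

lemma canon_edge_ledge: "ldet g = 1 \<Longrightarrow> canon_edge (ledge p g q) = ledge p (canon g) q"
  by (simp add: canon_edge_def ledge_def canon_star)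

definition det_one :: "'a dart multiset multiset \<Rightarrow> bool" where
  "det_one M \<longleftrightarrow> (\<forall>e\<in>#M. \<forall>(p, g, q)\<in>#e. ldet g = 1)"

text \<open>If no edge labelled by a multiple of the identity matrix leaves \<open>K\<close>, then the weights on
  \<open>K\<close> together with the shears that can be split off the labels at \<open>K\<close> have a
  gauge-invariant sum. It is doubled since the shear of an edge inside \<open>K\<close> labelled by a multiple
  of the identity is counted at both ends.\<close>

definition z_closed :: "'a set \<Rightarrow> 'a dart multiset multiset \<Rightarrow> bool" where
  "z_closed K M \<longleftrightarrow> (\<forall>e\<in>#M. \<forall>(p, g, q)\<in>#e. is_z g \<longrightarrow> (p \<in> Some ` K \<longleftrightarrow> q \<in> Some ` K))"

definition dart_pot :: "'a set \<Rightarrow> 'a dart \<Rightarrow> int" where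
  "dart_pot K = (\<lambda>(p, g, q). if p \<in> Some ` K then (if is_z g then lsh g else 2 * lsh g) else 0)"

definition pot :: "'a set \<Rightarrow> ('a \<Rightarrow> int) \<Rightarrow> 'a dart multiset multiset \<Rightarrow> int" where
  "pot K b M = 2 * (\<Sum>x\<in>K. b x) + (\<Sum>e\<in>#M. \<Sum>d\<in>#e. dart_pot K d)"

lemma det_one_add [simp]: "det_one (add_mset (ledge p g q) M) \<longleftrightarrow> ldet g = 1 \<and> det_one M"
  by (simp add: det_one_def ledge_def)

lemma z_closed_add [simp]: "z_closed K (add_mset (ledge p g q) M) \<longleftrightarrow>
    (is_z g \<longrightarrow> (p \<in> Some ` K \<longleftrightarrow> q \<in> Some ` K)) \<and> z_closed K M"
  unfolding z_closed_def ledge_def by (simp del: image_iff) blast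

lemma pot_add: "pot K b (add_mset (ledge p g q) M) =
    pot K b M + dart_pot K (p, g, q) + dart_pot K (q, star g, p)"
  by (simp add: pot_def ledge_def)

lemma sum_bump:
  assumes "finite K"
  shows "(\<Sum>x\<in>K. bump b p k x) = (\<Sum>x\<in>K. b x) + (if p \<in> Some ` K then k else 0)"
proof (cases p)
  case (Some y)
  show ?thesis
  proof (cases "y \<in> K")
    case True
    have "(\<Sum>x\<in>K. bump b p k x) = (b y + k) + (\<Sum>x\<in>K - {y}. bump b p k x)"
      using assms True by (subst sum.remove) (auto simp: Some)
    also have "(\<Sum>x\<in>K - {y}. bump b p k x) = (\<Sum>x\<in>K - {y}. b x)"
      by (intro sum.cong) (auto simp: Some)
    finally show ?thesis
      using assms True by (simp add: Some sum.remove)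
  next
    case False
    then show ?thesis
      by (auto simp: Some intro!: sum.cong)
  qed
qed auto

text \<open>If p lies in K, the weight gains k, which counts 2 k in \<open>pot\<close>. A label that
  is not \<open>is_z\<close> loses 2 k at p while its reverse loses nothing, having the shear on its
  right; an \<open>is_z\<close> label loses k in both directions, and its other end lies in K
  too.\<close>

lemma gauge_invariants:
  assumes "gauge (V, b, M) (V', b', M')" "det_one M"
  shows "V' = V" "det_one M'" "image_mset canon_edge M' = image_mset canon_edge M"
    "z_closed K M \<Longrightarrow> z_closed K M'"
    "finite K \<Longrightarrow> z_closed K M \<Longrightarrow> pot K b' M' = pot K b M"
proof -
  from assms(1) obtain p g q N k where X: "V' = V" "M = add_mset (ledge p g q) N"
    "b' = bump b p k" "M' = add_mset (ledge p (shear (-k) * g) q) N"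
    by (cases rule: gauge.cases) auto
  have det: "ldet g = 1"
    using assms(2) by (simp add: X)
  show "V' = V" "det_one M'"
    using assms(2) by (simp_all add: X)
  show "image_mset canon_edge M' = image_mset canon_edge M"
    using det by (simp add: X canon_edge_ledge canon_shear)
  show "z_closed K M'" if "z_closed K M"
    using that by (simp add: X)
  show "pot K b' M' = pot K b M" if fin: "finite K" and z: "z_closed K M"
  proof (cases "is_z g")
    case True
    then have "p \<in> Some ` K \<longleftrightarrow> q \<in> Some ` K"
      using z by (simp add: X)
    moreover have "lsh (star (shear (-k) * g)) = lsh g - k" "lsh (star g) = lsh g"
      using True det lsh_star[of "shear (-k) * g"] by (simp_all add: lsh_star lsh_shear_left)
    ultimately show ?thesis
      using True det by (simp add: X pot_add) (simp add: pot_def sum_bump fin dart_pot_def lsh_shear_left)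
  next
    case False
    then show ?thesis
      using det by (simp add: X pot_add)
        (simp add: pot_def sum_bump fin dart_pot_def lsh_shear_left lsh_shear_right)
  qed
qed

lemma gauges_invariants:
  assumes "gauge\<^sup>*\<^sup>* (V, b, M) (V', b', M')" "det_one M"
  shows "V' = V \<and> det_one M' \<and> image_mset canon_edge M' = image_mset canon_edge M \<and>
    (finite K \<longrightarrow> z_closed K M \<longrightarrow> z_closed K M' \<and> pot K b' M' = pot K b M)"
  using assms(1)
proof (induction "(V', b', M')" arbitrary: V' b' M' rule: rtranclp_induct)
  case base
  then show ?case
    using assms(2) by simp
next
  case (step Y)
  obtain V1 b1 M1 where Y: "Y = (V1, b1, M1)"
    by (cases Y)
  note IH = step(3)[OF Y]
  note gi = gauge_invariants(1-3)[OF step(2)[unfolded Y]]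
    gauge_invariants(4,5)[OF step(2)[unfolded Y], of K]
  show ?case
    using IH gi by metis
qed

section \<open>Central powers and continued fractions\<close>

definition zc :: lab where
  "zc = link * link"

text \<open>The matrix is minus the identity, of order 2; it is the last coordinate, 6 at
  \<open>zc\<close>, that keeps all powers apart.\<close>

lemma zc_power: "zc ^ k = Lab ((-1) ^ k) 0 0 ((-1) ^ k) (6 * int k)"
  by (induction k) (auto simp: zc_def link_def one_lab_def)

lemma zc_central: "zc ^ k * g = g * zc ^ k"
  by (cases g) (simp add: zc_power)

lemma star_zc [simp]: "star (zc ^ k) = zc ^ k"
  by (simp add: zc_power)

lemma word_zeros: "word (replicate (2 * k) 0 @ us) = zc ^ k * word us"
  by (induction k) (auto simp: zc_def mult.assoc)

lemma word_zeros_right: "word (us @ replicate (2 * k) 0) = zc ^ k * word us"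
proof -
  have "word (us @ replicate (2 * k) 0) = star (word (replicate (2 * k) 0 @ rev us))"
    by (simp add: star_word)
  also have "\<dots> = zc ^ k * word us"
    unfolding word_zeros by (simp add: star_word zc_central)
  finally show ?thesis .
qed

lemma word_odd_zeros: "word (replicate (2 * k + 1) 0) = zc ^ Suc k"
proof -
  have "replicate (2 * k + 1) 0 = replicate (2 * k) 0 @ [0::int]"
    by (simp add: replicate_append_same)
  then show ?thesis
    using word_zeros[of k "[0]"] by (simp add: zc_def zc_central[symmetric] power_Suc2 del: power_Suc)
qed

definition le_m2 :: "int list \<Rightarrow> bool" where
  "le_m2 us \<longleftrightarrow> (\<forall>u\<in>set us. u \<le> -2)"

lemma le_m2_simps [simp]: "le_m2 []" "le_m2 (u # us) \<longleftrightarrow> u \<le> -2 \<and> le_m2 us" "le_m2 (rev us) = le_m2 us"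
  by (auto simp: le_m2_def)

text \<open>The ratio p / r of the first column stays in the interval [0, 1): it is 0 for the empty
  word, and a further entry u in front replaces it by 1 / (-u - p / r), where -u is at least
  2.\<close>

lemma word_le_m2_ex:
  assumes "le_m2 us"
  shows "\<exists>p q r s n. word us = Lab p q r s n \<and> r < 0 \<and> r < p \<and> p \<le> 0"
  using assms
proof (induction us)
  case Nil
  then show ?case
    by (simp add: link_def)
next
  case (Cons u us)
  obtain p q r s n where us: "word us = Lab p q r s n" "r < 0" "r < p" "p \<le> 0"
    using Cons by auto
  have w: "word (u # us) = Lab r s (- p - u * r) (- q - u * s) (n + u + 3)"
    by (simp add: us link_def shear_def algebra_simps)
  have "(- u - 2) * r \<le> 0"
    using Cons.prems us(2) by (intro mult_nonneg_nonpos) auto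
  then have "- p - u * r < r"
    using us by (simp add: algebra_simps)
  then show ?case
    using w us by simp
qed

lemma word_le_m2:
  assumes "le_m2 us"
  obtains p q r s n where "word us = Lab p q r s n" "r < 0" "r < p" "p \<le> 0"
  using word_le_m2_ex[OF assms] by blast

text \<open>The first column of the matrix of \<open>word us\<close> is a fraction whose Hirzebruch-Jung continued
  fraction has the coefficients \<open>- us\<close>.\<close>

lemma word_le_m2_inj:
  assumes "le_m2 us" "le_m2 vs" "word us = Lab p q r s n" "word vs = Lab p q' r s' n'"
  shows "us = vs"
  using assms
proof (induction us arbitrary: vs p q r s n q' s' n')
  case Nil
  then have "p = 0"
    by (simp add: link_def)
  show ?case
  proof (cases vs)
    case (Cons v vs')
    have "le_m2 vs'"
      using Nil Cons by simp
    then obtain p1 q1 r1 s1 n1 where "word vs' = Lab p1 q1 r1 s1 n1" "r1 < 0"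
      by (rule word_le_m2)
    then show ?thesis
      using Nil \<open>p = 0\<close> by (simp add: Cons link_def shear_def)
  qed simp
next
  case (Cons u us)
  have "le_m2 us"
    using Cons by simp
  then obtain p1 q1 r1 s1 n1 where us: "word us = Lab p1 q1 r1 s1 n1" "r1 < 0" "r1 < p1" "p1 \<le> 0"
    by (rule word_le_m2)
  have pr: "p = r1" "r = - p1 - u * r1"
    using Cons.prems(3) us by (auto simp: link_def shear_def)
  show ?case
  proof (cases vs)
    case Nil
    then show ?thesis
      using Cons.prems(4) pr us by (simp add: link_def)
  next
    case vs: (Cons v vs')
    have "le_m2 vs'"
      using Cons vs by simp
    then obtain p2 q2 r2 s2 n2 where vs': "word vs' = Lab p2 q2 r2 s2 n2" "r2 < 0" "r2 < p2" "p2 \<le> 0"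
      by (rule word_le_m2)
    have pr': "p = r2" "r = - p2 - v * r2"
      using Cons.prems(4) vs vs' by (auto simp: link_def shear_def)
    have r: "r1 = r2"
      using pr pr' by simp
    \<comment> \<open>Uniqueness of division with remainder: the remainders p1 and p2 both lie above
      r1 and are at most 0, so they differ by less than the absolute value of r1.\<close>
    have uv: "(v - u) * r1 = p1 - p2"
      using pr pr' r by (simp add: algebra_simps)
    have "u = v"
    proof (rule ccontr)
      assume "u \<noteq> v"
      then have "\<bar>v - u\<bar> \<ge> 1"
        by simp
      then have "\<bar>v - u\<bar> * \<bar>r1\<bar> \<ge> 1 * \<bar>r1\<bar>"
        by (intro mult_right_mono) auto
      then have "\<bar>p1 - p2\<bar> \<ge> \<bar>r1\<bar>"
        by (simp add: uv[symmetric] abs_mult)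
      then show False
        using us vs' r by linarith
    qed
    moreover have "us = vs'"
      using Cons.IH[of vs' p1 q1 r1 s1 n1] Cons.prems us vs' vs r uv \<open>u = v\<close> by simp
    ultimately show ?thesis
      by (simp add: vs)
  qed
qed

text \<open>Standard up to reversion: the two blocks may come in either order, but \<open>us\<close>
  itself is read in the same direction.\<close>

definition even_std :: "nat \<Rightarrow> int list \<Rightarrow> int list \<Rightarrow> bool" where
  "even_std k us ws \<longleftrightarrow> le_m2 us \<and> (ws = replicate (2 * k) 0 @ us \<or> ws = us @ replicate (2 * k) 0)"

definition std :: "int list \<Rightarrow> bool" where
  "std ws \<longleftrightarrow> (\<exists>k us. even_std k us ws) \<or> (\<exists>k. ws = replicate (2 * k + 1) 0)"

lemma word_even_std: "even_std k us ws \<Longrightarrow> word ws = zc ^ k * word us"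
  by (auto simp: even_std_def word_zeros word_zeros_right)

lemma sign_cases: "(-1::int) ^ k = 1 \<or> (-1::int) ^ k = -1"
  by (induction k) auto

text \<open>From r < p \<le> 0 the quotient p div r is 0, and the sign of \<open>zc ^ k\<close>
  cancels in it. Hence words of standard chains will be their own canonical representatives.\<close>

lemma lsh_even:
  assumes "le_m2 us"
  shows "lsh (zc ^ k * word us) = 0" "\<not> is_z (zc ^ k * word us)"
proof -
  obtain p q r s n where us: "word us = Lab p q r s n" "r < 0" "r < p" "p \<le> 0"
    using assms by (rule word_le_m2)
  have "p div r = 0"
    using us by (intro div_neg_neg_trivial)
  then show "lsh (zc ^ k * word us) = 0" "\<not> is_z (zc ^ k * word us)"
    using us sign_cases[of k] by (auto simp: zc_power lsh_def is_z_def)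
qed

lemma lsh_zc [simp]: "lsh (zc ^ k) = 0" "is_z (zc ^ k)"
  by (simp_all add: zc_power lsh_def is_z_def)

lemma lsh_std:
  assumes "std ws"
  shows "lsh (word ws) = 0"
proof -
  from assms consider k us where "even_std k us ws" | k where "ws = replicate (2 * k + 1) 0"
    unfolding std_def by blast
  then show ?thesis
  proof cases
    case 1
    then show ?thesis
      using lsh_even(1) by (simp add: word_even_std even_std_def)
  next
    case 2
    then show ?thesis
      by (simp only: word_odd_zeros lsh_zc)
  qed
qed

lemma std_rev: "std ws \<Longrightarrow> std (rev ws)"
  unfolding std_def even_std_def by (metis le_m2_simps(3) rev_append rev_replicate)

lemma canon_std: "std ws \<Longrightarrow> canon (word ws) = word ws"
  by (simp add: canon_def lsh_std star_word std_rev)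

lemma is_z_std:
  assumes "std ws" "is_z (word ws)"
  shows "\<exists>k. ws = replicate (2 * k + 1) 0"
  using assms lsh_even(2) by (auto simp: std_def word_even_std) (auto simp: even_std_def)

text \<open>The lower left entries of \<open>word us\<close> and \<open>word us'\<close> are both
  negative, so equal products force equal signs. Then the continued fractions agree, and the last
  coordinate, 6 k plus a common term, separates k from k'.\<close>

lemma word_eq_even:
  assumes "even_std k us ws" "even_std k' us' ws'" "word ws = word ws'"
  shows "k = k' \<and> us = us'"
proof -
  have neg: "le_m2 us" "le_m2 us'"
    using assms by (auto simp: even_std_def)
  obtain p q r s n where us: "word us = Lab p q r s n" "r < 0" "r < p" "p \<le> 0"
    using neg(1) by (rule word_le_m2)
  obtain p' q' r' s' n' where us': "word us' = Lab p' q' r' s' n'" "r' < 0" "r' < p'" "p' \<le> 0"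
    using neg(2) by (rule word_le_m2)
  have eq: "zc ^ k * word us = zc ^ k' * word us'"
    using assms by (simp add: word_even_std)
  then have "p = p' \<and> r = r'"
    using us us' sign_cases[of k] sign_cases[of k'] by (auto simp: zc_power)
  then have "us = us'"
    using word_le_m2_inj[OF neg] us us' by blast
  then show ?thesis
    using eq us by (simp add: zc_power)
qed

lemma word_eq_std:
  assumes "std ws" "std ws'" "word ws = word ws'"
  shows "ws = ws' \<or> (\<exists>k us. even_std k us ws \<and> even_std k us ws')"
proof -
  have "(is_z (word ws) \<longleftrightarrow> is_z (word ws'))"
    using assms(3) by simp
  then consider k k' where "ws = replicate (2 * k + 1) 0" "ws' = replicate (2 * k' + 1) 0"
    | k us k' us' where "even_std k us ws" "even_std k' us' ws'"
    using assms(1,2) is_z_std word_odd_zeros lsh_zc(2) unfolding std_def by metis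
  then show ?thesis
  proof cases
    case 1
    then have "zc ^ Suc k = zc ^ Suc k'"
      using assms(3) by (simp only: word_odd_zeros)
    then show ?thesis
      using 1 by (simp add: zc_power del: power_Suc)
  next
    case 2
    then show ?thesis
      using word_eq_even assms(3) by metis
  qed
qed

text \<open>A contractible label has lower left entry -1. This forces sign +1, r = -1 and p = 0, so
  \<open>us\<close> is empty; then m = n = 0, and the last coordinate 6 k + 3 = 3 excludes zeros. It
  is the reason why standard graphs are irreducible.\<close>

lemma word_std_not_trivial:
  assumes "std ws" "ws \<noteq> []"
  shows "word ws \<noteq> shear m * link * shear n"
proof
  assume eq: "word ws = shear m * link * shear n"
  have triv: "shear m * link * shear n = Lab (-m) (1 - m * n) (-1) (-n) (m + n + 3)"
    by (simp add: shear_def link_def algebra_simps)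
  have "\<not> is_z (word ws)"
    unfolding eq triv by (simp add: is_z_def)
  then obtain k us where ws: "even_std k us ws"
    using assms(1) word_odd_zeros lsh_zc(2) unfolding std_def by metis
  then have neg: "le_m2 us"
    by (simp add: even_std_def)
  obtain p q r s n' where us: "word us = Lab p q r s n'" "r < 0" "r < p" "p \<le> 0"
    using neg by (rule word_le_m2)
  have eq': "zc ^ k * word us = Lab (-m) (1 - m * n) (-1) (-n) (m + n + 3)"
    using eq triv word_even_std[OF ws] by simp
  then have sg: "(-1::int) ^ k = 1" "r = -1" "p = 0"
    using us sign_cases[of k] by (auto simp: zc_power)
  then have "us = []"
    using word_le_m2_inj[OF neg _ us(1), of "[]"] us by (simp add: link_def)
  then have "k = 0"
    using eq' sg by (simp add: zc_power link_def)
  then show False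
    using ws assms(2) \<open>us = []\<close> by (simp add: even_std_def)
qed

section \<open>Decomposing a graph into paths\<close>

definition path_edges :: "'a list \<Rightarrow> 'a multiset multiset" where
  "path_edges vs = mset (map (\<lambda>(u, v). {#u, v#}) (zip vs (tl vs)))"

lemma path_edges_simps [simp]:
  "path_edges [] = {#}"
  "path_edges [x] = {#}"
  "path_edges (x # y # vs) = add_mset {#x, y#} (path_edges (y # vs))"
  by (simp_all add: path_edges_def)

lemma path_edges_append:
  "path_edges (us @ x # vs) = path_edges (us @ [x]) + path_edges (x # vs)"
proof (induction us rule: induct_list012)
  case (2 a)
  then show ?case
    by simp
next
  case (3 a b us)
  then show ?case
    by simp
qed simp

lemma path_edges_rev [simp]: "path_edges (rev vs) = path_edges vs"
proof (induction vs rule: induct_list012)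
  case (3 x y vs)
  have "path_edges (rev (x # y # vs)) = path_edges (rev vs @ [y]) + path_edges [y, x]"
    using path_edges_append[of "rev vs" y "[x]"] by simp
  then show ?case
    using 3 by (simp add: add_mset_commute)
qed auto

lemma path_edges_subset: "e \<in># path_edges vs \<Longrightarrow> set_mset e \<subseteq> set vs"
  by (induction vs rule: induct_list012) auto

lemma path_edges_image: "image_mset (image_mset f) (path_edges vs) = path_edges (map f vs)"
  by (induction vs rule: induct_list012) auto

text \<open>Every occurrence of v in the list has two neighbours, except that one is missing at
  either end of the list.\<close>

lemma path_edges_degree:
  assumes "vs \<noteq> []"
  shows "(\<Sum>e\<in>#path_edges vs. count e v) + (if hd vs = v then 1 else 0) + (if last vs = v then 1 else 0)
    = 2 * count (mset vs) v"
  using assms by (induction vs rule: induct_list012) auto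

text \<open>A triple \<open>(p, xs, q)\<close> is a path through the vertices \<open>xs\<close> from \<open>p\<close> to \<open>q\<close>, where \<open>None\<close>
  stands for a free end.\<close>

type_synonym 'a triple = "'a option \<times> 'a list \<times> 'a option"

definition opt :: "'a option \<Rightarrow> 'a list" where
  "opt p = (case p of None \<Rightarrow> [] | Some x \<Rightarrow> [x])"

lemma opt_simps [simp]: "opt None = []" "opt (Some x) = [x]" "set (opt p) = set_option p"
  "rev (opt p) = opt p" "map f (opt p) = opt (map_option f p)" 
  by (cases p; simp add: opt_def)+

fun full :: "'a triple \<Rightarrow> 'a list" where
  "full (p, xs, q) = opt p @ xs @ opt q"

fun inner :: "'a triple \<Rightarrow> 'a list" where
  "inner (p, xs, q) = xs"

fun flip :: "'a triple \<Rightarrow> 'a triple" where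
  "flip (p, xs, q) = (q, rev xs, p)"

text \<open>A path without inner vertices has to be an actual edge. With a free end it would carry
  the label \<open>link\<close> although no edge of the graph stands behind it.\<close>

fun ok :: "'a set \<Rightarrow> 'a triple \<Rightarrow> bool" where
  "ok A (p, xs, q) \<longleftrightarrow> set_option p \<subseteq> A \<and> set_option q \<subseteq> A \<and> (xs = [] \<longrightarrow> p \<noteq> None \<and> q \<noteq> None)"

fun slabel :: "('a \<Rightarrow> int) \<Rightarrow> 'a triple \<Rightarrow> 'a dart multiset" where
  "slabel b (p, xs, q) = ledge p (word (map b xs)) q"

lemma opt_eq_Nil [simp]: "opt p = [] \<longleftrightarrow> p = None"
  by (cases p) simp_all

lemma slabel_flip: "slabel b (flip t) = slabel b t"
proof (cases t)
  case (fields p xs q)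
  show ?thesis
    unfolding fields flip.simps slabel.simps by (subst ledge_sym) (simp add: star_word rev_map)
qed

lemma flip_simps [simp]: "full (flip t) = rev (full t)" "inner (flip t) = rev (inner t)"
  "ok A (flip t) = ok A t" "slabel b (flip t) = slabel b t" "flip (flip t) = t"
  by (simp_all only: slabel_flip) (cases t; auto)+

text \<open>For a finite graph the equality of multisets makes the inner lists free of repetitions,
  pairwise disjoint and a cover of the vertices outside A; likewise every edge lies on exactly one
  path, with multiplicity.\<close>

definition decomp :: "'a wgraph \<Rightarrow> 'a set \<Rightarrow> 'a triple multiset \<Rightarrow> bool" where
  "decomp \<Gamma> A ts \<longleftrightarrow> A \<subseteq> verts \<Gamma> \<and>
     mset_set (verts \<Gamma>) = mset_set A + (\<Sum>t\<in>#ts. mset (inner t)) \<and>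
     edges \<Gamma> = (\<Sum>t\<in>#ts. path_edges (full t)) \<and> (\<forall>t\<in>#ts. ok A t)"

text \<open>Weights off A are 0 because that is what the rules leave behind on removed
  vertices.\<close>

definition dstate :: "'a wgraph \<Rightarrow> 'a set \<Rightarrow> 'a triple multiset \<Rightarrow> 'a state" where
  "dstate \<Gamma> A ts = (A, \<lambda>v. if v \<in> A then lweight \<Gamma> v else 0, image_mset (slabel (lweight \<Gamma>)) ts)"

lemma decomp_flip: "decomp \<Gamma> A (add_mset t ts) \<longleftrightarrow> decomp \<Gamma> A (add_mset (flip t) ts)"
  by (simp add: decomp_def)

lemma dstate_flip: "dstate \<Gamma> A (add_mset (flip t) ts) = dstate \<Gamma> A (add_mset t ts)"
  by (simp add: dstate_def)

section \<open>Disjointness and degrees in a decomposition\<close>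

lemma decomp_inner_count:
  assumes "decomp \<Gamma> A ts" "finite (verts \<Gamma>)"
  shows "count (\<Sum>t\<in>#ts. mset (inner t)) v = (if v \<in> verts \<Gamma> - A then 1 else 0)"
proof -
  have "A \<subseteq> verts \<Gamma>"
    using assms by (simp add: decomp_def)
  moreover have "count (mset_set (verts \<Gamma>)) v = count (mset_set A) v + count (\<Sum>t\<in>#ts. mset (inner t)) v"
    using assms by (simp add: decomp_def)
  ultimately show ?thesis
    using assms(2) by (auto simp: count_mset_set' finite_subset split: if_splits)
qed

lemma decomp_inner_notin:
  assumes "decomp \<Gamma> A ts" "finite (verts \<Gamma>)" "t \<in># ts" "v \<in> set (inner t)"
  shows "v \<in> verts \<Gamma> - A"
proof -
  have "v \<in># (\<Sum>t\<in>#ts. mset (inner t))"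
    using assms by (auto simp: in_Union_mset_iff)
  then show ?thesis
    using decomp_inner_count[OF assms(1,2), of v] by (auto simp: count_eq_zero_iff split: if_splits)
qed

lemma decomp_inner_unique:
  assumes "decomp \<Gamma> A (add_mset t ts)" "finite (verts \<Gamma>)" "v \<in> set (inner t)"
  shows "count (mset (inner t)) v = 1" "\<forall>s\<in>#ts. v \<notin> set (inner s)"
proof -
  have "count (mset (inner t)) v + count (\<Sum>t\<in>#ts. mset (inner t)) v \<le> 1"
    using decomp_inner_count[OF assms(1,2), of v] by (auto split: if_splits)
  moreover have "count (mset (inner t)) v \<ge> 1"
    using assms(3) by (simp add: count_greater_eq_one_iff)
  ultimately have "count (mset (inner t)) v = 1" and zero: "count (\<Sum>t\<in>#ts. mset (inner t)) v = 0"
    by linarith+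
  then show "count (mset (inner t)) v = 1"
    by simp
  show "\<forall>s\<in>#ts. v \<notin> set (inner s)"
    using zero by (auto simp: count_eq_zero_iff in_Union_mset_iff)
qed

lemma decomp_distinct:
  assumes "decomp \<Gamma> A ts" "finite (verts \<Gamma>)" "t \<in># ts"
  shows "distinct (inner t)"
proof -
  obtain ts0 where ts: "ts = add_mset t ts0"
    using assms(3) by (meson multi_member_split)
  have "count (mset (inner t)) v \<le> 1" for v
    using decomp_inner_unique(1)[OF assms(1)[unfolded ts] assms(2), of v]
    by (cases "v \<in> set (inner t)") (simp_all add: not_in_iff[THEN iffD1])
  then show ?thesis
    by (simp add: distinct_count_atmost_1 count_mset_0_iff le_antisym
        Suc_le_eq count_mset_gt_0 flip: One_nat_def)
qed

lemma degree_decomp: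
  assumes "decomp \<Gamma> A ts"
  shows "degree \<Gamma> v = (\<Sum>t\<in>#ts. \<Sum>e\<in>#path_edges (full t). count e v)"
proof -
  have "edges \<Gamma> = (\<Sum>t\<in>#ts. path_edges (full t))"
    using assms by (simp add: decomp_def)
  moreover have "(\<Sum>e\<in>#(\<Sum>t\<in>#ts. path_edges (full t)). count e v) =
      (\<Sum>t\<in>#ts. \<Sum>e\<in>#path_edges (full t). count e v)"
    by (induction ts) auto
  ultimately show ?thesis
    unfolding degree_def by simp
qed

lemma triple_degree:
  assumes "ok A t" "v \<notin> set (inner t)"
  shows "(\<Sum>e\<in>#path_edges (full t). count e v) = ends_at v (slabel b t)"
proof (cases t)
  case (fields p xs q)
  then have "full t \<noteq> []"
    using assms(1) by auto
  have "hd (full t) = v \<longleftrightarrow> p = Some v"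
    using assms fields by (cases p; cases xs) auto
  moreover have "last (full t) = v \<longleftrightarrow> q = Some v"
    using assms fields by (cases q; cases xs rule: rev_cases) auto
  moreover have "count (mset (full t)) v = (if p = Some v then 1 else 0) + (if q = Some v then 1 else 0)"
    using assms(2) by (cases p; cases q) (auto simp: fields count_mset_0_iff)
  ultimately show ?thesis
    using path_edges_degree[OF \<open>full t \<noteq> []\<close>, of v] by (auto simp: fields split: if_splits)
qed

lemma ldeg_dstate:
  assumes "decomp \<Gamma> A ts" "finite (verts \<Gamma>)" "v \<in> A"
  shows "ldeg v (image_mset (slabel b) ts) = degree \<Gamma> v"
proof -
  have "ldeg v (image_mset (slabel b) ts) = (\<Sum>t\<in>#ts. ends_at v (slabel b t))"
    by (simp add: ldeg_def multiset.map_comp comp_def)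
  also have "\<dots> = (\<Sum>t\<in>#ts. \<Sum>e\<in>#path_edges (full t). count e v)"
  proof (intro arg_cong[where f = sum_mset] image_mset_cong)
    fix t assume t: "t \<in># ts"
    then have "v \<notin> set (inner t)"
      using decomp_inner_notin[OF assms(1,2) t] assms(3) by blast
    moreover have "ok A t"
      using assms(1) t by (simp add: decomp_def)
    ultimately show "ends_at v (slabel b t) = (\<Sum>e\<in>#path_edges (full t). count e v)"
      by (rule triple_degree[symmetric, rotated])
  qed
  finally show ?thesis
    using degree_decomp[OF assms(1)] by simp
qed

section \<open>Suppressing the vertices of degree at most 2\<close>

lemma decomp_merge:
  assumes "decomp \<Gamma> A (add_mset (p, xs, Some x) (add_mset (Some x, ys, q) ts))"
    "x \<in> A" "p \<noteq> Some x" "q \<noteq> Some x" "finite A"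
    "\<forall>t\<in>#ts. ends_at x (slabel b t) = 0"
  shows "decomp \<Gamma> (A - {x}) (add_mset (p, xs @ x # ys, q) ts)"
proof -
  have "mset_set A = add_mset x (mset_set (A - {x}))"
    using assms(2,5) by (simp add: mset_set.remove)
  moreover have "path_edges (opt p @ xs @ x # ys @ opt q) =
      path_edges (opt p @ xs @ [x]) + path_edges (x # ys @ opt q)"
    using path_edges_append[of "opt p @ xs" x "ys @ opt q"] by simp
  moreover have "ok (A - {x}) t" if "t \<in># ts" for t
    using that assms(1,6) by (cases t) (auto simp: decomp_def split: if_splits)
  ultimately show ?thesis
    using assms(1,3,4) by (auto simp: decomp_def)
qed

lemma decomp_merge_end:
  assumes "decomp \<Gamma> A (add_mset (p, xs, Some x) ts)" "x \<in> A" "p \<noteq> Some x" "finite A"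
    "\<forall>t\<in>#ts. ends_at x (slabel b t) = 0"
  shows "decomp \<Gamma> (A - {x}) (add_mset (p, xs @ [x], None) ts)"
proof -
  have "mset_set A = add_mset x (mset_set (A - {x}))"
    using assms(2,4) by (simp add: mset_set.remove)
  moreover have "ok (A - {x}) t" if "t \<in># ts" for t
    using that assms(1,5) by (cases t) (auto simp: decomp_def split: if_splits)
  ultimately show ?thesis
    using assms(1,3) by (auto simp: decomp_def)
qed

lemma decomp_merge_isolated:
  assumes "decomp \<Gamma> A ts" "x \<in> A" "finite A" "\<forall>t\<in>#ts. ends_at x (slabel b t) = 0"
  shows "decomp \<Gamma> (A - {x}) (add_mset (None, [x], None) ts)"
proof -
  have "mset_set A = add_mset x (mset_set (A - {x}))"
    using assms(2,3) by (simp add: mset_set.remove)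
  moreover have "ok (A - {x}) t" if "t \<in># ts" for t
    using that assms(1,4) by (cases t) (auto simp: decomp_def split: if_splits)
  ultimately show ?thesis
    using assms(1) by (auto simp: decomp_def)
qed

lemma red_merge:
  assumes "x \<in> A" "p \<noteq> Some x" "q \<noteq> Some x" "ldeg x M = 0"
  shows "red (A, \<lambda>v. if v \<in> A then b v else 0,
      add_mset (ledge p (word (map b xs)) (Some x)) (add_mset (ledge (Some x) (word (map b ys)) q) M))
    (A - {x}, \<lambda>v. if v \<in> A - {x} then b v else 0, add_mset (slabel b (p, xs @ x # ys, q)) M)"
  using assms
  by (intro redI'[OF rl.elim[of p x q _ "word (map b xs)" "word (map b ys)"], where V = A and M = M
        and b = "\<lambda>v. if v \<in> A then b v else 0"]) (auto simp: word_append fun_eq_iff)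

lemma triple_end_cases:
  assumes "ldeg x (image_mset (slabel b) ts) > 0"
  obtains p xs ts' where "ts = add_mset (p, xs, Some x) ts'"
  | p xs ts' where "ts = add_mset (flip (p, xs, Some x)) ts'"
proof -
  from assms obtain t where t: "t \<in># ts" "ends_at x (slabel b t) > 0"
    unfolding neq0_conv[symmetric] ldeg_eq_0_iff by auto
  obtain ts' where ts: "ts = add_mset t ts'"
    using t(1) by (meson multi_member_split)
  obtain p xs q where tt: "t = (p, xs, q)"
    by (cases t)
  consider "q = Some x" | "p = Some x"
    using t(2) by (auto simp: tt split: if_splits)
  then show ?thesis
  proof cases
    case 1
    then show ?thesis
      using that(1) ts tt by blast
  next
    case 2
    then have "t = flip (q, rev xs, Some x)"
      by (simp add: tt)
    then show ?thesis
      using that(2) ts by blast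
  qed
qed

lemma obtain_triple_end:
  assumes "decomp \<Gamma> A ts" "ldeg x (image_mset (slabel (lweight \<Gamma>)) ts) > 0"
  obtains p xs ts' where "decomp \<Gamma> A (add_mset (p, xs, Some x) ts')"
    "dstate \<Gamma> A ts = dstate \<Gamma> A (add_mset (p, xs, Some x) ts')"
    "image_mset (slabel (lweight \<Gamma>)) ts =
      image_mset (slabel (lweight \<Gamma>)) (add_mset (p, xs, Some x) ts')"
  using assms(2)
proof (cases rule: triple_end_cases)
  case (1 p xs ts')
  then show ?thesis
    using that assms(1) by simp
next
  case (2 p xs ts')
  then show ?thesis
    using that[of p xs ts'] assms(1) decomp_flip[of \<Gamma> A "(p, xs, Some x)" ts']
      dstate_flip[of \<Gamma> A "(p, xs, Some x)" ts'] flip_simps(4)[of _ "(p, xs, Some x)"]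
    by (simp del: flip.simps slabel.simps)
qed

lemma ldeg_slabel_0: "ldeg x (image_mset (slabel b) ts) = 0 \<longleftrightarrow> (\<forall>t\<in>#ts. ends_at x (slabel b t) = 0)"
  by (simp add: ldeg_eq_0_iff)

lemma adjacent_closed:
  assumes "(adjacent \<Gamma>)\<^sup>*\<^sup>* u v" "u \<in> C" "\<And>e. e \<in># edges \<Gamma> \<Longrightarrow> set_mset e \<inter> C \<noteq> {} \<Longrightarrow> set_mset e \<subseteq> C"
  shows "v \<in> C"
  using assms(1,2)
proof (induction rule: rtranclp_induct)
  case (step y z)
  then show ?case
    using assms(3)[of "{#y, z#}"] by (auto simp: adjacent_def)
qed

text \<open>No edge leaves the closed path: x has no further edge ends, and inner vertices lie on no
  other path. By connectedness the closed path is the whole graph.\<close>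

lemma loop_circular:
  assumes con: "connected_graph \<Gamma>" and fin: "finite (verts \<Gamma>)"
    and dec: "decomp \<Gamma> A (add_mset (Some x, xs, Some x) ts)"
    and zero: "\<forall>t\<in>#ts. ends_at x (slabel b t) = 0"
  shows "circular \<Gamma> \<and> A = {x} \<and> ts = {#}"
proof -
  let ?C = "set (x # xs)"
  have xA: "x \<in> A" and AV: "A \<subseteq> verts \<Gamma>"
    using dec by (auto simp: decomp_def)
  have "set xs \<subseteq> verts \<Gamma> - A"
    using decomp_inner_notin[OF dec fin, of "(Some x, xs, Some x)"] by auto
  then have CV: "?C \<subseteq> verts \<Gamma>"
    using xA AV by auto
  have out: "set (full t) \<inter> ?C = {}" if t: "t \<in># ts" for t
  proof -
    obtain p ys q where tt: "t = (p, ys, q)"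
      by (cases t)
    have "p \<noteq> Some x" "q \<noteq> Some x"
      using zero t by (auto simp: tt split: if_splits)
    moreover have "set_option p \<subseteq> A" "set_option q \<subseteq> A"
      using dec t by (auto simp: tt decomp_def)
    moreover have "set ys \<subseteq> verts \<Gamma> - A"
      using decomp_inner_notin[OF dec fin, of t] t by (auto simp: tt)
    moreover have "set ys \<inter> set xs = {}"
      using decomp_inner_unique(2)[OF dec fin] t by (fastforce simp: tt)
    ultimately show ?thesis
      using xA \<open>set xs \<subseteq> verts \<Gamma> - A\<close> by (auto simp: tt)
  qed
  have "set_mset e \<subseteq> ?C" if e: "e \<in># edges \<Gamma>" "set_mset e \<inter> ?C \<noteq> {}" for e
  proof -
    from e(1) dec consider "e \<in># path_edges (full (Some x, xs, Some x))"
      | t where "t \<in># ts" "e \<in># path_edges (full t)"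
      by (auto simp: decomp_def in_Union_mset_iff)
    then show ?thesis
    proof cases
      case 1
      then show ?thesis
        using path_edges_subset[of e "full (Some x, xs, Some x)"] by auto
    next
      case 2
      then show ?thesis
        using out path_edges_subset[of e "full t"] e(2) by blast
    qed
  qed
  then have "v \<in> ?C" if "v \<in> verts \<Gamma>" for v
    using adjacent_closed[of \<Gamma> x v ?C] con that xA AV unfolding connected_graph_def by auto
  then have V: "verts \<Gamma> = ?C"
    using CV by blast
  have A: "A = {x}"
    using V AV xA \<open>set xs \<subseteq> verts \<Gamma> - A\<close> by auto
  have ts: "ts = {#}"
  proof (rule ccontr)
    assume "ts \<noteq> {#}"
    then obtain t where t: "t \<in># ts"
      by auto
    have "full t \<noteq> []"
      using dec t by (cases t) (auto simp: decomp_def)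
    moreover have "set (full t) \<subseteq> verts \<Gamma>"
      using decomp_inner_notin[OF dec fin, of t] t dec AV by (cases t) (fastforce simp: decomp_def)
    ultimately show False
      using out[OF t] V by (metis Int_absorb2 set_empty)
  qed
  have "distinct (x # xs)"
    using decomp_distinct[OF dec fin, of "(Some x, xs, Some x)"] xA \<open>set xs \<subseteq> verts \<Gamma> - A\<close> by auto
  \<comment> \<open>\<open>zip\<close> cuts off the final x of the longer list, so the edges of the
    closed path are those of the cyclic list, including the edge back to x.\<close>
  moreover have "zip (x # xs @ [x]) (xs @ [x]) = zip (x # xs) (xs @ [x])"
    using zip_append[of "x # xs" "xs @ [x]" "[x]" "[]"] by simp
  then have "edges \<Gamma> = mset (map (\<lambda>(u, v). {#u, v#}) (zip (x # xs) (rotate1 (x # xs))))"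
    using dec by (simp add: decomp_def ts path_edges_def)
  ultimately have "cycle \<Gamma> (x # xs)"
    using V by (simp add: cycle_def)
  then show ?thesis
    using A ts unfolding circular_def by blast
qed

text \<open>An isolated vertex is capped twice and a leaf once; both then have degree 2, with edges
  to infinity, and are suppressed like any other. If both ends at x belong to the same path, the
  graph is a cycle and \<open>circ\<close> empties the state.\<close>

lemma eliminate_step:
  assumes wg: "weighted_graph \<Gamma>" and con: "connected_graph \<Gamma>"
    and dec: "decomp \<Gamma> A ts" and x: "x \<in> A" "degree \<Gamma> x \<le> 2"
  shows "(\<exists>ts'. decomp \<Gamma> (A - {x}) ts' \<and> red\<^sup>*\<^sup>* (dstate \<Gamma> A ts) (dstate \<Gamma> (A - {x}) ts')) \<or>
    circular \<Gamma> \<and> red\<^sup>*\<^sup>* (dstate \<Gamma> A ts) ({}, \<lambda>_. 0, {#})"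
proof -
  let ?b = "lweight \<Gamma>"
  let ?B = "\<lambda>A v. if v \<in> A then ?b v else 0"
  have fin: "finite (verts \<Gamma>)"
    using wg by (simp add: weighted_graph_def)
  have finA: "finite A"
    using dec fin by (auto simp: decomp_def intro: finite_subset)
  have deg: "ldeg x (image_mset (slabel ?b) ts) = degree \<Gamma> x"
    by (rule ldeg_dstate[OF dec fin x(1)])
  consider (0) "degree \<Gamma> x = 0" | (1) "degree \<Gamma> x > 0"
    by blast
  then show ?thesis
  proof cases
    case 0
    then have zero: "\<forall>t\<in>#ts. ends_at x (slabel ?b t) = 0" "ldeg x (image_mset (slabel ?b) ts) = 0"
      using deg by (simp_all add: ldeg_slabel_0)
    let ?M = "image_mset (slabel ?b) ts"
    have "red (A, ?B A, ?M) (A, ?B A, add_mset (ledge (Some x) link None) ?M)"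
      using x zero by (intro redI'[OF rl.cap[of x], where V = A and M = ?M]) auto
    moreover have "red (A, ?B A, add_mset (ledge (Some x) link None) ?M)
        (A, ?B A, add_mset (ledge (Some x) link None) (add_mset (ledge (Some x) link None) ?M))"
      using x zero by (intro redI'[OF rl.cap[of x], where V = A
            and M = "add_mset (ledge (Some x) link None) ?M"]) auto
    moreover have "red (A, ?B A, add_mset (ledge (Some x) link None) (add_mset (ledge (Some x) link None) ?M))
        (dstate \<Gamma> (A - {x}) (add_mset (None, [x], None) ts))"
      using red_merge[of x A None None ?M ?b "[]" "[]"] x zero
      by (subst (1) ledge_sym) (simp add: dstate_def)
    ultimately have "red\<^sup>*\<^sup>* (dstate \<Gamma> A ts) (dstate \<Gamma> (A - {x}) (add_mset (None, [x], None) ts))"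
      unfolding dstate_def by (meson converse_rtranclp_into_rtranclp rtranclp.rtrancl_refl)
    then show ?thesis
      using decomp_merge_isolated[OF dec x(1) finA zero(1)] by blast
  next
    case 1
    then obtain p xs ts1 where ts1: "decomp \<Gamma> A (add_mset (p, xs, Some x) ts1)"
      "dstate \<Gamma> A ts = dstate \<Gamma> A (add_mset (p, xs, Some x) ts1)"
      "image_mset (slabel ?b) ts = image_mset (slabel ?b) (add_mset (p, xs, Some x) ts1)"
      using obtain_triple_end[OF dec, of x] deg by auto
    let ?M1 = "image_mset (slabel ?b) ts1"
    have deg1: "(if p = Some x then 2 else 1) + ldeg x ?M1 = degree \<Gamma> x"
      using deg ts1(3) by auto
    consider (loop) "p = Some x" "ldeg x ?M1 = 0"
      | (leaf) "p \<noteq> Some x" "ldeg x ?M1 = 0" | (line) "p \<noteq> Some x" "ldeg x ?M1 = 1"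
      using deg1 x(2) by (cases "p = Some x") force+
    then show ?thesis
    proof cases
      case loop
      then have zero: "\<forall>t\<in>#ts1. ends_at x (slabel ?b t) = 0"
        by (simp add: ldeg_slabel_0)
      have circ: "circular \<Gamma> \<and> A = {x} \<and> ts1 = {#}"
        using loop_circular[OF con fin _ zero] ts1(1) loop(1) by blast
      have "red (dstate \<Gamma> A (add_mset (p, xs, Some x) ts1)) ({}, \<lambda>_. 0, {#})"
        using circ by (intro redI'[OF rl.circ[of x _ "word (map ?b xs)"], where V = A and M = "{#}"
              and b = "?B A"]) (auto simp: dstate_def loop(1))
      then show ?thesis
        using circ ts1(2) by auto
    next
      case leaf
      then have zero: "\<forall>t\<in>#ts1. ends_at x (slabel ?b t) = 0"
        by (simp add: ldeg_slabel_0)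
      have "red (dstate \<Gamma> A ts) (A, ?B A, add_mset (ledge (Some x) link None)
          (image_mset (slabel ?b) (add_mset (p, xs, Some x) ts1)))"
        unfolding ts1(2) using x leaf
        by (intro redI'[OF rl.cap[of x], where V = A
              and M = "image_mset (slabel ?b) (add_mset (p, xs, Some x) ts1)"]) (auto simp: dstate_def)
      moreover have "red (A, ?B A, add_mset (ledge (Some x) link None)
          (image_mset (slabel ?b) (add_mset (p, xs, Some x) ts1)))
          (dstate \<Gamma> (A - {x}) (add_mset (p, xs @ [x], None) ts1))"
        using red_merge[of x A p None ?M1 ?b xs "[]"] x leaf
        by (simp add: dstate_def add_mset_commute)
      ultimately have "red\<^sup>*\<^sup>* (dstate \<Gamma> A ts) (dstate \<Gamma> (A - {x}) (add_mset (p, xs @ [x], None) ts1))"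
        by (meson converse_rtranclp_into_rtranclp rtranclp.rtrancl_refl)
      then show ?thesis
        using decomp_merge_end[OF ts1(1) x(1) leaf(1) finA zero] by blast
    next
      case line
      then have "ldeg x ?M1 > 0"
        by simp
      then obtain q ys ts2 where ts1': "ts1 = add_mset (q, ys, Some x) ts2
          \<or> ts1 = add_mset (flip (q, ys, Some x)) ts2"
        by (cases rule: triple_end_cases) blast+
      define t1 where "t1 = (Some x, rev ys, q)"
      have M1: "?M1 = image_mset (slabel ?b) (add_mset t1 ts2)"
        using ts1' flip_simps(4)[of ?b "(q, ys, Some x)"] unfolding t1_def by auto
      have dec2: "decomp \<Gamma> A (add_mset (p, xs, Some x) (add_mset t1 ts2))"
        using ts1(1) ts1' decomp_flip[of \<Gamma> A "(q, ys, Some x)" "add_mset (p, xs, Some x) ts2"]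
        unfolding t1_def by (auto simp: add_mset_commute)
      have q: "q \<noteq> Some x" and zero': "ldeg x (image_mset (slabel ?b) ts2) = 0"
        using line(2) unfolding M1 t1_def by (auto split: if_splits)
      then have zero: "\<forall>t\<in>#ts2. ends_at x (slabel ?b t) = 0"
        by (simp add: ldeg_slabel_0)
      have "dstate \<Gamma> A ts = (A, ?B A, add_mset (ledge p (word (map ?b xs)) (Some x))
          (add_mset (ledge (Some x) (word (map ?b (rev ys))) q) (image_mset (slabel ?b) ts2)))"
        unfolding ts1(2) using M1 by (simp add: dstate_def t1_def)
      moreover have "dstate \<Gamma> (A - {x}) (add_mset (p, xs @ x # rev ys, q) ts2) =
          (A - {x}, ?B (A - {x}), add_mset (slabel ?b (p, xs @ x # rev ys, q)) (image_mset (slabel ?b) ts2))"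
        by (simp add: dstate_def)
      ultimately have "red (dstate \<Gamma> A ts) (dstate \<Gamma> (A - {x}) (add_mset (p, xs @ x # rev ys, q) ts2))"
        using red_merge[OF x(1) line(1) q zero', of ?b xs "rev ys"] by metis
      then show ?thesis
        using decomp_merge[OF dec2[unfolded t1_def] x(1) line(1) q finA zero] by blast
    qed
  qed
qed

lemma decomp_init:
  fixes \<Gamma> :: "'a wgraph"
  assumes "weighted_graph \<Gamma>"
  obtains ts where "decomp \<Gamma> (verts \<Gamma>) ts" "dstate \<Gamma> (verts \<Gamma>) ts = init \<Gamma>"
proof -
  have "\<forall>e\<in>#edges \<Gamma>. \<exists>u v. e = {#u, v#} \<and> u \<in> verts \<Gamma> \<and> v \<in> verts \<Gamma>"
    using edge_pair[OF assms] by metis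
  then obtain f g where fg: "\<And>e. e \<in># edges \<Gamma> \<Longrightarrow> e = {#f e, g e#} \<and> f e \<in> verts \<Gamma> \<and> g e \<in> verts \<Gamma>"
    by metis
  define ts :: "'a triple multiset" where "ts = image_mset (\<lambda>e. (Some (f e), [], Some (g e))) (edges \<Gamma>)"
  have "(\<Sum>t\<in>#ts. path_edges (full t)) = (\<Sum>e\<in>#edges \<Gamma>. {#{#f e, g e#}#})"
    by (simp add: ts_def multiset.map_comp comp_def)
  also have "\<dots> = (\<Sum>e\<in>#edges \<Gamma>. {#e#})"
    using fg by (intro arg_cong[where f = sum_mset] image_mset_cong) auto
  also have "\<dots> = edges \<Gamma>"
    by simp
  finally have "decomp \<Gamma> (verts \<Gamma>) ts"
    using fg by (auto simp: decomp_def) (auto simp: ts_def multiset.map_comp comp_def)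
  moreover have "image_mset (slabel (lweight \<Gamma>)) ts = image_mset iedge (edges \<Gamma>)"
    unfolding ts_def multiset.map_comp
  proof (intro image_mset_cong)
    fix e assume "e \<in># edges \<Gamma>"
    then have "iedge e = iedge {#f e, g e#}"
      using fg by simp
    then show "(slabel (lweight \<Gamma>) \<circ> (\<lambda>e. (Some (f e), [], Some (g e)))) e = iedge e"
      by simp
  qed
  then have "dstate \<Gamma> (verts \<Gamma>) ts = init \<Gamma>"
    by (auto simp: dstate_def init_def lweight_def)
  ultimately show ?thesis
    using that by blast
qed

text \<open>Starting from all vertices, those of degree at most 2 are dropped one at a time. The
  degree in \<Gamma> can be used throughout, since by \<open>ldeg_dstate\<close> a kept vertex has
  the same degree in the current state.\<close>

lemma eliminate:
  assumes wg: "weighted_graph \<Gamma>" and con: "connected_graph \<Gamma>"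
  shows "(\<exists>ts. decomp \<Gamma> (branching \<Gamma>) ts \<and> red\<^sup>*\<^sup>* (init \<Gamma>) (dstate \<Gamma> (branching \<Gamma>) ts)) \<or>
    circular \<Gamma> \<and> red\<^sup>*\<^sup>* (init \<Gamma>) ({}, \<lambda>_. 0, {#})"
proof -
  have fin: "finite (verts \<Gamma>)"
    using wg by (simp add: weighted_graph_def)
  have "(\<exists>ts. decomp \<Gamma> (branching \<Gamma>) ts \<and> red\<^sup>*\<^sup>* (init \<Gamma>) (dstate \<Gamma> (branching \<Gamma>) ts)) \<or>
      circular \<Gamma> \<and> red\<^sup>*\<^sup>* (init \<Gamma>) ({}, \<lambda>_. 0, {#})"
    if "decomp \<Gamma> A ts" "red\<^sup>*\<^sup>* (init \<Gamma>) (dstate \<Gamma> A ts)" "branching \<Gamma> \<subseteq> A" for A ts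
    using that
  proof (induction "card A" arbitrary: A ts rule: less_induct)
    case less
    have finA: "finite A" "A \<subseteq> verts \<Gamma>"
      using less.prems fin by (auto simp: decomp_def intro: finite_subset)
    show ?case
    proof (cases "A = branching \<Gamma>")
      case True
      then show ?thesis
        using less.prems by blast
    next
      case False
      then obtain x where x: "x \<in> A" "x \<notin> branching \<Gamma>"
        using less.prems(3) by blast
      then have "degree \<Gamma> x \<le> 2"
        using finA by (auto simp: branching_def)
      from eliminate_step[OF wg con less.prems(1) x(1) this] show ?thesis
      proof (elim disjE exE conjE)
        fix ts' assume "decomp \<Gamma> (A - {x}) ts'" "red\<^sup>*\<^sup>* (dstate \<Gamma> A ts) (dstate \<Gamma> (A - {x}) ts')"
        then show ?thesis
          using less.hyps[of "A - {x}" ts'] less.prems x finA card_Diff1_less[OF finA(1) x(1)]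
            rtranclp_trans[of red] by blast
      next
        assume "circular \<Gamma>" "red\<^sup>*\<^sup>* (dstate \<Gamma> A ts) ({}, \<lambda>_. 0, {#})"
        then show ?thesis
          using less.prems(2) rtranclp_trans[of red] by blast
      qed
    qed
  qed
  moreover obtain ts where "decomp \<Gamma> (verts \<Gamma>) ts" "dstate \<Gamma> (verts \<Gamma>) ts = init \<Gamma>"
    using decomp_init[OF wg] .
  ultimately show ?thesis
    using branching_def by (metis (no_types, lifting) mem_Collect_eq rtranclp.rtrancl_refl subsetI)
qed

section \<open>Segments\<close>

lemma filter_path_edges_Cons:
  assumes "x \<notin> N"
  shows "{#e \<in># path_edges (x # ys). set_mset e \<subseteq> N#} = {#e \<in># path_edges ys. set_mset e \<subseteq> N#}"
  using assms by (cases ys) auto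

lemma filter_path_edges_snoc:
  assumes "x \<notin> N"
  shows "{#e \<in># path_edges (ys @ [x]). set_mset e \<subseteq> N#} = {#e \<in># path_edges ys. set_mset e \<subseteq> N#}"
  using filter_path_edges_Cons[OF assms, of "rev ys"] path_edges_rev[of "ys @ [x]"]
    path_edges_rev[of ys] by simp

text \<open>Only the branching ends of the path lie outside N, so what is lost are the first and the
  last edge where such an end exists.\<close>

lemma filter_path_edges_full:
  assumes "ok B t" "set (inner t) \<subseteq> N" "N \<inter> B = {}"
  shows "{#e \<in># path_edges (full t). set_mset e \<subseteq> N#} = path_edges (inner t)"
proof (cases t)
  case (fields p xs q)
  have "\<forall>e\<in>#path_edges xs. set_mset e \<subseteq> N"
    using assms(2) path_edges_subset[of _ xs] by (fastforce simp: fields)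
  then have *: "{#e \<in># path_edges xs. set_mset e \<subseteq> N#} = path_edges xs"
    by (simp add: filter_mset_eq_conv)
  have 1: "{#e \<in># path_edges (xs @ opt q). set_mset e \<subseteq> N#} = path_edges xs"
  proof (cases q)
    case (Some y)
    then have "y \<notin> N"
      using assms by (auto simp: fields)
    then show ?thesis
      using * by (simp add: Some filter_path_edges_snoc)
  qed (use * in simp)
  show ?thesis
  proof (cases p)
    case (Some y)
    then have "y \<notin> N"
      using assms by (auto simp: fields)
    then show ?thesis
      using 1 by (simp add: fields Some filter_path_edges_Cons)
  qed (use 1 in \<open>simp add: fields\<close>)
qed

lemma filter_sum_mset: "filter_mset P (\<Sum>t\<in>#ts. F t) = (\<Sum>t\<in>#ts. filter_mset P (F t))"
  by (induction ts) auto

lemma path_connected_hd: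
  assumes "set_mset (path_edges xs) \<subseteq> set_mset (edges \<Gamma>)" "v \<in> set xs"
  shows "(adjacent \<Gamma>)\<^sup>*\<^sup>* (hd xs) v"
  using assms
proof (induction xs rule: induct_list012)
  case (3 x y xs)
  have "adjacent \<Gamma> x y"
    using 3 by (simp add: adjacent_def)
  then show ?case
    using 3 by (auto intro: converse_rtranclp_into_rtranclp)
qed auto

lemma adjacent_sym: "adjacent \<Gamma> u v \<Longrightarrow> adjacent \<Gamma> v u"
  by (simp add: adjacent_def add_mset_commute)

lemma adjacent_rtranclp_sym: "(adjacent \<Gamma>)\<^sup>*\<^sup>* u v \<Longrightarrow> (adjacent \<Gamma>)\<^sup>*\<^sup>* v u"
  by (induction rule: rtranclp_induct) (auto intro: adjacent_sym converse_rtranclp_into_rtranclp)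

lemma path_connected:
  assumes "set_mset (path_edges xs) \<subseteq> set_mset (edges \<Gamma>)" "u \<in> set xs" "v \<in> set xs"
  shows "(adjacent \<Gamma>)\<^sup>*\<^sup>* u v"
  using path_connected_hd[OF assms(1)] assms(2,3) adjacent_rtranclp_sym rtranclp_trans by metis

definition seg :: "'a wgraph \<Rightarrow> 'a list \<Rightarrow> 'a wgraph" where
  "seg \<Gamma> xs = \<Gamma>\<lparr>verts := set xs, edges := path_edges xs\<rparr>"

lemma seg_simps [simp]: "verts (seg \<Gamma> xs) = set xs" "weight (seg \<Gamma> xs) = weight \<Gamma>"
  "edges (seg \<Gamma> xs) = path_edges xs"
  by (simp_all add: seg_def)

lemma chain_iff: "chain L vs \<longleftrightarrow> vs \<noteq> [] \<and> distinct vs \<and> verts L = set vs \<and> edges L = path_edges vs"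
  by (simp add: chain_def path_edges_def)

lemma edge_nonempty:
  assumes "weighted_graph \<Gamma>" "e \<in># edges \<Gamma>"
  shows "set_mset e \<noteq> {}"
  using assms by (auto simp: weighted_graph_def)

lemma edges_nonbranching:
  assumes "weighted_graph \<Gamma>" "decomp \<Gamma> B ts"
  shows "edges (induced \<Gamma> (verts \<Gamma> - B)) = (\<Sum>t\<in>#ts. path_edges (inner t))"
proof -
  have "edges (induced \<Gamma> (verts \<Gamma> - B)) =
      (\<Sum>t\<in>#ts. {#e \<in># path_edges (full t). set_mset e \<subseteq> verts \<Gamma> - B#})"
    using assms(2) by (simp add: induced_def decomp_def filter_sum_mset)
  also have "\<dots> = (\<Sum>t\<in>#ts. path_edges (inner t))"
  proof (intro arg_cong[where f = sum_mset] image_mset_cong)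
    fix t assume t: "t \<in># ts"
    then have "set (inner t) \<subseteq> verts \<Gamma> - B"
      using decomp_inner_notin[OF assms(2) _ t] assms(1) by (auto simp: weighted_graph_def)
    moreover have "ok B t"
      using assms(2) t by (simp add: decomp_def)
    ultimately show "{#e \<in># path_edges (full t). set_mset e \<subseteq> verts \<Gamma> - B#} = path_edges (inner t)"
      by (intro filter_path_edges_full) auto
  qed
  finally show ?thesis .
qed

text \<open>Inner lists of different paths are disjoint, so no edge of H leaves one of them; and
  each is connected along its own path.\<close>

lemma component_of_triple:
  assumes wg: "weighted_graph \<Gamma>" and dec: "decomp \<Gamma> B ts" and t: "t \<in># ts" and u: "u \<in> set (inner t)"
  defines "H \<equiv> induced \<Gamma> (verts \<Gamma> - B)"
  shows "induced H {v. (adjacent H)\<^sup>*\<^sup>* u v} = seg \<Gamma> (inner t)"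
proof -
  have fin: "finite (verts \<Gamma>)"
    using wg by (simp add: weighted_graph_def)
  obtain ts0 where ts: "ts = add_mset t ts0"
    using t by (meson multi_member_split)
  note dec' = dec[unfolded ts]
  have EH: "edges H = path_edges (inner t) + (\<Sum>t\<in>#ts0. path_edges (inner t))"
    unfolding H_def using edges_nonbranching[OF wg dec] by (simp add: ts)
  have disj: "set_mset e \<inter> set (inner t) = {}" if "s \<in># ts0" "e \<in># path_edges (inner s)" for s e
    using decomp_inner_unique(2)[OF dec' fin] path_edges_subset[OF that(2)] that(1) by fastforce
  have ne: "set_mset e \<noteq> {}" if "e \<in># edges H" for e
    using edge_nonempty[OF wg] that by (simp add: H_def induced_def)
  have "{v. (adjacent H)\<^sup>*\<^sup>* u v} = set (inner t)"
  proof (intro equalityI subsetI)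
    fix v assume "v \<in> {v. (adjacent H)\<^sup>*\<^sup>* u v}"
    then have "(adjacent H)\<^sup>*\<^sup>* u v"
      by simp
    then show "v \<in> set (inner t)"
    proof (rule adjacent_closed)
      fix e assume e: "e \<in># edges H" "set_mset e \<inter> set (inner t) \<noteq> {}"
      have "e \<in># path_edges (inner t) \<or> (\<exists>s\<in>#ts0. e \<in># path_edges (inner s))"
        using e(1) by (simp add: EH in_Union_mset_iff)
      then have "e \<in># path_edges (inner t)"
        using disj e(2) by blast
      then show "set_mset e \<subseteq> set (inner t)"
        by (rule path_edges_subset)
    qed (rule u)
  next
    fix v assume "v \<in> set (inner t)"
    then show "v \<in> {v. (adjacent H)\<^sup>*\<^sup>* u v}"
      using path_connected[of "inner t" H u v] u by (auto simp: EH)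
  qed
  moreover have "{#e \<in># edges H. set_mset e \<subseteq> set (inner t)#} = path_edges (inner t)"
  proof -
    have "{#e \<in># path_edges (inner t). set_mset e \<subseteq> set (inner t)#} = path_edges (inner t)"
      using path_edges_subset by (auto simp: filter_mset_eq_conv)
    moreover have "{#e \<in># (\<Sum>t\<in>#ts0. path_edges (inner t)). set_mset e \<subseteq> set (inner t)#} = {#}"
      using disj ne by (fastforce simp: EH filter_mset_eq_conv)
    ultimately show ?thesis
      by (simp add: EH)
  qed
  moreover have "verts H \<inter> set (inner t) = set (inner t)"
    using decomp_inner_notin[OF dec fin t] by (auto simp: H_def induced_def)
  ultimately show ?thesis
    by (simp add: induced_def[of H] seg_def) (simp add: H_def induced_def)
qed

lemma segments_decomp:
  assumes wg: "weighted_graph \<Gamma>" and dec: "decomp \<Gamma> (branching \<Gamma>) ts"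
  shows "segments \<Gamma> = {seg \<Gamma> (inner t) | t. t \<in># ts \<and> inner t \<noteq> []}"
proof -
  have fin: "finite (verts \<Gamma>)"
    using wg by (simp add: weighted_graph_def)
  let ?H = "induced \<Gamma> (verts \<Gamma> - branching \<Gamma>)"
  note comp = component_of_triple[OF wg dec]
  show ?thesis
  proof (intro equalityI subsetI)
    fix L assume "L \<in> segments \<Gamma>"
    then obtain u where u: "u \<in> verts \<Gamma> - branching \<Gamma>" "L = induced ?H {v. (adjacent ?H)\<^sup>*\<^sup>* u v}"
      unfolding segments_def components_def by (auto simp: induced_def[of \<Gamma>])
    have "count (\<Sum>t\<in>#ts. mset (inner t)) u = 1"
      using decomp_inner_count[OF dec fin, of u] u(1) by simp
    then have "u \<in># (\<Sum>t\<in>#ts. mset (inner t))"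
      by (metis count_eq_zero_iff zero_neq_one)
    then obtain t where t: "t \<in># ts" "u \<in> set (inner t)"
      by (auto simp: in_Union_mset_iff)
    then have "L = seg \<Gamma> (inner t)"
      using comp u(2) by simp
    moreover have "inner t \<noteq> []"
      using t(2) by auto
    ultimately show "L \<in> {seg \<Gamma> (inner t) | t. t \<in># ts \<and> inner t \<noteq> []}"
      using t(1) by blast
  next
    fix L assume "L \<in> {seg \<Gamma> (inner t) | t. t \<in># ts \<and> inner t \<noteq> []}"
    then obtain t where t: "L = seg \<Gamma> (inner t)" "t \<in># ts" "inner t \<noteq> []"
      by blast
    then have u: "hd (inner t) \<in> set (inner t)"
      by simp
    moreover from this have "hd (inner t) \<in> verts ?H"
      using decomp_inner_notin[OF dec fin t(2)] by (auto simp: induced_def)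
    ultimately show "L \<in> segments \<Gamma>"
      unfolding segments_def components_def t(1) using comp[OF t(2)] by (metis imageI)
  qed
qed

lemma chain_seg:
  assumes "weighted_graph \<Gamma>" "decomp \<Gamma> B ts" "t \<in># ts" "inner t \<noteq> []"
  shows "chain (seg \<Gamma> (inner t)) (inner t)"
  using assms decomp_distinct[OF assms(2) _ assms(3)] by (simp add: chain_iff weighted_graph_def)

text \<open>By distinctness only the first edge contains the head, so it determines the second
  vertex, and the remaining lists are compared in the same way.\<close>

lemma path_unique_hd:
  assumes "distinct xs" "distinct vs" "xs \<noteq> []" "vs \<noteq> []" "hd xs = hd vs" "set xs = set vs"
    "path_edges xs = path_edges vs"
  shows "xs = vs"
  using assms
proof (induction xs arbitrary: vs rule: induct_list012)
  case (2 x)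
  then show ?case
    by (cases vs) (auto dest: subset_singletonD)
next
  case (3 x y xs)
  then obtain vs' where vs: "vs = x # vs'"
    by (cases vs) auto
  then obtain y' vs'' where vs': "vs' = y' # vs''"
    using "3.prems" by (cases vs') auto
  have eq: "add_mset {#x, y#} (path_edges (y # xs)) = add_mset {#x, y'#} (path_edges (y' # vs''))"
    using "3.prems" by (simp add: vs vs')
  have "{#x, y#} \<notin># path_edges (y' # vs'')"
    using path_edges_subset[of "{#x, y#}" "y' # vs''"] "3.prems" by (auto simp: vs vs')
  then have "{#x, y#} = {#x, y'#}"
    using eq by (metis insert_noteq_member)
  then have y: "y' = y"
    by (auto simp: pair_mset_eq_iff)
  then have "y # xs = y # vs''"
    using "3.prems" eq by (intro "3.IH"(2)) (auto simp: vs vs' insert_ident)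
  then show ?case
    by (simp add: vs vs' y)
qed simp

text \<open>The head of one listing has at most one edge end at it, so it must also stand at an end
  of the other listing.\<close>

lemma chain_unique:
  assumes "chain L xs" "chain L vs"
  shows "vs = xs \<or> vs = rev xs"
proof -
  have x: "xs \<noteq> []" "distinct xs" and v: "vs \<noteq> []" "distinct vs"
    and eq: "set xs = set vs" "path_edges xs = path_edges vs"
    using assms by (auto simp: chain_iff)
  let ?v = "hd xs"
  have "count (mset xs) ?v = 1" "count (mset vs) ?v = 1"
    using x v eq hd_in_set[OF x(1)] by (simp_all add: distinct_count_atmost_1)
  define S where "S = (\<Sum>e\<in>#path_edges vs. count e ?v)"
  have "S + (if last xs = ?v then 1 else 0) = 1"
    "S + (if hd vs = ?v then 1 else 0) + (if last vs = ?v then 1 else 0) = 2"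
    using path_edges_degree[OF x(1), of ?v] path_edges_degree[OF v(1), of ?v]
      \<open>count (mset xs) ?v = 1\<close> \<open>count (mset vs) ?v = 1\<close>
    unfolding eq(2) S_def by simp_all
  then have "hd vs = ?v \<or> last vs = ?v"
    by (cases "hd vs = ?v"; cases "last vs = ?v"; cases "last xs = ?v") simp_all
  then show ?thesis
  proof
    assume "hd vs = ?v"
    then show ?thesis
      using path_unique_hd[OF x(2) v(2) x(1) v(1)] eq by simp
  next
    assume "last vs = ?v"
    then have "xs = rev vs"
      using path_unique_hd[of xs "rev vs"] x v eq by (simp add: hd_rev)
    then show ?thesis
      by simp
  qed
qed

section \<open>Standard graphs yield normal forms\<close>

lemma standard_chain_std:
  assumes "standard_chain L" "chain L xs"
  shows "std (map (weight L) xs)"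
proof -
  obtain vs where vs: "chain L vs" and
    w: "(\<exists>k ws. map (weight L) vs = replicate (2 * k) 0 @ ws \<and> (\<forall>w\<in>set ws. w \<le> -2)) \<or>
      (\<exists>k. map (weight L) vs = replicate (2 * k + 1) 0)"
    using assms(1) unfolding standard_chain_def by blast
  have "std (map (weight L) vs)"
    using w unfolding std_def even_std_def le_m2_def by blast
  moreover have "vs = xs \<or> vs = rev xs"
    by (rule chain_unique[OF assms(2) vs])
  ultimately show ?thesis
    using std_rev[of "map (weight L) vs"] by (auto simp: rev_map)
qed

lemma std_triple:
  assumes "standard \<Gamma>" "\<not> circular \<Gamma>" "decomp \<Gamma> (branching \<Gamma>) ts" "t \<in># ts"
  shows "std (map (weight \<Gamma>) (inner t))"
proof (cases "inner t = []")
  case True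
  have "even_std 0 [] []"
    by (simp add: even_std_def)
  then show ?thesis
    unfolding True std_def by auto
next
  case False
  have wg: "weighted_graph \<Gamma>"
    using assms(1) by (simp add: standard_def)
  have "seg \<Gamma> (inner t) \<in> segments \<Gamma>"
    using segments_decomp[OF wg assms(3)] assms(4) False by blast
  then have "standard_chain (seg \<Gamma> (inner t))"
    using assms(1,2) by (simp add: standard_def)
  then show ?thesis
    using standard_chain_std chain_seg[OF wg assms(3,4) False] by fastforce
qed

lemma loop_in_path: "{#v, v#} \<in># path_edges ys \<Longrightarrow> count (mset ys) v \<ge> 2"
proof (induction ys rule: induct_list012)
  case (3 x y zs)
  then consider "x = v" "y = v" | "count (mset (y # zs)) v \<ge> 2"
    by (auto simp: pair_mset_eq_iff)
  then show ?case
    by cases auto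
qed auto

lemma full_disjoint:
  assumes "decomp \<Gamma> B ts" "finite (verts \<Gamma>)" "t \<in># ts" "v \<in> set (inner t)"
  shows "v \<in> set (full s) \<Longrightarrow> s \<in># ts \<Longrightarrow> s = t" "count (mset (full t)) v = 1"
proof -
  have vB: "v \<notin> B"
    using decomp_inner_notin[OF assms] by simp
  obtain ts0 where ts: "ts = add_mset t ts0"
    using assms(3) by (meson multi_member_split)
  have ok: "ok B s" if "s \<in># ts" for s
    using assms(1) that by (simp add: decomp_def)
  show "s = t" if "v \<in> set (full s)" "s \<in># ts"
  proof (rule ccontr)
    assume "s \<noteq> t"
    then have "s \<in># ts0"
      using that(2) ts by simp
    then have "v \<notin> set (inner s)"
      using decomp_inner_unique(2)[OF assms(1)[unfolded ts] assms(2,4)] by blast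
    then show False
      using that ok[OF that(2)] vB by (cases s) auto
  qed
  have "count (mset (inner t)) v = 1"
    using decomp_inner_unique(1)[OF assms(1)[unfolded ts] assms(2,4)] .
  then show "count (mset (full t)) v = 1"
    using ok[OF assms(3)] vB by (cases t; cases "fst t"; cases "snd (snd t)") auto
qed

text \<open>A loop at v would lie on the path through v, which would then have to visit v
  twice.\<close>

lemma lweight_inner:
  assumes dec: "decomp \<Gamma> B ts" and fin: "finite (verts \<Gamma>)" and t: "t \<in># ts" "v \<in> set (inner t)"
  shows "lweight \<Gamma> v = weight \<Gamma> v"
proof -
  have "{#v, v#} \<notin># edges \<Gamma>"
  proof
    assume "{#v, v#} \<in># edges \<Gamma>"
    then obtain s where s: "s \<in># ts" "{#v, v#} \<in># path_edges (full s)"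
      using dec by (auto simp: decomp_def in_Union_mset_iff)
    then have "v \<in> set (full s)"
      using path_edges_subset[OF s(2)] by simp
    then have "s = t"
      using s(1) by (rule full_disjoint(1)[OF dec fin t])
    then show False
      using full_disjoint(2)[OF dec fin t] loop_in_path[OF s(2)] by simp
  qed
  then have "count (edges \<Gamma>) {#v, v#} = 0"
    by (simp add: not_in_iff)
  moreover have "v \<in> verts \<Gamma>"
    using decomp_inner_notin[OF dec fin t] by simp
  ultimately show ?thesis
    by (simp add: lweight_def)
qed

lemma slabel_lweight:
  assumes "decomp \<Gamma> B ts" "finite (verts \<Gamma>)" "t \<in># ts"
  shows "slabel (lweight \<Gamma>) t = slabel (weight \<Gamma>) t"
proof -
  have "map (lweight \<Gamma>) (inner t) = map (weight \<Gamma>) (inner t)"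
    using lweight_inner[OF assms] by simp
  then show ?thesis
    by (cases t) (simp only: slabel.simps inner.simps)
qed

text \<open>All remaining vertices have degree at least 3, so only \<open>triv\<close> could apply.
  A path with a free end has inner vertices, and no nonempty standard segment has a contractible
  label.\<close>

lemma dstate_normal:
  assumes std: "standard \<Gamma>" "\<not> circular \<Gamma>" and dec: "decomp \<Gamma> (branching \<Gamma>) ts"
  shows "\<not> red (dstate \<Gamma> (branching \<Gamma>) ts) Y"
proof
  have wg: "weighted_graph \<Gamma>"
    using std(1) by (simp add: standard_def)
  then have fin: "finite (verts \<Gamma>)"
    by (simp add: weighted_graph_def)
  assume "red (dstate \<Gamma> (branching \<Gamma>) ts) Y"
  then show False
  proof (cases rule: red.cases)
    case (redI x V b A B D \<beta>' Q M)
    have eq: "V = branching \<Gamma>" "M + A = image_mset (slabel (lweight \<Gamma>)) ts"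
      using redI(1) by (simp_all add: dstate_def)
    then have deg: "ldeg x (M + A) \<ge> 3"
      using ldeg_dstate[OF dec fin, of x] redI(3) by (simp add: branching_def)
    obtain m n where A: "A = {#ledge (Some x) (shear m * link * shear n) None#}"
      using redI(4,5) deg by (cases rule: rl.cases) auto
    have "ledge (Some x) (shear m * link * shear n) None \<in># image_mset (slabel (lweight \<Gamma>)) ts"
      unfolding eq(2)[symmetric] A by simp
    then obtain t where t: "t \<in># ts" "slabel (lweight \<Gamma>) t = ledge (Some x) (shear m * link * shear n) None"
      by auto
    obtain p xs q where tt: "t = (p, xs, q)"
      by (cases t)
    let ?w = "word (map (weight \<Gamma>) xs)"
    have eq': "ledge p ?w q = ledge (Some x) (shear m * link * shear n) None"
      using t slabel_lweight[OF dec fin t(1)] by (simp add: tt)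
    have "ok (branching \<Gamma>) t"
      using dec t(1) by (simp add: decomp_def)
    then have "xs \<noteq> []"
      using eq' by (auto simp: tt ledge_eq_iff)
    moreover have "?w = shear m * link * shear n \<or> ?w = shear n * link * shear m"
      using eq' by (auto simp: ledge_eq_iff mult.assoc)
    moreover have "std (map (weight \<Gamma>) xs)"
      using std_triple[OF std dec t(1)] by (simp add: tt)
    ultimately show False
      using word_std_not_trivial by (metis map_is_Nil_conv)
  qed
qed

lemma cycle_degree:
  assumes "cycle \<Gamma> vs" "v \<in> verts \<Gamma>"
  shows "degree \<Gamma> v = 2"
proof -
  obtain x xs where vs: "vs = x # xs"
    using assms(1) by (cases vs) (auto simp: cycle_def)
  have "zip (x # xs @ [x]) (xs @ [x]) = zip (x # xs) (xs @ [x])"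
    using zip_append[of "x # xs" "xs @ [x]" "[x]" "[]"] by simp
  then have "edges \<Gamma> = path_edges (x # xs @ [x])"
    using assms(1) by (simp add: cycle_def path_edges_def vs)
  moreover have "count (mset (x # xs)) v = 1"
    using assms unfolding cycle_def vs distinct_count_atmost_1 by simp
  ultimately show ?thesis
    unfolding degree_def using path_edges_degree[of "x # xs @ [x]" v]
    by (auto split: if_splits)
qed

text \<open>A free end would have degree at most 1.\<close>

lemma circular_no_decomp:
  assumes "weighted_graph \<Gamma>" "circular \<Gamma>"
  shows "\<not> decomp \<Gamma> (branching \<Gamma>) ts"
proof
  assume dec: "decomp \<Gamma> (branching \<Gamma>) ts"
  have fin: "finite (verts \<Gamma>)" "verts \<Gamma> \<noteq> {}"
    using assms(1) by (simp_all add: weighted_graph_def)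
  have deg: "degree \<Gamma> v = 2" if "v \<in> verts \<Gamma>" for v
    using assms(2) cycle_degree[OF _ that] by (auto simp: circular_def)
  then have B: "branching \<Gamma> = {}"
    by (auto simp: branching_def)
  obtain u where u: "u \<in> verts \<Gamma>"
    using fin(2) by blast
  then have "u \<in># (\<Sum>t\<in>#ts. mset (inner t))"
    using decomp_inner_count[OF dec fin(1), of u] B
    by (metis DiffI count_eq_zero_iff empty_iff zero_neq_one)
  then obtain t where t: "t \<in># ts" "u \<in> set (inner t)"
    by (auto simp: in_Union_mset_iff)
  have "ok {} t"
    using dec t(1) by (simp add: decomp_def B)
  then have full: "full t = inner t"
    by (cases t) auto
  let ?v = "hd (inner t)"
  have ne: "inner t \<noteq> []"
    using t(2) by auto
  then have v: "?v \<in> set (inner t)"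
    by simp
  obtain ts0 where ts: "ts = add_mset t ts0"
    using t(1) by (meson multi_member_split)
  have "(\<Sum>e\<in>#path_edges (full s). count e ?v) = 0" if s: "s \<in># ts0" for s
  proof -
    have "?v \<notin> set (inner s)"
      using decomp_inner_unique(2)[OF dec[unfolded ts] fin(1) v] s by blast
    moreover have "ok {} s"
      using dec s by (simp add: decomp_def B ts)
    ultimately show ?thesis
      using triple_degree[of "{}" s ?v "\<lambda>_. 0"] by (cases s) auto
  qed
  then have "degree \<Gamma> ?v = (\<Sum>e\<in>#path_edges (inner t). count e ?v)"
    using degree_decomp[OF dec, of ?v] full by (simp add: ts)
  moreover have "count (mset (inner t)) ?v = 1"
    by (rule decomp_inner_unique(1)[OF dec[unfolded ts] fin(1) v])
  ultimately have "degree \<Gamma> ?v \<le> 1"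
    using path_edges_degree[OF ne, of ?v] by simp
  then show False
    using deg decomp_inner_notin[OF dec fin(1) t(1) v] by simp
qed

section \<open>Elementary transformations\<close>

lemma isomorphic_sym:
  assumes "weighted_graph \<Gamma>" "isomorphic \<Gamma> \<Gamma>'"
  shows "isomorphic \<Gamma>' \<Gamma>"
proof -
  obtain f where f: "bij_betw f (verts \<Gamma>) (verts \<Gamma>')"
    "image_mset (image_mset f) (edges \<Gamma>) = edges \<Gamma>'"
    "\<And>v. v \<in> verts \<Gamma> \<Longrightarrow> weight \<Gamma>' (f v) = weight \<Gamma> v"
    using assms(2) unfolding isomorphic_def by blast
  let ?g = "inv_into (verts \<Gamma>) f"
  have g: "?g (f v) = v" if "v \<in> verts \<Gamma>" for v
    using f(1) that by (simp add: bij_betw_inv_into_left)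
  have "image_mset (image_mset ?g) (edges \<Gamma>') = image_mset (\<lambda>e. e) (edges \<Gamma>)"
    unfolding f(2)[symmetric] multiset.map_comp
  proof (intro image_mset_cong)
    fix e assume "e \<in># edges \<Gamma>"
    then have "set_mset e \<subseteq> verts \<Gamma>"
      using assms(1) by (simp add: weighted_graph_def)
    then have "image_mset (\<lambda>v. ?g (f v)) e = image_mset (\<lambda>v. v) e"
      by (intro image_mset_cong) (auto simp: g)
    then show "(image_mset ?g \<circ> image_mset f) e = e"
      by (simp add: multiset.map_comp comp_def)
  qed
  moreover have "bij_betw ?g (verts \<Gamma>') (verts \<Gamma>)"
    by (rule bij_betw_inv_into[OF f(1)])
  moreover have "weight \<Gamma> (?g v) = weight \<Gamma>' v" if "v \<in> verts \<Gamma>'" for v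
  proof -
    have "?g v \<in> verts \<Gamma>" "f (?g v) = v"
      using f(1) that by (auto simp: bij_betw_def inv_into_into f_inv_into_f)
    then show ?thesis
      using f(3)[of "?g v"] by simp
  qed
  ultimately show ?thesis
    unfolding isomorphic_def by auto
qed

lemma birationally_equivalent_refl: "birationally_equivalent \<Gamma> \<Gamma>"
  by (simp add: birationally_equivalent_def)

lemma birationally_equivalent_trans:
  "birationally_equivalent \<Gamma> \<Gamma>' \<Longrightarrow> birationally_equivalent \<Gamma>' \<Gamma>'' \<Longrightarrow> birationally_equivalent \<Gamma> \<Gamma>''"
  unfolding birationally_equivalent_def by (rule rtranclp_trans)

lemma birationally_equivalent_sym:
  assumes "birationally_equivalent \<Gamma> \<Gamma>'"
  shows "birationally_equivalent \<Gamma>' \<Gamma>"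
  using assms unfolding birationally_equivalent_def
proof (induction rule: rtranclp_induct)
  case (step \<Delta> \<Delta>')
  have "birational_step \<Delta>' \<Delta>"
    using step(2) isomorphic_sym unfolding birational_step_def blowdown_def by blast
  then show ?case
    using step(3) by (rule converse_rtranclp_into_rtranclp)
qed simp

lemma image_mset_replace_outside:
  assumes "\<And>e. e \<in># E \<Longrightarrow> x \<notin># e"
  shows "image_mset (image_mset (\<lambda>v. if v = x then z else v)) E = E"
proof -
  have "image_mset (\<lambda>v. if v = x then z else v) e = e" if "e \<in># E" for e
  proof -
    have "image_mset (\<lambda>v. if v = x then z else v) e = image_mset (\<lambda>v. v) e"
      using assms[OF that] by (intro image_mset_cong) auto
    then show ?thesis
      by simp
  qed
  then have "image_mset (image_mset (\<lambda>v. if v = x then z else v)) E = image_mset (\<lambda>e. e) E"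
    by (intro image_mset_cong)
  then show ?thesis
    by simp
qed

text \<open>In \<open>[[a, 0, c]]\<close>, blow up the first edge and contract the former 0-vertex.\<close>

lemma elementary_inner:
  fixes \<Gamma> :: "'a::infinite wgraph"
  assumes wg: "weighted_graph \<Gamma>" and E: "edges \<Gamma> = E + {#{#a, z#}, {#z, c#}#}"
    and z: "\<forall>e\<in>#E. z \<notin># e" "weight \<Gamma> z = 0" and ne: "a \<noteq> z" "c \<noteq> z" "a \<noteq> c"
  shows "birationally_equivalent \<Gamma>
    (\<Gamma>\<lparr>weight := (weight \<Gamma>)(a := weight \<Gamma> a - 1, c := weight \<Gamma> c + 1)\<rparr>)" (is "birationally_equivalent _ ?\<Gamma>'")
proof -
  let ?w = "weight \<Gamma>"
  have V: "a \<in> verts \<Gamma>" "z \<in> verts \<Gamma>" "c \<in> verts \<Gamma>" "finite (verts \<Gamma>)"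
    and EV: "\<And>e. e \<in># E \<Longrightarrow> size e = 2 \<and> set_mset e \<subseteq> verts \<Gamma>"
    using wg by (auto simp: weighted_graph_def E)
  obtain x where x: "x \<notin> verts \<Gamma>"
    using ex_new_if_finite[OF infinite_UNIV V(4)] by blast
  then have xn: "x \<noteq> a" "x \<noteq> z" "x \<noteq> c" and xE: "\<And>e. e \<in># E \<Longrightarrow> x \<notin># e"
    using V EV by auto
  define \<Gamma>1 where "\<Gamma>1 = \<Gamma>\<lparr>verts := insert x (verts \<Gamma>),
    edges := E + {#{#z, c#}#} + {#{#a, x#}, {#x, z#}#},
    weight := ?w(a := ?w a - 1, z := -1, x := -1)\<rparr>"
  \<comment> \<open>\<open>\<Gamma>1\<close> is a blowup of two graphs: of \<Gamma> with new vertex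
    x, and of \<open>\<Gamma>2\<close> with new vertex z. In \<open>\<Gamma>2\<close> the vertex x
    has taken over the place of z and its weight 0.\<close>
  define \<Gamma>2 where "\<Gamma>2 = \<Gamma>\<lparr>verts := insert x (verts \<Gamma> - {z}),
    edges := E + {#{#a, x#}, {#x, c#}#},
    weight := ?w(a := ?w a - 1, c := ?w c + 1, x := 0)\<rparr>"
  have wg1: "weighted_graph \<Gamma>1"
    using wg V EV by (auto simp: weighted_graph_def \<Gamma>1_def)
  have wg2: "weighted_graph \<Gamma>2"
    using V EV z ne by (fastforce simp: weighted_graph_def \<Gamma>2_def)
  have wg': "weighted_graph ?\<Gamma>'"
    using wg by (simp add: weighted_graph_def)
  have "inner_blowup \<Gamma> \<Gamma>1"
    unfolding inner_blowup_def
    using x ne z(2) by (intro exI[of _ a] exI[of _ z] exI[of _ x]) (auto simp: \<Gamma>1_def E)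
  moreover have "inner_blowup \<Gamma>2 \<Gamma>1"
    unfolding inner_blowup_def
    using V x ne xn by (intro exI[of _ x] exI[of _ c] exI[of _ z])
      (auto simp: \<Gamma>1_def \<Gamma>2_def add_mset_commute fun_eq_iff)
  moreover have "isomorphic \<Gamma>2 ?\<Gamma>'"
    unfolding isomorphic_def
  proof (intro exI[of _ "\<lambda>v. if v = x then z else v"] conjI)
    let ?f = "\<lambda>v. if v = x then z else v"
    show "bij_betw ?f (verts \<Gamma>2) (verts ?\<Gamma>')"
      using V x by (auto simp: bij_betw_def inj_on_def \<Gamma>2_def)
    have "image_mset (image_mset ?f) E = E"
      using xE by (rule image_mset_replace_outside)
    then show "image_mset (image_mset ?f) (edges \<Gamma>2) = edges ?\<Gamma>'"
      using xn by (simp add: \<Gamma>2_def E)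
    show "\<forall>v\<in>verts \<Gamma>2. weight ?\<Gamma>' (?f v) = weight \<Gamma>2 v"
      using x xn ne z(2) by (auto simp: \<Gamma>2_def)
  qed
  ultimately have "birational_step \<Gamma> \<Gamma>1" "birational_step \<Gamma>1 \<Gamma>2" "birational_step \<Gamma>2 ?\<Gamma>'"
    using wg wg1 wg2 wg' by (simp_all add: birational_step_def blowdown_def blowup_def)
  then show ?thesis
    unfolding birationally_equivalent_def
    by (meson converse_rtranclp_into_rtranclp rtranclp.rtrancl_refl)
qed

text \<open>The same exchange at a leaf: after the blowup of its edge, z is contracted as a leaf, so
  the unit taken from a reappears nowhere.\<close>

lemma elementary_end:
  fixes \<Gamma> :: "'a::infinite wgraph"
  assumes wg: "weighted_graph \<Gamma>" and E: "edges \<Gamma> = E + {#{#a, z#}#}"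
    and z: "\<forall>e\<in>#E. z \<notin># e" "weight \<Gamma> z = 0" and ne: "a \<noteq> z"
  shows "birationally_equivalent \<Gamma> (\<Gamma>\<lparr>weight := (weight \<Gamma>)(a := weight \<Gamma> a - 1)\<rparr>)" (is "birationally_equivalent _ ?\<Gamma>'")
proof -
  let ?w = "weight \<Gamma>"
  have V: "a \<in> verts \<Gamma>" "z \<in> verts \<Gamma>" "finite (verts \<Gamma>)"
    and EV: "\<And>e. e \<in># E \<Longrightarrow> size e = 2 \<and> set_mset e \<subseteq> verts \<Gamma>"
    using wg by (auto simp: weighted_graph_def E)
  obtain x where x: "x \<notin> verts \<Gamma>"
    using ex_new_if_finite[OF infinite_UNIV V(3)] by blast
  then have xn: "x \<noteq> a" "x \<noteq> z" and xE: "\<And>e. e \<in># E \<Longrightarrow> x \<notin># e"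
    using V EV by auto
  define \<Gamma>1 where "\<Gamma>1 = \<Gamma>\<lparr>verts := insert x (verts \<Gamma>),
    edges := E + {#{#a, x#}, {#x, z#}#},
    weight := ?w(a := ?w a - 1, z := -1, x := -1)\<rparr>"
  define \<Gamma>2 where "\<Gamma>2 = \<Gamma>\<lparr>verts := insert x (verts \<Gamma> - {z}),
    edges := E + {#{#a, x#}#}, weight := ?w(a := ?w a - 1, x := 0)\<rparr>"
  have wg1: "weighted_graph \<Gamma>1"
    using wg V EV by (auto simp: weighted_graph_def \<Gamma>1_def)
  have wg2: "weighted_graph \<Gamma>2"
    using V EV z ne by (fastforce simp: weighted_graph_def \<Gamma>2_def)
  have wg': "weighted_graph ?\<Gamma>'"
    using wg by (simp add: weighted_graph_def)
  have "inner_blowup \<Gamma> \<Gamma>1"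
    unfolding inner_blowup_def
    using x ne z(2) by (intro exI[of _ a] exI[of _ z] exI[of _ x]) (auto simp: \<Gamma>1_def E)
  moreover have "outer_blowup \<Gamma>2 \<Gamma>1"
    unfolding outer_blowup_def
    using V x ne xn by (intro exI[of _ x] exI[of _ z])
      (auto simp: \<Gamma>1_def \<Gamma>2_def add_mset_commute fun_eq_iff)
  moreover have "isomorphic \<Gamma>2 ?\<Gamma>'"
    unfolding isomorphic_def
  proof (intro exI[of _ "\<lambda>v. if v = x then z else v"] conjI)
    let ?f = "\<lambda>v. if v = x then z else v"
    show "bij_betw ?f (verts \<Gamma>2) (verts ?\<Gamma>')"
      using V x by (auto simp: bij_betw_def inj_on_def \<Gamma>2_def)
    have "image_mset (image_mset ?f) E = E"
      using xE by (rule image_mset_replace_outside)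
    then show "image_mset (image_mset ?f) (edges \<Gamma>2) = edges ?\<Gamma>'"
      using xn by (simp add: \<Gamma>2_def E)
    show "\<forall>v\<in>verts \<Gamma>2. weight ?\<Gamma>' (?f v) = weight \<Gamma>2 v"
      using x xn ne z(2) by (auto simp: \<Gamma>2_def)
  qed
  ultimately have "birational_step \<Gamma> \<Gamma>1" "birational_step \<Gamma>1 \<Gamma>2" "birational_step \<Gamma>2 ?\<Gamma>'"
    using wg wg1 wg2 wg' by (simp_all add: birational_step_def blowdown_def blowup_def)
  then show ?thesis
    unfolding birationally_equivalent_def
    by (meson converse_rtranclp_into_rtranclp rtranclp.rtrancl_refl)
qed

section \<open>Transport of weight along chains of zeros\<close>

definition wequiv :: "'a::infinite wgraph \<Rightarrow> ('a \<Rightarrow> int) \<Rightarrow> ('a \<Rightarrow> int) \<Rightarrow> bool" where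
  "wequiv \<Gamma> w w' \<longleftrightarrow> birationally_equivalent (\<Gamma>\<lparr>weight := w\<rparr>) (\<Gamma>\<lparr>weight := w'\<rparr>)"

lemma wequiv_refl: "wequiv \<Gamma> w w"
  by (simp add: wequiv_def birationally_equivalent_refl)

lemma wequiv_trans: "wequiv \<Gamma> w w' \<Longrightarrow> wequiv \<Gamma> w' w'' \<Longrightarrow> wequiv \<Gamma> w w''"
  unfolding wequiv_def by (rule birationally_equivalent_trans)

lemma wequiv_sym: "wequiv \<Gamma> w w' \<Longrightarrow> wequiv \<Gamma> w' w"
  unfolding wequiv_def by (rule birationally_equivalent_sym)

text \<open>Increments are added instead of assigned, because the two ends of a path may be the same
  vertex.\<close>

definition delta :: "'a \<Rightarrow> 'a \<Rightarrow> int" where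
  "delta a v = (if v = a then 1 else 0)"

lemma degree_rest:
  assumes "edges \<Gamma> = E + F" "degree \<Gamma> z = (\<Sum>e\<in>#F. count e z)"
  shows "\<forall>e\<in>#E. z \<notin># e"
  using assms by (auto simp: degree_def count_eq_zero_iff)

lemma wequiv_inner:
  assumes wg: "weighted_graph \<Gamma>" and sub: "{#{#a, z#}, {#z, c#}#} \<subseteq># edges \<Gamma>"
    and z: "degree \<Gamma> z = 2" "w z = 0" and ne: "a \<noteq> z" "c \<noteq> z"
  shows "wequiv \<Gamma> w (\<lambda>v. w v - delta a v + delta c v)"
proof (cases "a = c")
  case True
  then show ?thesis
    by (simp add: wequiv_refl)
next
  case False
  obtain E where E: "edges \<Gamma> = E + {#{#a, z#}, {#z, c#}#}"
    using sub by (metis subset_mset.diff_add)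
  then have "\<forall>e\<in>#E. z \<notin># e"
    using z(1) ne by (intro degree_rest[OF E]) simp
  moreover have "weighted_graph (\<Gamma>\<lparr>weight := w\<rparr>)"
    using wg by (simp add: weighted_graph_def)
  ultimately have "birationally_equivalent (\<Gamma>\<lparr>weight := w\<rparr>)
      (\<Gamma>\<lparr>weight := w(a := w a - 1, c := w c + 1)\<rparr>)"
    using elementary_inner[of "\<Gamma>\<lparr>weight := w\<rparr>" E a z c] E z(2) ne False by simp
  moreover have "w(a := w a - 1, c := w c + 1) = (\<lambda>v. w v - delta a v + delta c v)"
    using False by (auto simp: delta_def)
  ultimately show ?thesis
    by (simp add: wequiv_def)
qed

lemma wequiv_end:
  assumes wg: "weighted_graph \<Gamma>" and sub: "{#a, z#} \<in># edges \<Gamma>"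
    and z: "degree \<Gamma> z = 1" "w z = 0" and ne: "a \<noteq> z"
  shows "wequiv \<Gamma> w (\<lambda>v. w v - delta a v)"
proof -
  obtain E where E: "edges \<Gamma> = E + {#{#a, z#}#}"
    using sub by (metis add.commute add_mset_add_single multi_member_split)
  then have "\<forall>e\<in>#E. z \<notin># e"
    using z(1) ne by (intro degree_rest[OF E]) simp
  moreover have "weighted_graph (\<Gamma>\<lparr>weight := w\<rparr>)"
    using wg by (simp add: weighted_graph_def)
  ultimately have "birationally_equivalent (\<Gamma>\<lparr>weight := w\<rparr>) (\<Gamma>\<lparr>weight := w(a := w a - 1)\<rparr>)"
    using elementary_end[of "\<Gamma>\<lparr>weight := w\<rparr>" E a z] E z(2) ne by simp
  moreover have "w(a := w a - 1) = (\<lambda>v. w v - delta a v)"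
    by (auto simp: delta_def)
  ultimately show ?thesis
    by (simp add: wequiv_def)
qed

fun zig :: "'a set \<Rightarrow> 'a list \<Rightarrow> bool" where
  "zig Z [] \<longleftrightarrow> False"
| "zig Z [a] \<longleftrightarrow> a \<notin> Z"
| "zig Z (a # z # ys) \<longleftrightarrow> a \<notin> Z \<and> z \<in> Z \<and> zig Z ys"

lemma zigI:
  assumes "odd (length ys)" "\<And>i. i < length ys \<Longrightarrow> ys ! i \<in> Z \<longleftrightarrow> odd i"
  shows "zig Z ys"
  using assms
proof (induction Z ys rule: zig.induct)
  case (2 Z a)
  then show ?case
    using 2(2)[of 0] by simp
next
  case (3 Z a z ys)
  have "zig Z ys"
    using "3.prems"(1) "3.prems"(2)[of "Suc (Suc i)" for i] by (intro "3.IH") auto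
  then show ?case
    using "3.prems"(2)[of 0] "3.prems"(2)[of 1] by simp
qed simp

lemma zig_hd_last: "zig Z ys \<Longrightarrow> ys \<noteq> [] \<and> hd ys \<notin> Z \<and> last ys \<notin> Z"
  by (induction Z ys rule: zig.induct) auto

text \<open>The transfers telescope: a vertex between two centres gains 1 and then loses it. Its
  weight may be nonzero in between; only the centres must keep weight 0, and they do, as no transfer
  starts or ends in Z.\<close>

lemma zig_move:
  assumes "weighted_graph \<Gamma>" "zig Z ys" "path_edges ys \<subseteq># edges \<Gamma>"
    "\<forall>z\<in>Z. degree \<Gamma> z = 2 \<and> w z = 0"
  shows "wequiv \<Gamma> w (\<lambda>v. w v - delta (hd ys) v + delta (last ys) v)"
  using assms(2-4)
proof (induction Z ys arbitrary: w rule: zig.induct)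
  case (2 Z a)
  then show ?case
    by (simp add: wequiv_refl)
next
  case (3 Z a z ys)
  then have ys: "ys \<noteq> []" "hd ys \<notin> Z"
    using zig_hd_last[of Z ys] by auto
  then have split: "path_edges (a # z # ys) = {#{#a, z#}, {#z, hd ys#}#} + path_edges ys"
    by (cases ys) auto
  let ?w = "\<lambda>v. w v - delta a v + delta (hd ys) v"
  have "{#{#a, z#}, {#z, hd ys#}#} \<subseteq># edges \<Gamma>"
    by (rule subset_mset.order_trans[OF mset_subset_eq_add_left "3.prems"(2)[unfolded split]])
  moreover have "path_edges ys \<subseteq># edges \<Gamma>"
    by (rule subset_mset.order_trans[OF mset_subset_eq_add_right "3.prems"(2)[unfolded split]])
  moreover have Z: "a \<notin> Z" "z \<in> Z" "zig Z ys"
    using 3 by auto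
  moreover have "\<forall>z\<in>Z. degree \<Gamma> z = 2 \<and> ?w z = 0"
    using "3.prems"(3) Z(1) ys(2) by (auto simp: delta_def)
  ultimately have "wequiv \<Gamma> ?w (\<lambda>v. ?w v - delta (hd ys) v + delta (last ys) v)"
    by (intro "3.IH")
  moreover have "wequiv \<Gamma> w ?w"
    using "3.prems"(3) Z ys(2) \<open>{#{#a, z#}, {#z, hd ys#}#} \<subseteq># edges \<Gamma>\<close>
    by (intro wequiv_inner[OF assms(1)]) auto
  ultimately have "wequiv \<Gamma> w (\<lambda>v. ?w v - delta (hd ys) v + delta (last ys) v)"
    by (metis (no_types, lifting) wequiv_trans)
  then show ?case
    using ys by simp
qed simp

lemma inner_degree:
  assumes dec: "decomp \<Gamma> B ts" and fin: "finite (verts \<Gamma>)" and t: "t \<in># ts" "v \<in> set (inner t)"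
  shows "degree \<Gamma> v + (if hd (full t) = v then 1 else 0) + (if last (full t) = v then 1 else 0) = 2"
proof -
  obtain ts0 where ts: "ts = add_mset t ts0"
    using t(1) by (meson multi_member_split)
  have ok: "ok B s" if "s \<in># ts" for s
    using dec that by (simp add: decomp_def)
  have vB: "v \<notin> B"
    using decomp_inner_notin[OF dec fin t] by simp
  have "(\<Sum>e\<in>#path_edges (full s). count e v) = 0" if s: "s \<in># ts0" for s
  proof -
    have "v \<notin> set (full s)"
      using decomp_inner_unique(2)[OF dec[unfolded ts] fin t(2)] s ok[of s] vB
      by (cases s) (auto simp: ts)
    then have "v \<notin># e" if "e \<in># path_edges (full s)" for e
      using path_edges_subset[OF that] by blast
    then show ?thesis
      by (auto simp: count_eq_zero_iff)
  qed
  then have "degree \<Gamma> v = (\<Sum>e\<in>#path_edges (full t). count e v)"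
    using degree_decomp[OF dec, of v] by (simp add: ts)
  moreover have "full t \<noteq> []"
    using t(2) by (cases t) auto
  ultimately show ?thesis
    using path_edges_degree[of "full t" v] full_disjoint(2)[OF dec fin t] by simp
qed

lemma path_edges_full_subset:
  assumes "decomp \<Gamma> B ts" "t \<in># ts"
  shows "path_edges (full t) \<subseteq># edges \<Gamma>"
proof -
  obtain ts0 where "ts = add_mset t ts0"
    using assms(2) by (meson multi_member_split)
  then show ?thesis
    using assms(1) by (simp add: decomp_def)
qed

text \<open>The alternate vertices \<open>xs ! 0, xs ! 2, \<dots>\<close> of an odd chain of 0-vertices serve as centres of
  elementary transformations.\<close>

lemma zig_triple:
  assumes "distinct xs" "odd (length xs)" "u \<notin> set xs" "v \<notin> set xs"
  shows "zig {xs ! i | i. i < length xs \<and> even i} (u # xs @ [v])"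
proof (rule zigI)
  show "odd (length (u # xs @ [v]))"
    using assms(2) by simp
  fix i assume i: "i < length (u # xs @ [v])"
  let ?Z = "{xs ! i | i. i < length xs \<and> even i}"
  have Z: "?Z \<subseteq> set xs"
    by auto
  consider "i = 0" | j where "i = Suc j" "j < length xs" | "i = Suc (length xs)"
    using i by (cases i) (auto simp: less_Suc_eq)
  then show "(u # xs @ [v]) ! i \<in> ?Z \<longleftrightarrow> odd i"
  proof cases
    case 2
    have "xs ! j \<in> ?Z \<longleftrightarrow> even j"
      using 2(2) assms(1) by (auto simp: nth_eq_iff_index_eq)
    then show ?thesis
      using 2 by (simp add: nth_append)
  next
    case 3
    then show ?thesis
      using assms Z by (auto simp: nth_append)
  qed (use assms Z in auto)
qed

lemma odd_zero_move:
  assumes wg: "weighted_graph \<Gamma>" and dec: "decomp \<Gamma> B ts" and t: "(Some u, xs, Some v) \<in># ts"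
    and xs: "odd (length xs)" "\<forall>x\<in>set xs. w x = 0"
  shows "wequiv \<Gamma> w (\<lambda>y. w y - delta u y + delta v y)"
proof -
  have fin: "finite (verts \<Gamma>)"
    using wg by (simp add: weighted_graph_def)
  have uv: "u \<in> B" "v \<in> B"
    using dec t by (auto simp: decomp_def)
  have notin: "x \<notin> B" if "x \<in> set xs" for x
    using decomp_inner_notin[OF dec fin t] that by simp
  have deg: "degree \<Gamma> x = 2" if "x \<in> set xs" for x
    using inner_degree[OF dec fin t, of x] that notin[OF that] uv by (auto split: if_splits)
  have "distinct xs"
    using decomp_distinct[OF dec fin t] by simp
  then have "zig {xs ! i | i. i < length xs \<and> even i} (u # xs @ [v])"
    using xs uv notin by (intro zig_triple) auto
  moreover have "path_edges (u # xs @ [v]) \<subseteq># edges \<Gamma>"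
    using path_edges_full_subset[OF dec t] by simp
  moreover have "\<forall>x\<in>{xs ! i | i. i < length xs \<and> even i}. degree \<Gamma> x = 2 \<and> w x = 0"
    using deg xs(2) by auto
  ultimately have "wequiv \<Gamma> w (\<lambda>y. w y - delta (hd (u # xs @ [v])) y + delta (last (u # xs @ [v])) y)"
    by (rule zig_move[OF wg])
  then show ?thesis
    by simp
qed

text \<open>If there is more than one zero, the unit taken from u is first carried to the neighbour
  a of the leaf z and then disappears by \<open>wequiv_end\<close>. The centres of the first stage
  are taken in \<open>us\<close>, which has odd length since only a and z are missing.\<close>

lemma odd_zero_end_move:
  assumes wg: "weighted_graph \<Gamma>" and dec: "decomp \<Gamma> B ts" and t: "(Some u, xs, None) \<in># ts"
    and xs: "odd (length xs)" "\<forall>x\<in>set xs. w x = 0"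
  shows "wequiv \<Gamma> w (\<lambda>y. w y - delta u y)"
proof -
  have fin: "finite (verts \<Gamma>)"
    using wg by (simp add: weighted_graph_def)
  have uB: "u \<in> B"
    using dec t by (auto simp: decomp_def)
  have notin: "x \<notin> B" if "x \<in> set xs" for x
    using decomp_inner_notin[OF dec fin t] that by simp
  have dist: "distinct xs"
    using decomp_distinct[OF dec fin t] by simp
  obtain ys z where ys: "xs = ys @ [z]"
    using xs(1) by (cases xs rule: rev_cases) auto
  have deg: "degree \<Gamma> x = (if x = z then 1 else 2)" if "x \<in> set xs" for x
    using inner_degree[OF dec fin t, of x] that notin[OF that] uB
    by (auto simp: ys split: if_splits)
  show ?thesis
  proof (cases ys rule: rev_cases)
    case Nil
    show ?thesis
    proof (rule wequiv_end[OF wg])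
      show "{#u, z#} \<in># edges \<Gamma>"
        using mset_subset_eqD[OF path_edges_full_subset[OF dec t]] by (simp add: ys Nil)
      show "degree \<Gamma> z = 1" "w z = 0" "u \<noteq> z"
        using deg[of z] xs(2) notin[of z] uB by (auto simp: ys)
    qed
  next
    case (snoc us a)
    have split: "path_edges (u # xs) = path_edges (u # us @ [a]) + {#{#a, z#}#}"
      using path_edges_append[of "u # us" a "[z]"] by (simp add: ys snoc)
    have sub: "path_edges (u # us @ [a]) \<subseteq># edges \<Gamma>" "{#a, z#} \<in># edges \<Gamma>"
    proof -
      have "path_edges (u # us @ [a]) + {#{#a, z#}#} \<subseteq># edges \<Gamma>"
        using path_edges_full_subset[OF dec t] split by simp
      then show "path_edges (u # us @ [a]) \<subseteq># edges \<Gamma>" "{#a, z#} \<in># edges \<Gamma>"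
        using subset_mset.order_trans[OF mset_subset_eq_add_left]
        by (blast, auto dest: mset_subset_eqD)
    qed
    have "zig {us ! i | i. i < length us \<and> even i} (u # us @ [a])"
      using xs dist uB notin by (intro zig_triple) (auto simp: ys snoc)
    moreover have "\<forall>x\<in>{us ! i | i. i < length us \<and> even i}. degree \<Gamma> x = 2 \<and> w x = 0"
      using deg xs(2) dist by (auto simp: ys snoc)
    ultimately have "wequiv \<Gamma> w
        (\<lambda>y. w y - delta (hd (u # us @ [a])) y + delta (last (u # us @ [a])) y)"
      using sub(1) by (intro zig_move[OF wg])
    then have 1: "wequiv \<Gamma> w (\<lambda>y. w y - delta u y + delta a y)"
      by simp
    let ?w = "\<lambda>y. w y - delta u y + delta a y"
    have "z \<noteq> a" "z \<noteq> u"
      using dist notin[of z] uB by (auto simp: ys snoc)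
    then have "wequiv \<Gamma> ?w (\<lambda>y. ?w y - delta a y)"
      using deg[of z] xs(2) by (intro wequiv_end[OF wg sub(2)]) (auto simp: ys delta_def)
    then show ?thesis
      using wequiv_trans[OF 1] by simp
  qed
qed

section \<open>The zero part\<close>

definition odd_zero :: "'a wgraph \<Rightarrow> 'a triple \<Rightarrow> bool" where
  "odd_zero \<Gamma> t \<longleftrightarrow> odd (length (inner t)) \<and> (\<forall>x\<in>set (inner t). weight \<Gamma> x = 0)"

definition linked :: "'a wgraph \<Rightarrow> 'a triple multiset \<Rightarrow> 'a \<Rightarrow> 'a \<Rightarrow> bool" where
  "linked \<Gamma> ts u v \<longleftrightarrow> (\<exists>t\<in>#ts. odd_zero \<Gamma> t \<and>
     (\<exists>xs. t = (Some u, xs, Some v) \<or> t = (Some v, xs, Some u)))"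

definition free_link :: "'a wgraph \<Rightarrow> 'a triple multiset \<Rightarrow> 'a \<Rightarrow> bool" where
  "free_link \<Gamma> ts u \<longleftrightarrow> (\<exists>t\<in>#ts. odd_zero \<Gamma> t \<and>
     (\<exists>xs. t = (Some u, xs, None) \<or> t = (None, xs, Some u)))"

lemma linked_sym: "linked \<Gamma> ts u v \<Longrightarrow> linked \<Gamma> ts v u"
  unfolding linked_def by blast

lemma linkeds_sym: "(linked \<Gamma> ts)\<^sup>*\<^sup>* u v \<Longrightarrow> (linked \<Gamma> ts)\<^sup>*\<^sup>* v u"
  by (induction rule: rtranclp_induct) (auto intro: linked_sym converse_rtranclp_into_rtranclp)

lemma path_edges_meet:
  assumes "xs \<noteq> []" "e \<in># path_edges (opt p @ xs @ opt q)"
  shows "set_mset e \<inter> set xs \<noteq> {}"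
proof -
  have *: "set_mset e \<inter> set xs \<noteq> {}" if "xs \<noteq> []" "e \<in># path_edges (xs @ opt q)" for xs
    using that by (induction xs rule: induct_list012) (cases q; auto)+
  show ?thesis
  proof (cases p)
    case (Some y)
    obtain x xs' where "xs = x # xs'"
      using assms(1) by (cases xs) auto
    then show ?thesis
      using assms *[of xs] by (auto simp: Some)
  qed (use assms * in auto)
qed

lemma odd_zero_segments_decomp:
  assumes wg: "weighted_graph \<Gamma>" and dec: "decomp \<Gamma> (branching \<Gamma>) ts"
  shows "odd_zero_segments \<Gamma> = {seg \<Gamma> (inner t) | t. t \<in># ts \<and> odd_zero \<Gamma> t}"
proof -
  have *: "(\<exists>vs k. chain (seg \<Gamma> (inner t)) vs \<and>
      map (weight (seg \<Gamma> (inner t))) vs = replicate (2 * k + 1) 0) \<longleftrightarrow> odd_zero \<Gamma> t"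
    if t: "t \<in># ts" "inner t \<noteq> []" for t
  proof
    assume "\<exists>vs k. chain (seg \<Gamma> (inner t)) vs \<and>
      map (weight (seg \<Gamma> (inner t))) vs = replicate (2 * k + 1) 0"
    then obtain vs k where vs: "chain (seg \<Gamma> (inner t)) vs" "map (weight \<Gamma>) vs = replicate (2 * k + 1) 0"
      by auto
    have "vs = inner t \<or> vs = rev (inner t)"
      using chain_unique[OF chain_seg[OF wg dec t] vs(1)] .
    then have "length (inner t) = length vs" "set (inner t) = set vs"
      by auto
    moreover have "length vs = 2 * k + 1"
      using arg_cong[OF vs(2), of length] by simp
    moreover have "\<forall>x\<in>set vs. weight \<Gamma> x = 0"
      using arg_cong[OF vs(2), of set] by (auto simp del: replicate.simps)
    ultimately show "odd_zero \<Gamma> t"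
      by (simp add: odd_zero_def)
  next
    assume oz: "odd_zero \<Gamma> t"
    then have "odd (length (inner t))"
      by (simp add: odd_zero_def)
    then have "length (inner t) = 2 * (length (inner t) div 2) + 1"
      by presburger
    moreover have "map (weight \<Gamma>) (inner t) = replicate (length (inner t)) 0"
      using oz by (simp add: odd_zero_def list_eq_iff_nth_eq)
    ultimately have "map (weight (seg \<Gamma> (inner t))) (inner t) =
        replicate (2 * (length (inner t) div 2) + 1) 0"
      by simp
    then show "\<exists>vs k. chain (seg \<Gamma> (inner t)) vs \<and>
      map (weight (seg \<Gamma> (inner t))) vs = replicate (2 * k + 1) 0"
      using chain_seg[OF wg dec t] by blast
  qed
  have ne: "inner t \<noteq> []" if "odd_zero \<Gamma> t" for t
    using that by (auto simp: odd_zero_def)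
  show ?thesis
    unfolding odd_zero_segments_def segments_decomp[OF wg dec] using * ne by blast
qed

lemma verts_zero_part:
  assumes wg: "weighted_graph \<Gamma>" and dec: "decomp \<Gamma> (branching \<Gamma>) ts"
  shows "verts (zero_part \<Gamma>) =
    branching \<Gamma> \<union> (\<Union>t\<in>{t. t \<in># ts \<and> odd_zero \<Gamma> t}. set (inner t))"
proof -
  have "odd_zero_segments \<Gamma> = (\<lambda>t. seg \<Gamma> (inner t)) ` {t. t \<in># ts \<and> odd_zero \<Gamma> t}"
    unfolding odd_zero_segments_decomp[OF wg dec] by blast
  then show ?thesis
    by (simp add: zero_part_def Let_def)
qed

lemma inner_unique_triple:
  assumes "decomp \<Gamma> B ts" "finite (verts \<Gamma>)" "t \<in># ts" "s \<in># ts" "x \<in> set (inner t)" "x \<in> set (inner s)"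
  shows "s = t"
proof -
  have "x \<in> set (full s)"
    using assms(6) by (cases s) auto
  then show ?thesis
    using full_disjoint(1)[OF assms(1,2,3,5)] assms(4) by blast
qed

text \<open>A non-branching vertex determines the path through it, so an edge not contained in B
  lies on the path of the odd zero segment it meets. Conversely, the path of such a segment has
  inner vertices, and each of its edges contains one.\<close>

lemma edges_zero_part:
  assumes wg: "weighted_graph \<Gamma>" and dec: "decomp \<Gamma> (branching \<Gamma>) ts"
  shows "e \<in># edges (zero_part \<Gamma>) \<longleftrightarrow> (\<exists>t\<in>#ts. odd_zero \<Gamma> t \<and> e \<in># path_edges (full t))"
proof -
  have fin: "finite (verts \<Gamma>)"
    using wg by (simp add: weighted_graph_def)
  let ?B = "branching \<Gamma>"
  let ?V = "?B \<union> (\<Union>t\<in>{t. t \<in># ts \<and> odd_zero \<Gamma> t}. set (inner t))"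
  have ok: "ok ?B t" if "t \<in># ts" for t
    using dec that by (simp add: decomp_def)
  have notB: "x \<notin> ?B" if "t \<in># ts" "x \<in> set (inner t)" for t x
    using decomp_inner_notin[OF dec fin that] by simp
  have "e \<in># edges (zero_part \<Gamma>) \<longleftrightarrow>
      e \<in># edges \<Gamma> \<and> set_mset e \<subseteq> verts (zero_part \<Gamma>) \<and> \<not> set_mset e \<subseteq> ?B"
    by (auto simp: zero_part_def Let_def)
  also have "\<dots> \<longleftrightarrow> (\<exists>t\<in>#ts. e \<in># path_edges (full t)) \<and> set_mset e \<subseteq> ?V \<and> \<not> set_mset e \<subseteq> ?B"
    using dec unfolding verts_zero_part[OF wg dec] by (simp add: decomp_def in_Union_mset_iff)
  also have "\<dots> \<longleftrightarrow> (\<exists>t\<in>#ts. odd_zero \<Gamma> t \<and> e \<in># path_edges (full t))"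
  proof (intro iffI)
    assume "(\<exists>t\<in>#ts. e \<in># path_edges (full t)) \<and> set_mset e \<subseteq> ?V \<and> \<not> set_mset e \<subseteq> ?B"
    then obtain t x where t: "t \<in># ts" "e \<in># path_edges (full t)" "x \<in># e" "x \<in> ?V" "x \<notin> ?B"
      by blast
    then obtain s where s: "s \<in># ts" "odd_zero \<Gamma> s" "x \<in> set (inner s)"
      by blast
    have "x \<in> set (full t)"
      using path_edges_subset[OF t(2)] t(3) by blast
    then have "t = s"
      using full_disjoint(1)[OF dec fin s(1,3)] t(1) by blast
    then show "\<exists>t\<in>#ts. odd_zero \<Gamma> t \<and> e \<in># path_edges (full t)"
      using s t by blast
  next
    assume "\<exists>t\<in>#ts. odd_zero \<Gamma> t \<and> e \<in># path_edges (full t)"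
    then obtain t where t: "t \<in># ts" "odd_zero \<Gamma> t" "e \<in># path_edges (full t)"
      by blast
    have "set (full t) \<subseteq> ?B \<union> set (inner t)"
      using ok[OF t(1)] by (cases t) auto
    then have "set_mset e \<subseteq> ?V"
      using path_edges_subset[OF t(3)] t(1,2) by blast
    moreover have "set_mset e \<inter> set (inner t) \<noteq> {}"
    proof -
      have "inner t \<noteq> []"
        using t(2) by (auto simp: odd_zero_def)
      then show ?thesis
        using t(3) path_edges_meet by (cases t) simp
    qed
    ultimately show "(\<exists>t\<in>#ts. e \<in># path_edges (full t)) \<and> set_mset e \<subseteq> ?V \<and> \<not> set_mset e \<subseteq> ?B"
      using t notB by blast
  qed
  finally show ?thesis .
qed

text \<open>The branching vertices in one connected component of the zero part, as
  \<open>component_zero_part\<close> shows.\<close>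

definition link_class :: "'a wgraph \<Rightarrow> 'a triple multiset \<Rightarrow> 'a \<Rightarrow> 'a set" where
  "link_class \<Gamma> ts u = {v. (linked \<Gamma> ts)\<^sup>*\<^sup>* u v}"

lemma link_class_self [simp]: "u \<in> link_class \<Gamma> ts u"
  by (simp add: link_class_def)

lemma link_class_eq:
  assumes "v \<in> link_class \<Gamma> ts u"
  shows "link_class \<Gamma> ts v = link_class \<Gamma> ts u"
proof -
  have uv: "(linked \<Gamma> ts)\<^sup>*\<^sup>* u v"
    using assms by (simp add: link_class_def)
  show ?thesis
    unfolding link_class_def
    using rtranclp_trans[OF uv] rtranclp_trans[OF linkeds_sym[OF uv]] by blast
qed

lemma link_class_linked: "v \<in> link_class \<Gamma> ts u \<Longrightarrow> linked \<Gamma> ts v w \<Longrightarrow> w \<in> link_class \<Gamma> ts u"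
  unfolding link_class_def by (auto intro: rtranclp.rtrancl_into_rtrancl)

lemma link_class_subset:
  assumes "decomp \<Gamma> B ts" "u \<in> B"
  shows "link_class \<Gamma> ts u \<subseteq> B"
proof
  fix v assume "v \<in> link_class \<Gamma> ts u"
  then have "(linked \<Gamma> ts)\<^sup>*\<^sup>* u v"
    by (simp add: link_class_def)
  then show "v \<in> B"
  proof (induction rule: rtranclp_induct)
    case (step y z)
    then show ?case
      using assms(1) by (fastforce simp: linked_def decomp_def)
  qed (rule assms(2))
qed

text \<open>If the path of an odd zero segment meets the class, then all its branching ends belong
  to the class. So the class together with these segments is closed under adjacency, and it is
  connected along the paths.\<close>

lemma zero_component:
  assumes wg: "weighted_graph \<Gamma>" and dec: "decomp \<Gamma> (branching \<Gamma>) ts" and u: "u \<in> branching \<Gamma>"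
  shows "{v. (adjacent (zero_part \<Gamma>))\<^sup>*\<^sup>* u v} = link_class \<Gamma> ts u \<union>
    (\<Union>t\<in>{t. t \<in># ts \<and> odd_zero \<Gamma> t \<and> set (full t) \<inter> link_class \<Gamma> ts u \<noteq> {}}. set (inner t))"
    (is "?A = ?K \<union> ?I")
proof -
  let ?B = "branching \<Gamma>" and ?Z = "zero_part \<Gamma>"
  have fin: "finite (verts \<Gamma>)"
    using wg by (simp add: weighted_graph_def)
  have KB: "?K \<subseteq> ?B"
    by (rule link_class_subset[OF dec u])
  have ok: "ok ?B t" if "t \<in># ts" for t
    using dec that by (simp add: decomp_def)
  have notB: "x \<notin> ?B" if "t \<in># ts" "x \<in> set (inner t)" for t x
    using decomp_inner_notin[OF dec fin that] by simp
  have full_sub: "set (full t) \<subseteq> ?K \<union> ?I"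
    if t: "t \<in># ts" "odd_zero \<Gamma> t" and meet: "set (full t) \<inter> ?K \<noteq> {}" for t
  proof -
    obtain p xs q where tt: "t = (p, xs, q)"
      by (cases t)
    have "set_option p \<union> set_option q \<subseteq> ?K"
    proof (cases p; cases q)
      fix a b assume ab: "p = Some a" "q = Some b"
      then have "linked \<Gamma> ts a b" "linked \<Gamma> ts b a"
        using t unfolding linked_def tt by blast+
      moreover have "a \<in> ?K \<or> b \<in> ?K"
        using meet notB[OF t(1)] KB by (auto simp: tt ab)
      ultimately show ?thesis
        using link_class_linked ab by fastforce
    qed (use meet notB[OF t(1)] KB in \<open>auto simp: tt\<close>)
    moreover have "set (inner t) \<subseteq> ?I"
      using t meet by blast
    ultimately show ?thesis
      by (auto simp: tt)
  qed
  have "?A \<subseteq> ?K \<union> ?I"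
  proof
    fix v assume "v \<in> ?A"
    then have "(adjacent ?Z)\<^sup>*\<^sup>* u v"
      by simp
    then show "v \<in> ?K \<union> ?I"
    proof (rule adjacent_closed)
      fix e assume e: "e \<in># edges ?Z" "set_mset e \<inter> (?K \<union> ?I) \<noteq> {}"
      then obtain t where t: "t \<in># ts" "odd_zero \<Gamma> t" "e \<in># path_edges (full t)"
        using edges_zero_part[OF wg dec] by blast
      have sub: "set_mset e \<subseteq> set (full t)"
        by (rule path_edges_subset[OF t(3)])
      obtain y where y: "y \<in># e" "y \<in> ?K \<or> y \<in> ?I"
        using e(2) by blast
      have "set (full t) \<inter> ?K \<noteq> {}"
      proof (cases "y \<in> ?K")
        case False
        then obtain s where s: "s \<in># ts" "set (full s) \<inter> ?K \<noteq> {}" "y \<in> set (inner s)"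
          using y(2) by blast
        have "t = s"
          using full_disjoint(1)[OF dec fin s(1,3)] t(1) y(1) sub by blast
        then show ?thesis
          using s by blast
      qed (use y sub in blast)
      then show "set_mset e \<subseteq> ?K \<union> ?I"
        using full_sub[OF t(1,2)] sub by blast
    qed simp
  qed
  moreover have con: "(adjacent ?Z)\<^sup>*\<^sup>* a b"
    if "t \<in># ts" "odd_zero \<Gamma> t" "a \<in> set (full t)" "b \<in> set (full t)" for t a b
  proof (rule path_connected[OF _ that(3,4)])
    show "set_mset (path_edges (full t)) \<subseteq> set_mset (edges ?Z)"
      using edges_zero_part[OF wg dec] that(1,2) by blast
  qed
  have K: "?K \<subseteq> ?A"
  proof
    fix v assume "v \<in> ?K"
    then have "(linked \<Gamma> ts)\<^sup>*\<^sup>* u v"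
      by (simp add: link_class_def)
    then show "v \<in> ?A"
    proof (induction rule: rtranclp_induct)
      case (step y z)
      then obtain t where t: "t \<in># ts" "odd_zero \<Gamma> t" "y \<in> set (full t)" "z \<in> set (full t)"
        unfolding linked_def by fastforce
      then show ?case
        using step(3) con[OF t] by auto
    qed simp
  qed
  have "?I \<subseteq> ?A"
  proof
    fix y assume "y \<in> ?I"
    then obtain t v where t: "t \<in># ts" "odd_zero \<Gamma> t" "v \<in> set (full t)" "v \<in> ?K" "y \<in> set (inner t)"
      by blast
    have "y \<in> set (full t)"
      using t(5) by (cases t) auto
    then show "y \<in> ?A"
      using con[OF t(1-3)] K t(4) by fastforce
  qed
  ultimately show ?thesis
    using K by blast
qed

lemma component_verts:
  assumes "y \<in> verts Z" "\<And>e. e \<in># edges Z \<Longrightarrow> set_mset e \<subseteq> verts Z"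
  shows "verts (induced Z {v. (adjacent Z)\<^sup>*\<^sup>* y v}) = {v. (adjacent Z)\<^sup>*\<^sup>* y v}"
proof -
  have "v \<in> verts Z" if "(adjacent Z)\<^sup>*\<^sup>* y v" for v
    using adjacent_closed[OF that assms(1)] assms(2) by blast
  then show ?thesis
    by (auto simp: induced_def)
qed

lemma zero_part_edges_in: "e \<in># edges (zero_part \<Gamma>) \<Longrightarrow> set_mset e \<subseteq> verts (zero_part \<Gamma>)"
  by (auto simp: zero_part_def Let_def)

text \<open>By \<open>inner_degree\<close> an inner vertex has degree 1 only if it is the outermost
  one towards a free end while the other end is attached. Thus end-vertices of \<Gamma> in G
  correspond to free links of its class.\<close>

lemma component_zero_part:
  assumes wg: "weighted_graph \<Gamma>" and dec: "decomp \<Gamma> (branching \<Gamma>) ts"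
    and G: "G \<in> components (zero_part \<Gamma>)" and u: "u \<in> verts G \<inter> branching \<Gamma>"
  shows "verts G \<inter> branching \<Gamma> = link_class \<Gamma> ts u"
    "has_end_vertex \<Gamma> G \<longleftrightarrow> (\<exists>v\<in>link_class \<Gamma> ts u. free_link \<Gamma> ts v)"
proof -
  let ?B = "branching \<Gamma>" and ?Z = "zero_part \<Gamma>" and ?K = "link_class \<Gamma> ts u"
  have fin: "finite (verts \<Gamma>)"
    using wg by (simp add: weighted_graph_def)
  have ok: "ok ?B t" if "t \<in># ts" for t
    using dec that by (simp add: decomp_def)
  have notB: "x \<notin> ?B" if "t \<in># ts" "x \<in> set (inner t)" for t x
    using decomp_inner_notin[OF dec fin that] by simp
  obtain y where y: "y \<in> verts ?Z" "G = induced ?Z {v. (adjacent ?Z)\<^sup>*\<^sup>* y v}"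
    using G by (auto simp: components_def)
  then have VGy: "verts G = {v. (adjacent ?Z)\<^sup>*\<^sup>* y v}"
    using component_verts[OF y(1) zero_part_edges_in] by simp
  then have yu: "(adjacent ?Z)\<^sup>*\<^sup>* y u"
    using u by simp
  have VG: "verts G = {v. (adjacent ?Z)\<^sup>*\<^sup>* u v}"
    unfolding VGy using rtranclp_trans[OF yu] rtranclp_trans[OF adjacent_rtranclp_sym[OF yu]]
    by blast
  have uB: "u \<in> ?B"
    using u by simp
  have KB: "?K \<subseteq> ?B"
    by (rule link_class_subset[OF dec uB])
  note comp = zero_component[OF wg dec uB]
  show "verts G \<inter> ?B = ?K"
    unfolding VG comp using KB notB by blast
  show "has_end_vertex \<Gamma> G \<longleftrightarrow> (\<exists>v\<in>?K. free_link \<Gamma> ts v)"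
  proof
    assume "has_end_vertex \<Gamma> G"
    then obtain x where x: "x \<in> verts G" "degree \<Gamma> x = 1" "x \<in> verts \<Gamma>"
      by (auto simp: has_end_vertex_def end_vertices_def)
    have "x \<notin> ?B"
      using x by (simp add: branching_def)
    then obtain t where t: "t \<in># ts" "odd_zero \<Gamma> t" "set (full t) \<inter> ?K \<noteq> {}" "x \<in> set (inner t)"
      using x(1) KB unfolding VG comp by blast
    obtain p xs q where tt: "t = (p, xs, q)"
      by (cases t)
    have pq: "p = None \<or> q = None"
    proof (rule ccontr)
      assume "\<not> (p = None \<or> q = None)"
      then obtain a b where ab: "p = Some a" "q = Some b"
        by auto
      then have "a \<noteq> x" "b \<noteq> x"
        using ok[OF t(1)] \<open>x \<notin> ?B\<close> by (auto simp: tt)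
      then show False
        using inner_degree[OF dec fin t(1,4)] x(2) by (simp add: tt ab)
    qed
    obtain v where v: "v \<in> ?K" "v \<in> set (full t)"
      using t(3) by blast
    then have "p = Some v \<or> q = Some v"
      using notB[OF t(1)] KB by (auto simp: tt)
    then have "free_link \<Gamma> ts v"
      using pq t(1,2) unfolding free_link_def tt by blast
    then show "\<exists>v\<in>?K. free_link \<Gamma> ts v"
      using v by blast
  next
    assume "\<exists>v\<in>?K. free_link \<Gamma> ts v"
    then obtain v t where v: "v \<in> ?K" and t: "t \<in># ts" "odd_zero \<Gamma> t"
      and tx: "\<exists>xs. t = (Some v, xs, None) \<or> t = (None, xs, Some v)"
      unfolding free_link_def by blast
    have vB: "v \<in> ?B"
      using v KB by blast
    have "\<exists>x. x \<in> set (inner t) \<and> degree \<Gamma> x = 1"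
      using tx
    proof (elim exE disjE)
      fix xs assume tt: "t = (Some v, xs, None)"
      then have "xs \<noteq> []"
        using ok[OF t(1)] by auto
      then have x: "last xs \<in> set xs"
        by simp
      moreover have "last xs \<noteq> v"
        using notB[OF t(1)] x vB by (auto simp: tt)
      moreover have "last xs \<in> set (inner t)"
        using x by (simp add: tt)
      ultimately show ?thesis
        using inner_degree[OF dec fin t(1), of "last xs"] \<open>xs \<noteq> []\<close>
        by (intro exI[of _ "last xs"]) (simp add: tt)
    next
      fix xs assume tt: "t = (None, xs, Some v)"
      then have "xs \<noteq> []"
        using ok[OF t(1)] by auto
      then have x: "hd xs \<in> set xs"
        by simp
      moreover have "hd xs \<noteq> v"
        using notB[OF t(1)] x vB by (auto simp: tt)
      moreover have "hd xs \<in> set (inner t)"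
        using x by (simp add: tt)
      ultimately show ?thesis
        using inner_degree[OF dec fin t(1), of "hd xs"] \<open>xs \<noteq> []\<close>
        by (intro exI[of _ "hd xs"]) (simp add: tt)
    qed
    then obtain x where x: "x \<in> set (inner t)" "degree \<Gamma> x = 1"
      by blast
    have "v \<in> set (full t)"
      using tx by auto
    then have "x \<in> verts G"
      unfolding VG comp using x v t by blast
    moreover have "x \<in> verts \<Gamma>"
      using decomp_inner_notin[OF dec fin t(1) x(1)] by simp
    ultimately show "has_end_vertex \<Gamma> G"
      using x(2) by (auto simp: has_end_vertex_def end_vertices_def)
  qed
qed

section \<open>The group of realisable weight changes\<close>

lemma component_exists:
  assumes "u \<in> verts Z"
  obtains G where "G \<in> components Z" "u \<in> verts G"
  using assms that[of "induced Z {v. (adjacent Z)\<^sup>*\<^sup>* u v}"]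
  by (auto simp: components_def induced_def)

text \<open>The change must be realisable from every weight function that agrees with \<Gamma> off
  the branching vertices, not only from the given one; this makes such changes closed under sums and
  negatives.\<close>

definition move :: "'a::infinite wgraph \<Rightarrow> ('a \<Rightarrow> int) \<Rightarrow> bool" where
  "move \<Gamma> d \<longleftrightarrow> (\<forall>v. v \<notin> branching \<Gamma> \<longrightarrow> d v = 0) \<and>
     (\<forall>w. (\<forall>v. v \<notin> branching \<Gamma> \<longrightarrow> w v = weight \<Gamma> v) \<longrightarrow> wequiv \<Gamma> w (\<lambda>v. w v + d v))"

lemma move_zero: "move \<Gamma> (\<lambda>_. 0)"
  by (simp add: move_def wequiv_refl)

lemma move_add:
  assumes "move \<Gamma> d" "move \<Gamma> d'"
  shows "move \<Gamma> (\<lambda>v. d v + d' v)"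
  unfolding move_def
proof (intro conjI allI impI)
  fix w :: "'a \<Rightarrow> int" assume w: "\<forall>v. v \<notin> branching \<Gamma> \<longrightarrow> w v = weight \<Gamma> v"
  have "wequiv \<Gamma> w (\<lambda>v. w v + d v)"
    using assms(1) w by (simp add: move_def)
  moreover have "wequiv \<Gamma> (\<lambda>v. w v + d v) (\<lambda>v. (w v + d v) + d' v)"
    using assms w unfolding move_def by (metis add.right_neutral)
  ultimately show "wequiv \<Gamma> w (\<lambda>v. w v + (d v + d' v))"
    using wequiv_trans by (simp add: add.assoc)
qed (use assms in \<open>simp add: move_def\<close>)

lemma move_uminus:
  assumes "move \<Gamma> d"
  shows "move \<Gamma> (\<lambda>v. - d v)"
  unfolding move_def
proof (intro conjI allI impI)
  fix w :: "'a \<Rightarrow> int" assume w: "\<forall>v. v \<notin> branching \<Gamma> \<longrightarrow> w v = weight \<Gamma> v"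
  have "wequiv \<Gamma> (\<lambda>v. w v + - d v) (\<lambda>v. (w v + - d v) + d v)"
    using assms w unfolding move_def by (metis add.right_neutral add.inverse_neutral)
  then show "wequiv \<Gamma> w (\<lambda>v. w v + - d v)"
    using wequiv_sym by simp
qed (use assms in \<open>simp add: move_def\<close>)

lemma move_multiple:
  assumes "move \<Gamma> d"
  shows "move \<Gamma> (\<lambda>v. k * d v)"
proof -
  have nat: "move \<Gamma> (\<lambda>v. int n * d v)" for n
  proof (induction n)
    case (Suc n)
    then show ?case
      using move_add[OF assms Suc] by (simp add: algebra_simps)
  qed (simp add: move_zero)
  show ?thesis
  proof (cases "k \<ge> 0")
    case True
    then show ?thesis
      using nat[of "nat k"] by simp
  next
    case False
    then show ?thesis
      using move_uminus[OF nat[of "nat (- k)"]] by simp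
  qed
qed

lemma move_linked:
  assumes wg: "weighted_graph \<Gamma>" and dec: "decomp \<Gamma> (branching \<Gamma>) ts" and uv: "linked \<Gamma> ts u v"
  shows "move \<Gamma> (\<lambda>y. delta v y - delta u y)"
proof -
  have fin: "finite (verts \<Gamma>)"
    using wg by (simp add: weighted_graph_def)
  have *: "move \<Gamma> (\<lambda>y. delta v y - delta u y)"
    if t: "(Some u, xs, Some v) \<in># ts" "odd_zero \<Gamma> (Some u, xs, Some v)" for u v xs
    unfolding move_def
  proof (intro conjI allI impI)
    have "u \<in> branching \<Gamma>" "v \<in> branching \<Gamma>"
      using dec t(1) by (auto simp: decomp_def)
    then show "delta v y - delta u y = 0" if "y \<notin> branching \<Gamma>" for y
      using that by (auto simp: delta_def)
    fix w assume w: "\<forall>y. y \<notin> branching \<Gamma> \<longrightarrow> w y = weight \<Gamma> y"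
    then have "\<forall>x\<in>set xs. w x = 0"
      using t(2) decomp_inner_notin[OF dec fin t(1)] by (auto simp: odd_zero_def)
    then have "wequiv \<Gamma> w (\<lambda>y. w y - delta u y + delta v y)"
      using t(2) by (intro odd_zero_move[OF wg dec t(1)]) (auto simp: odd_zero_def)
    then show "wequiv \<Gamma> w (\<lambda>y. w y + (delta v y - delta u y))"
      by (simp add: algebra_simps)
  qed
  from uv obtain xs where "(Some u, xs, Some v) \<in># ts \<and> odd_zero \<Gamma> (Some u, xs, Some v) \<or>
      (Some v, xs, Some u) \<in># ts \<and> odd_zero \<Gamma> (Some v, xs, Some u)"
    unfolding linked_def by blast
  then show ?thesis
    using * move_uminus[OF *[of v xs u]] by auto
qed

lemma move_link_class:
  assumes wg: "weighted_graph \<Gamma>" and dec: "decomp \<Gamma> (branching \<Gamma>) ts" and v: "v \<in> link_class \<Gamma> ts u"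
  shows "move \<Gamma> (\<lambda>y. delta v y - delta u y)"
proof -
  have "(linked \<Gamma> ts)\<^sup>*\<^sup>* u v"
    using v by (simp add: link_class_def)
  then show ?thesis
  proof (induction rule: rtranclp_induct)
    case base
    then show ?case
      by (simp add: move_zero)
  next
    case (step y z)
    then show ?case
      using move_add[OF step(3) move_linked[OF wg dec step(2)]] by simp
  qed
qed

lemma move_free:
  assumes wg: "weighted_graph \<Gamma>" and dec: "decomp \<Gamma> (branching \<Gamma>) ts" and u: "free_link \<Gamma> ts u"
  shows "move \<Gamma> (delta u)"
proof -
  have fin: "finite (verts \<Gamma>)"
    using wg by (simp add: weighted_graph_def)
  obtain xs ts' where dec': "decomp \<Gamma> (branching \<Gamma>) ts'" and t: "(Some u, xs, None) \<in># ts'"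
    and oz: "odd (length xs)" "\<forall>x\<in>set xs. weight \<Gamma> x = 0"
  proof -
    from u obtain t xs where t: "t \<in># ts" "odd_zero \<Gamma> t"
      "t = (Some u, xs, None) \<or> t = flip (Some u, rev xs, None)"
      unfolding free_link_def by fastforce
    obtain ts0 where ts: "ts = add_mset t ts0"
      using t(1) by (meson multi_member_split)
    from t(3) show ?thesis
    proof
      assume "t = (Some u, xs, None)"
      then show ?thesis
        using that[OF dec, of xs] t by (auto simp: odd_zero_def)
    next
      assume tt: "t = flip (Some u, rev xs, None)"
      then have "decomp \<Gamma> (branching \<Gamma>) (add_mset (Some u, rev xs, None) ts0)"
        using dec decomp_flip[of \<Gamma> _ "(Some u, rev xs, None)" ts0] ts by simp
      then show ?thesis
        using that[of _ "rev xs"] t tt by (auto simp: odd_zero_def)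
    qed
  qed
  have "move \<Gamma> (\<lambda>y. - delta u y)"
    unfolding move_def
  proof (intro conjI allI impI)
    have "u \<in> branching \<Gamma>"
      using dec' t by (auto simp: decomp_def)
    then show "- delta u y = 0" if "y \<notin> branching \<Gamma>" for y
      using that by (auto simp: delta_def)
    fix w assume "\<forall>y. y \<notin> branching \<Gamma> \<longrightarrow> w y = weight \<Gamma> y"
    then have "\<forall>x\<in>set xs. w x = 0"
      using oz decomp_inner_notin[OF dec' fin t] by auto
    then show "wequiv \<Gamma> w (\<lambda>y. w y + - delta u y)"
      using odd_zero_end_move[OF wg dec' t oz(1)] by simp
  qed
  then show ?thesis
    using move_uminus by fastforce
qed

text \<open>Induction on the support of d: a multiple of a known move kills d at u without enlarging
  the support. If the class of u has a free link, this move is \<open>delta u\<close>; otherwise the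
  vanishing sum yields a second vertex v of the support in the class, and the move is the difference
  of \<open>delta u\<close> and \<open>delta v\<close>.\<close>

lemma move_class_sum:
  assumes wg: "weighted_graph \<Gamma>" and dec: "decomp \<Gamma> (branching \<Gamma>) ts"
    and d: "\<And>v. v \<notin> branching \<Gamma> \<Longrightarrow> d v = 0"
    and sum: "\<And>u. u \<in> branching \<Gamma> \<Longrightarrow> (\<forall>v\<in>link_class \<Gamma> ts u. \<not> free_link \<Gamma> ts v) \<Longrightarrow>
      (\<Sum>v\<in>link_class \<Gamma> ts u. d v) = 0"
  shows "move \<Gamma> d"
  using d sum
proof (induction "card {v. d v \<noteq> 0}" arbitrary: d rule: less_induct)
  case less
  let ?B = "branching \<Gamma>"
  have finB: "finite ?B"
    using wg by (simp add: weighted_graph_def branching_def)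
  have supp: "finite {v. d v \<noteq> 0}"
    using finB less.prems(1) by (metis (mono_tags, lifting) finite_subset mem_Collect_eq subsetI)
  show ?case
  proof (cases "\<exists>u. d u \<noteq> 0")
    case False
    then have "d = (\<lambda>_. 0)"
      by auto
    then show ?thesis
      by (simp add: move_zero)
  next
    case True
    then obtain u where u: "d u \<noteq> 0"
      by blast
    then have uB: "u \<in> ?B"
      using less.prems(1) by blast
    let ?K = "link_class \<Gamma> ts u"
    have KB: "?K \<subseteq> ?B"
      by (rule link_class_subset[OF dec uB])
    have "\<exists>c. move \<Gamma> c \<and> c u = 1 \<and> (\<forall>v. d v = 0 \<longrightarrow> c v = 0) \<and>
      (\<forall>x\<in>?B. (\<forall>v\<in>link_class \<Gamma> ts x. \<not> free_link \<Gamma> ts v) \<longrightarrow> (\<Sum>v\<in>link_class \<Gamma> ts x. c v) = 0)"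
    proof (cases "\<exists>v\<in>?K. free_link \<Gamma> ts v")
      case True
      then obtain v where v: "v \<in> ?K" "free_link \<Gamma> ts v"
        by blast
      have "u \<in> link_class \<Gamma> ts v"
        using link_class_eq[OF v(1)] by simp
      then have "move \<Gamma> (\<lambda>y. delta u y - delta v y)"
        by (rule move_link_class[OF wg dec])
      then have "move \<Gamma> (delta u)"
        using move_add move_free[OF wg dec v(2)] by fastforce
      moreover have "(\<Sum>y\<in>link_class \<Gamma> ts x. delta u y) = 0"
        if "\<forall>v\<in>link_class \<Gamma> ts x. \<not> free_link \<Gamma> ts v" for x
      proof -
        have "u \<notin> link_class \<Gamma> ts x"
          using link_class_eq[of u \<Gamma> ts x] v that by blast
        then show ?thesis
          by (intro sum.neutral) (auto simp: delta_def)
      qed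
      ultimately show ?thesis
        using u by (intro exI[of _ "delta u"]) (auto simp: delta_def)
    next
      case False
      then have s0: "(\<Sum>v\<in>?K. d v) = 0"
        using less.prems(2)[OF uB] by blast
      have finK: "finite ?K"
        using KB finB by (rule finite_subset)
      have "\<exists>v\<in>?K. v \<noteq> u \<and> d v \<noteq> 0"
      proof (rule ccontr)
        assume "\<not> (\<exists>v\<in>?K. v \<noteq> u \<and> d v \<noteq> 0)"
        then have "(\<Sum>v\<in>?K - {u}. d v) = 0"
          by (intro sum.neutral) auto
        then show False
          using s0 u sum.remove[OF finK, of u d] by simp
      qed
      then obtain v where v: "v \<in> ?K" "v \<noteq> u" "d v \<noteq> 0"
        by blast
      have "u \<in> link_class \<Gamma> ts v"
        using link_class_eq[OF v(1)] by simp
      then have "move \<Gamma> (\<lambda>y. delta u y - delta v y)"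
        by (rule move_link_class[OF wg dec])
      moreover have "(\<Sum>y\<in>link_class \<Gamma> ts x. delta u y - delta v y) = 0" if x: "x \<in> ?B" for x
      proof -
        have "finite (link_class \<Gamma> ts x)"
          using link_class_subset[OF dec x] finB by (rule finite_subset)
        moreover have "u \<in> link_class \<Gamma> ts x \<longleftrightarrow> v \<in> link_class \<Gamma> ts x"
          using v(1) link_class_eq by (metis link_class_self)
        ultimately show ?thesis
          by (simp add: sum_subtractf delta_def)
      qed
      ultimately show ?thesis
        using u v by (intro exI[of _ "\<lambda>y. delta u y - delta v y"]) (auto simp: delta_def)
    qed
    then obtain c where c: "move \<Gamma> c" "c u = 1" "\<And>v. d v = 0 \<Longrightarrow> c v = 0"
      "\<And>x. x \<in> ?B \<Longrightarrow> (\<forall>v\<in>link_class \<Gamma> ts x. \<not> free_link \<Gamma> ts v) \<Longrightarrow> (\<Sum>v\<in>link_class \<Gamma> ts x. c v) = 0"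
      by blast
    let ?d = "\<lambda>v. d v - d u * c v"
    have "u \<notin> {v. ?d v \<noteq> 0}" "u \<in> {v. d v \<noteq> 0}" "{v. ?d v \<noteq> 0} \<subseteq> {v. d v \<noteq> 0}"
      using c(2,3) u by auto
    then have "{v. ?d v \<noteq> 0} \<subset> {v. d v \<noteq> 0}"
      by blast
    then have "card {v. ?d v \<noteq> 0} < card {v. d v \<noteq> 0}"
      using supp by (rule psubset_card_mono[rotated])
    then have "move \<Gamma> ?d"
    proof (rule less.hyps)
      show "?d v = 0" if "v \<notin> ?B" for v
        using less.prems(1)[OF that] c(3) by simp
      show "(\<Sum>v\<in>link_class \<Gamma> ts x. ?d v) = 0"
        if "x \<in> ?B" "\<forall>v\<in>link_class \<Gamma> ts x. \<not> free_link \<Gamma> ts v" for x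
        using less.prems(2)[OF that] c(4)[OF that]
        by (simp add: sum_subtractf sum_distrib_left[symmetric])
    qed
    then show ?thesis
      using move_add[OF _ move_multiple[OF c(1), of "d u"]] by fastforce
  qed
qed

lemma standard_decomp:
  assumes "standard \<Gamma>" "\<not> circular \<Gamma>"
  obtains ts where "decomp \<Gamma> (branching \<Gamma>) ts" "red\<^sup>*\<^sup>* (init \<Gamma>) (dstate \<Gamma> (branching \<Gamma>) ts)"
  using assms eliminate unfolding standard_def by metis

text \<open>Over a component without branching vertices both sums are empty; any other component is
  represented by each of its branching vertices.\<close>

lemma branching_weight_change_iff:
  assumes wg: "weighted_graph \<Gamma>" and dec: "decomp \<Gamma> (branching \<Gamma>) ts"
  shows "branching_weight_change \<Gamma> \<Gamma>' \<longleftrightarrow>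
    verts \<Gamma>' = verts \<Gamma> \<and> edges \<Gamma>' = edges \<Gamma> \<and>
    (\<forall>v. v \<notin> branching \<Gamma> \<longrightarrow> weight \<Gamma>' v = weight \<Gamma> v) \<and>
    (\<forall>u\<in>branching \<Gamma>. (\<forall>v\<in>link_class \<Gamma> ts u. \<not> free_link \<Gamma> ts v) \<longrightarrow>
       (\<Sum>b\<in>link_class \<Gamma> ts u. weight \<Gamma>' b) = (\<Sum>b\<in>link_class \<Gamma> ts u. weight \<Gamma> b))"
proof -
  let ?B = "branching \<Gamma>"
  let ?s = "\<lambda>K. (\<Sum>b\<in>K. weight \<Gamma>' b) = (\<Sum>b\<in>K. weight \<Gamma> b)"
  note comp = component_zero_part[OF wg dec]
  have "(\<forall>G\<in>components (zero_part \<Gamma>). \<not> has_end_vertex \<Gamma> G \<longrightarrow> ?s (verts G \<inter> ?B)) \<longleftrightarrow>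
      (\<forall>u\<in>?B. (\<forall>v\<in>link_class \<Gamma> ts u. \<not> free_link \<Gamma> ts v) \<longrightarrow> ?s (link_class \<Gamma> ts u))"
    (is "?L \<longleftrightarrow> ?R")
  proof
    assume L: ?L
    show ?R
    proof (intro ballI impI)
      fix u assume u: "u \<in> ?B" "\<forall>v\<in>link_class \<Gamma> ts u. \<not> free_link \<Gamma> ts v"
      then have "u \<in> verts (zero_part \<Gamma>)"
        by (simp add: verts_zero_part[OF wg dec])
      then obtain G where G: "G \<in> components (zero_part \<Gamma>)" "u \<in> verts G"
        by (rule component_exists)
      then show "?s (link_class \<Gamma> ts u)"
        using L comp[OF G(1), of u] u by (metis IntI)
    qed
  next
    assume R: ?R
    show ?L
    proof (intro ballI impI)
      fix G assume G: "G \<in> components (zero_part \<Gamma>)" "\<not> has_end_vertex \<Gamma> G"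
      show "?s (verts G \<inter> ?B)"
      proof (cases "verts G \<inter> ?B = {}")
        case False
        then obtain u where u: "u \<in> verts G \<inter> ?B"
          by blast
        then show ?thesis
          using R comp[OF G(1) u] G(2) by (metis IntD2)
      qed simp
    qed
  qed
  then show ?thesis
    by (simp add: branching_weight_change_def)
qed

lemma same_graph:
  assumes "verts \<Gamma>' = verts \<Gamma>" "edges \<Gamma>' = edges \<Gamma>"
  shows "degree \<Gamma>' = degree \<Gamma>" "branching \<Gamma>' = branching \<Gamma>" "weighted_graph \<Gamma>' = weighted_graph \<Gamma>"
    "connected_graph \<Gamma>' = connected_graph \<Gamma>" "circular \<Gamma>' = circular \<Gamma>"
    "decomp \<Gamma>' A ts = decomp \<Gamma> A ts"
proof -
  show deg: "degree \<Gamma>' = degree \<Gamma>"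
    using assms by (simp add: degree_def fun_eq_iff)
  have adj: "adjacent \<Gamma>' = adjacent \<Gamma>"
    using assms by (simp add: adjacent_def fun_eq_iff)
  show "branching \<Gamma>' = branching \<Gamma>" "weighted_graph \<Gamma>' = weighted_graph \<Gamma>"
    "connected_graph \<Gamma>' = connected_graph \<Gamma>" "circular \<Gamma>' = circular \<Gamma>"
    "decomp \<Gamma>' A ts = decomp \<Gamma> A ts"
    using assms by (simp_all add: branching_def deg weighted_graph_def connected_graph_def adj
        circular_def cycle_def decomp_def)
qed

text \<open>Segments avoid the branching vertices, and circularity depends on the underlying graph
  alone.\<close>

lemma standard_weight_change:
  assumes std: "standard \<Gamma>" "\<not> circular \<Gamma>" and same: "verts \<Gamma>' = verts \<Gamma>" "edges \<Gamma>' = edges \<Gamma>"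
    and w: "\<And>v. v \<notin> branching \<Gamma> \<Longrightarrow> weight \<Gamma>' v = weight \<Gamma> v"
  shows "standard \<Gamma>'"
proof -
  have wg: "weighted_graph \<Gamma>" "weighted_graph \<Gamma>'"
    using std(1) by (simp_all add: standard_def same_graph[OF same])
  then have fin: "finite (verts \<Gamma>)"
    by (simp add: weighted_graph_def)
  obtain ts where dec: "decomp \<Gamma> (branching \<Gamma>) ts"
    using standard_decomp[OF std] .
  then have dec': "decomp \<Gamma>' (branching \<Gamma>') ts"
    by (simp add: same_graph[OF same])
  have "standard_chain (seg \<Gamma>' (inner t))" if t: "t \<in># ts" "inner t \<noteq> []" for t
  proof -
    have "seg \<Gamma> (inner t) \<in> segments \<Gamma>"
      using segments_decomp[OF wg(1) dec] t by blast
    then have "standard_chain (seg \<Gamma> (inner t))"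
      using std by (simp add: standard_def)
    moreover have "map (weight \<Gamma>') vs = map (weight \<Gamma>) vs" if "chain (seg \<Gamma> (inner t)) vs" for vs
    proof -
      have "set vs = set (inner t)"
        using that by (simp add: chain_iff)
      then show ?thesis
        using decomp_inner_notin[OF dec fin t(1)] w by simp
    qed
    moreover have "chain (seg \<Gamma>' (inner t)) vs = chain (seg \<Gamma> (inner t)) vs" for vs
      by (simp add: chain_iff)
    ultimately show ?thesis
      unfolding standard_chain_def by (metis seg_simps(2))
  qed
  then have "\<forall>L\<in>segments \<Gamma>'. standard_chain L"
    using segments_decomp[OF wg(2) dec'] by auto
  then show ?thesis
    using std by (simp add: standard_def same_graph[OF same])
qed

lemma branching_weight_change_birational:
  fixes \<Gamma> :: "'a::infinite wgraph"
  assumes std: "standard \<Gamma>" "\<not> circular \<Gamma>" and ch: "branching_weight_change \<Gamma> \<Gamma>'"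
  shows "birationally_equivalent \<Gamma> \<Gamma>'"
proof -
  have wg: "weighted_graph \<Gamma>"
    using std(1) by (simp add: standard_def)
  obtain ts where dec: "decomp \<Gamma> (branching \<Gamma>) ts"
    using standard_decomp[OF std] .
  note ch' = ch[unfolded branching_weight_change_iff[OF wg dec]]
  have "move \<Gamma> (\<lambda>v. weight \<Gamma>' v - weight \<Gamma> v)"
    using ch' by (intro move_class_sum[OF wg dec]) (simp_all add: sum_subtractf)
  then have "wequiv \<Gamma> (weight \<Gamma>) (\<lambda>v. weight \<Gamma> v + (weight \<Gamma>' v - weight \<Gamma> v))"
    unfolding move_def by blast
  moreover have "\<Gamma>\<lparr>weight := weight \<Gamma>'\<rparr> = \<Gamma>'"
    using ch' by (cases \<Gamma>; cases \<Gamma>') simp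
  ultimately show ?thesis
    by (simp add: wequiv_def)
qed

lemma normalized_weight_change:
  fixes \<Gamma> :: "'a::infinite wgraph"
  assumes std: "standard \<Gamma>" "\<not> circular \<Gamma>"
  shows "\<exists>\<Gamma>'. branching_weight_change \<Gamma> \<Gamma>' \<and>
    (\<forall>G\<in>components (zero_part \<Gamma>).
       (has_end_vertex \<Gamma> G \<longrightarrow> (\<forall>b\<in>verts G \<inter> branching \<Gamma>. weight \<Gamma>' b = 0)) \<and>
       (\<not> has_end_vertex \<Gamma> G \<and> verts G \<inter> branching \<Gamma> \<noteq> {} \<longrightarrow>
          (\<exists>b\<in>verts G \<inter> branching \<Gamma>.
             weight \<Gamma>' b = (\<Sum>c\<in>verts G \<inter> branching \<Gamma>. weight \<Gamma> c) \<and>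
             (\<forall>c\<in>verts G \<inter> branching \<Gamma> - {b}. weight \<Gamma>' c = 0))))"
proof -
  let ?B = "branching \<Gamma>"
  have wg: "weighted_graph \<Gamma>"
    using std(1) by (simp add: standard_def)
  then have finB: "finite ?B"
    by (simp add: weighted_graph_def branching_def)
  obtain ts where dec: "decomp \<Gamma> ?B ts"
    using standard_decomp[OF std] .
  let ?K = "link_class \<Gamma> ts"
  let ?free = "\<lambda>u. \<exists>v\<in>?K u. free_link \<Gamma> ts v"
  \<comment> \<open>The exceptional vertex is chosen from the class as a set, so that all members of
    the class agree on it.\<close>
  define root where "root K = (SOME x. x \<in> K)" for K :: "'a set"
  have root: "root (?K u) \<in> ?K u" for u
    unfolding root_def by (rule someI[of _ u]) simp
  define w where "w v = (if v \<notin> ?B then weight \<Gamma> v else if ?free v then 0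
    else if v = root (?K v) then \<Sum>c\<in>?K v. weight \<Gamma> c else 0)" for v
  have w_free: "w v = 0" if "u \<in> ?B" "?free u" "v \<in> ?K u" for u v
    using that link_class_eq[OF that(3)] link_class_subset[OF dec that(1)] by (auto simp: w_def)
  have w_root: "w (root (?K u)) = (\<Sum>c\<in>?K u. weight \<Gamma> c)" if "u \<in> ?B" "\<not> ?free u" for u
    using that link_class_eq[OF root] link_class_subset[OF dec that(1)] root[of u]
    by (auto simp: w_def)
  have w_other: "w v = 0" if "u \<in> ?B" "\<not> ?free u" "v \<in> ?K u" "v \<noteq> root (?K u)" for u v
    using that link_class_eq[OF that(3)] link_class_subset[OF dec that(1)] by (auto simp: w_def)
  let ?\<Gamma>' = "\<Gamma>\<lparr>weight := w\<rparr>"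
  have "(\<Sum>b\<in>?K u. w b) = (\<Sum>b\<in>?K u. weight \<Gamma> b)" if u: "u \<in> ?B" "\<not> ?free u" for u
  proof -
    have "finite (?K u)"
      using link_class_subset[OF dec u(1)] finB by (rule finite_subset)
    then have "(\<Sum>b\<in>?K u. w b) = w (root (?K u)) + (\<Sum>b\<in>?K u - {root (?K u)}. w b)"
      using root by (rule sum.remove)
    also have "(\<Sum>b\<in>?K u - {root (?K u)}. w b) = 0"
      using w_other[OF u] by (intro sum.neutral) auto
    finally show ?thesis
      using w_root[OF u] by simp
  qed
  then have "branching_weight_change \<Gamma> ?\<Gamma>'"
    unfolding branching_weight_change_iff[OF wg dec] by (auto simp: w_def)
  moreover have "(has_end_vertex \<Gamma> G \<longrightarrow> (\<forall>b\<in>verts G \<inter> ?B. w b = 0)) \<and>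
      (\<not> has_end_vertex \<Gamma> G \<and> verts G \<inter> ?B \<noteq> {} \<longrightarrow>
        (\<exists>b\<in>verts G \<inter> ?B. w b = (\<Sum>c\<in>verts G \<inter> ?B. weight \<Gamma> c) \<and>
           (\<forall>c\<in>verts G \<inter> ?B - {b}. w c = 0)))"
    if G: "G \<in> components (zero_part \<Gamma>)" for G
  proof (cases "verts G \<inter> ?B = {}")
    case False
    then obtain u where u: "u \<in> verts G \<inter> ?B"
      by blast
    then have uB: "u \<in> ?B"
      by simp
    note comp = component_zero_part[OF wg dec G u]
    show ?thesis
      unfolding comp
      using w_free[OF uB] w_root[OF uB] w_other[OF uB] root[of u] by blast
  qed blast
  ultimately show ?thesis
    by (intro exI[of _ ?\<Gamma>'] conjI ballI) simp_all
qed

section \<open>Matching paths and reversing segments\<close>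

lemma image_mset_eq_matching:
  assumes "image_mset f A = image_mset g B"
  obtains R where "image_mset fst R = A" "image_mset snd R = B" "\<And>a b. (a, b) \<in># R \<Longrightarrow> f a = g b"
proof -
  have "\<exists>R. image_mset fst R = A \<and> image_mset snd R = B \<and> (\<forall>(a, b)\<in>#R. f a = g b)"
    using assms
  proof (induction A arbitrary: B)
    case (add a A)
    then have "f a \<in># image_mset g B"
      by (metis image_mset_add_mset union_single_eq_member)
    then obtain b where b: "b \<in># B" "f a = g b"
      by auto
    then obtain B' where B: "B = add_mset b B'"
      by (meson multi_member_split)
    have "image_mset f A = image_mset g B'"
      using add.prems b(2) by (simp add: B)
    from add.IH[OF this] obtain R where "image_mset fst R = A" "image_mset snd R = B'"
      "\<forall>(a, b)\<in>#R. f a = g b"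
      by blast
    then show ?case
      using b(2) by (intro exI[of _ "add_mset (a, b) R"]) (simp add: B)
  qed simp
  then show ?thesis
    using that by blast
qed

lemma ex_map_eq:
  assumes "distinct xs" "length xs = length ys"
  shows "\<exists>f. map f xs = ys"
  using assms
proof (induction xs arbitrary: ys)
  case (Cons x xs)
  then obtain y ys' where ys: "ys = y # ys'" "length xs = length ys'"
    by (cases ys) auto
  then obtain f where f: "map f xs = ys'"
    using Cons by auto
  have "map (f(x := y)) (x # xs) = ys"
    using f ys(1) Cons.prems(1) by (auto simp: map_fun_upd)
  then show ?case
    by (intro exI[of _ "f(x := y)"])
qed simp

text \<open>The bound on multiplicities excludes repetitions within a first list and between
  different ones, so the assignments by position never conflict.\<close>

lemma ex_common_map:
  assumes "\<And>xs ys. (xs, ys) \<in># P \<Longrightarrow> length xs = length ys"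
    "\<And>v. count (\<Sum>(xs, ys)\<in>#P. mset xs) v \<le> 1"
  shows "\<exists>f. \<forall>(xs, ys)\<in>#P. map f xs = ys"
  using assms
proof (induction P)
  case (add p P)
  obtain xs ys where p: "p = (xs, ys)"
    by (cases p)
  have cnt: "count (mset xs) v + count (\<Sum>(xs, ys)\<in>#P. mset xs) v \<le> 1" for v
    using add.prems(2)[of v] by (simp add: p)
  obtain f where f: "\<forall>(xs, ys)\<in>#P. map f xs = ys"
    using add.IH add.prems(1) cnt by (metis add_leD2 insert_iff set_mset_add_mset_insert)
  have le: "count (mset xs) v \<le> 1" for v
    using cnt[of v] by linarith
  have "distinct xs"
    unfolding distinct_count_atmost_1
  proof
    fix v
    show "count (mset xs) v = (if v \<in> set xs then 1 else 0)"
    proof (cases "v \<in> set xs")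
      case True
      then have "count (mset xs) v \<ge> 1"
        by (simp add: count_greater_eq_one_iff)
      then show ?thesis
        using le[of v] True by (simp only: if_True le_antisym)
    next
      case False
      then show ?thesis
        by (simp add: not_in_iff[symmetric])
    qed
  qed
  then obtain g where g: "map g xs = ys"
    using ex_map_eq add.prems(1) by (metis p union_single_eq_member)
  have disj: "v \<notin> set xs" if "(as, bs) \<in># P" "v \<in> set as" for as bs v
  proof
    assume "v \<in> set xs"
    then have "count (mset xs) v \<ge> 1"
      by (simp add: count_greater_eq_one_iff)
    moreover have "v \<in># (\<Sum>(xs, ys)\<in>#P. mset xs)"
      using that by (force simp: in_Union_mset_iff)
    then have "count (\<Sum>(xs, ys)\<in>#P. mset xs) v \<ge> 1"
      by (simp add: count_greater_eq_one_iff del: in_Union_mset_iff)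
    ultimately show False
      using cnt[of v] by linarith
  qed
  let ?h = "\<lambda>v. if v \<in> set xs then g v else f v"
  have "map ?h xs = ys"
    using g by auto
  moreover have "map ?h as = bs" if P: "(as, bs) \<in># P" for as bs
  proof -
    have "map ?h as = map f as"
      using disj[OF P] by simp
    then show ?thesis
      using f P by auto
  qed
  ultimately show ?case
    by (intro exI[of _ ?h]) (auto simp: p)
qed simp

lemma reversion_triple:
  assumes wg: "weighted_graph \<Gamma>" and dec: "decomp \<Gamma> (branching \<Gamma>) ts" and t: "t \<in># ts"
    and eq: "map w (inner t) = map w' (inner t) \<or>
      (\<exists>k us. even_std k us (map w (inner t)) \<and> even_std k us (map w' (inner t)))"
    and off: "\<And>v. v \<notin> set (inner t) \<Longrightarrow> w' v = w v"
  shows "w' = w \<or> reversion (\<Gamma>\<lparr>weight := w\<rparr>) (\<Gamma>\<lparr>weight := w'\<rparr>)"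
proof (cases "map w (inner t) = map w' (inner t)")
  case True
  then have "w' v = w v" for v
    using off by (cases "v \<in> set (inner t)") auto
  then show ?thesis
    by auto
next
  case False
  then obtain k us where us: "even_std k us (map w (inner t))" "even_std k us (map w' (inner t))"
    using eq by blast
  let ?G = "\<Gamma>\<lparr>weight := w\<rparr>" and ?xs = "inner t"
  have ne: "?xs \<noteq> []"
    using False by auto
  have same: "verts ?G = verts \<Gamma>" "edges ?G = edges \<Gamma>"
    by simp_all
  have wgG: "weighted_graph ?G" and decG: "decomp ?G (branching ?G) ts"
    using wg dec by (simp_all add: same_graph[OF same])
  have L: "seg ?G ?xs \<in> segments ?G"
    using segments_decomp[OF wgG decG] t ne by blast
  have ch: "chain (seg ?G ?xs) ?xs" "chain (seg ?G ?xs) (rev ?xs)"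
    using chain_seg[OF wgG decG t ne] by (auto simp: chain_iff)
  from False us consider
    "map w ?xs = replicate (2 * k) 0 @ us" "map w' ?xs = us @ replicate (2 * k) 0"
    | "map w ?xs = us @ replicate (2 * k) 0" "map w' ?xs = replicate (2 * k) 0 @ us"
    unfolding even_std_def by metis
  then have "reversion ?G (\<Gamma>\<lparr>weight := w'\<rparr>)"
  proof cases
    case 1
    show ?thesis
      unfolding reversion_def using 1 us off
      by (intro bexI[OF _ L] exI[of _ ?xs] exI[of _ k] exI[of _ us] conjI ch)
        (auto simp: even_std_def le_m2_def)
  next
    case 2
    \<comment> \<open>\<open>reversion\<close> expects the zeros in front, so the segment is read
      from its other end.\<close>
    have "map w (rev ?xs) = replicate (2 * k) 0 @ rev us" "map w' (rev ?xs) = rev us @ replicate (2 * k) 0"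
      using 2 by (simp_all flip: rev_map)
    then show ?thesis
      unfolding reversion_def using us off
      by (intro bexI[OF _ L] exI[of _ "rev ?xs"] exI[of _ k] exI[of _ "rev us"] conjI ch)
        (auto simp: even_std_def le_m2_def)
  qed
  then show ?thesis
    by simp
qed

lemma reversions:
  assumes wg: "weighted_graph \<Gamma>" and dec: "decomp \<Gamma> (branching \<Gamma>) ts"
    and eq: "\<And>t. t \<in># ts \<Longrightarrow> map w (inner t) = map w' (inner t) \<or>
      (\<exists>k us. even_std k us (map w (inner t)) \<and> even_std k us (map w' (inner t)))"
    and off: "\<And>v. v \<notin> (\<Union>t\<in>set_mset ts. set (inner t)) \<Longrightarrow> w' v = w v"
  shows "reversion\<^sup>*\<^sup>* (\<Gamma>\<lparr>weight := w\<rparr>) (\<Gamma>\<lparr>weight := w'\<rparr>)"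
proof -
  have fin: "finite (verts \<Gamma>)"
    using wg by (simp add: weighted_graph_def)
  \<comment> \<open>\<open>m S\<close> carries the new weights on the paths in S and the old ones
    elsewhere. Inner lists are disjoint, so enlarging S by one path leaves the others untouched and
    costs at most one reversion.\<close>
  define m where "m S v = (if v \<in> (\<Union>t\<in>S. set (inner t)) then w' v else w v)" for S :: "'a triple set" and v
  have *: "reversion\<^sup>*\<^sup>* (\<Gamma>\<lparr>weight := w\<rparr>) (\<Gamma>\<lparr>weight := m S\<rparr>)" if "finite S" "S \<subseteq> set_mset ts" for S
    using that
  proof (induction S rule: finite_induct)
    case empty
    have "m {} = w"
      by (auto simp: m_def)
    then show ?case
      by simp
  next
    case (insert t S)
    have t: "t \<in># ts"
      using insert by simp
    have "map (m S) (inner t) = map w (inner t)"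
    proof (rule map_cong[OF refl])
      fix v assume v: "v \<in> set (inner t)"
      have "v \<notin> set (inner s)" if "s \<in> S" for s
        using inner_unique_triple[OF dec fin t _ v, of s] that insert by blast
      then show "m S v = w v"
        by (simp add: m_def)
    qed
    moreover have "map (m (insert t S)) (inner t) = map w' (inner t)"
      by (simp add: m_def)
    ultimately have "m (insert t S) = m S \<or>
        reversion (\<Gamma>\<lparr>weight := m S\<rparr>) (\<Gamma>\<lparr>weight := m (insert t S)\<rparr>)"
      using eq[OF t] by (intro reversion_triple[OF wg dec t]) (simp only:, simp add: m_def)
    then show ?case
      using insert by (auto intro: rtranclp.rtrancl_into_rtrancl)
  qed
  have "m (set_mset ts) = w'"
    using off by (auto simp: m_def fun_eq_iff)
  then show ?thesis
    using *[of "set_mset ts"] by simp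
qed

lemma bij_betw_mset_set:
  assumes "image_mset f (mset_set A) = mset_set C" "finite A" "finite C"
  shows "bij_betw f A C"
proof -
  have "f ` A = C"
    using arg_cong[OF assms(1), of set_mset] assms(2,3) by simp
  moreover have "card A = card C"
    using arg_cong[OF assms(1), of size] by simp
  ultimately show ?thesis
    using assms(2) by (simp add: bij_betw_def eq_card_imp_inj_on)
qed


section \<open>Reading a standard graph off its normal form\<close>

definition std_labels :: "'a dart multiset multiset \<Rightarrow> bool" where
  "std_labels M \<longleftrightarrow> (\<forall>e\<in>#M. \<exists>p ws q. e = ledge p (word ws) q \<and> std ws)"

lemma std_labels_det: "std_labels M \<Longrightarrow> det_one M"
  by (fastforce simp: std_labels_def det_one_def ledge_def)

lemma std_labels_canon:
  assumes "std_labels M"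
  shows "image_mset canon_edge M = M"
proof -
  have "canon_edge e = e" if "e \<in># M" for e
    using assms that by (force simp: std_labels_def canon_edge_ledge canon_std)
  then have "image_mset canon_edge M = image_mset (\<lambda>e. e) M"
    by (intro image_mset_cong)
  then show ?thesis
    by simp
qed

text \<open>No shear splits off from the word of a standard chain in either direction, so only the
  weights contribute.\<close>

lemma std_labels_pot:
  assumes "std_labels M"
  shows "pot K b M = 2 * (\<Sum>x\<in>K. b x)"
proof -
  have "(\<Sum>d\<in>#e. dart_pot K d) = 0" if M: "e \<in># M" for e
  proof -
    obtain p ws q where e: "e = ledge p (word ws) q" "std ws"
      using assms M unfolding std_labels_def by blast
    show ?thesis
      unfolding e(1) using lsh_std[OF e(2)] lsh_std[OF std_rev[OF e(2)]]
      by (simp add: ledge_def dart_pot_def star_word rev_map)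
  qed
  then have "(\<Sum>e\<in>#M. \<Sum>d\<in>#e. dart_pot K d) = (\<Sum>e\<in>#M. 0)"
    by (intro arg_cong[where f = sum_mset] image_mset_cong)
  then show ?thesis
    by (simp add: pot_def)
qed

lemma decomp_reorient:
  assumes "decomp \<Gamma> A (image_mset h R)" "\<And>r. r \<in># R \<Longrightarrow> h' r = h r \<or> h' r = flip (h r)"
  shows "decomp \<Gamma> A (image_mset h' R)"
proof -
  have "(\<Sum>r\<in>#R. mset (inner (h' r))) = (\<Sum>r\<in>#R. mset (inner (h r)))"
    "(\<Sum>r\<in>#R. path_edges (full (h' r))) = (\<Sum>r\<in>#R. path_edges (full (h r)))"
    using assms(2) by (intro arg_cong[where f = sum_mset] image_mset_cong; fastforce)+
  moreover have "\<forall>r\<in>#R. ok A (h' r)"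
    using assms by (fastforce simp: decomp_def)
  ultimately show ?thesis
    using assms(1) by (simp add: decomp_def multiset.map_comp comp_def)
qed

lemma slabel_std_labels:
  assumes "standard \<Gamma>" "\<not> circular \<Gamma>" "decomp \<Gamma> (branching \<Gamma>) ts"
  shows "std_labels (image_mset (slabel (weight \<Gamma>)) ts)"
    "image_mset (slabel (lweight \<Gamma>)) ts = image_mset (slabel (weight \<Gamma>)) ts"
proof -
  have fin: "finite (verts \<Gamma>)"
    using assms(1) by (simp add: standard_def weighted_graph_def)
  show "std_labels (image_mset (slabel (weight \<Gamma>)) ts)"
    unfolding std_labels_def
  proof
    fix e assume "e \<in># image_mset (slabel (weight \<Gamma>)) ts"
    then obtain p xs q where "(p, xs, q) \<in># ts" "e = slabel (weight \<Gamma>) (p, xs, q)"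
      by auto
    then show "\<exists>p ws q. e = ledge p (word ws) q \<and> std ws"
      using std_triple[OF assms, of "(p, xs, q)"] by auto
  qed
  show "image_mset (slabel (lweight \<Gamma>)) ts = image_mset (slabel (weight \<Gamma>)) ts"
    using slabel_lweight[OF assms(3) fin] by (rule image_mset_cong)
qed

lemma nf_init:
  assumes "standard \<Gamma>" "\<not> circular \<Gamma>"
  obtains ts where "decomp \<Gamma> (branching \<Gamma>) ts" "nf (init \<Gamma>) (dstate \<Gamma> (branching \<Gamma>) ts)"
  using standard_decomp[OF assms] dstate_normal[OF assms] unfolding nf_def by metis

lemma nf_init_circular:
  assumes "standard \<Gamma>" "circular \<Gamma>"
  shows "nf (init \<Gamma>) ({}, \<lambda>_. 0, {#})"
proof -
  have wg: "weighted_graph \<Gamma>" "connected_graph \<Gamma>"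
    using assms by (simp_all add: standard_def)
  have "red\<^sup>*\<^sup>* (init \<Gamma>) ({}, \<lambda>_. 0, {#})"
    using eliminate[OF wg] circular_no_decomp[OF wg(1) assms(2)] by blast
  moreover have "\<not> red ({}, \<lambda>_. 0, {#}) Y" for Y :: "'a state"
    by (auto elim: red.cases)
  ultimately show ?thesis
    unfolding nf_def by blast
qed

lemma decomp_nonempty:
  assumes "decomp \<Gamma> {} {#}" "weighted_graph \<Gamma>"
  shows False
  using assms by (simp add: decomp_def weighted_graph_def mset_set_empty_iff)

text \<open>Standard labels are their own canonical representatives, so gauge-equivalent states with
  such labels have the same labels up to renaming. Of the weights, the potential recovers the sums
  over sets that are \<open>z_closed\<close>.\<close>

lemma equ_dstate:
  assumes std: "standard \<Gamma>" "\<not> circular \<Gamma>" and dec: "decomp \<Gamma> (branching \<Gamma>) ts"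
    and equ: "equ (dstate \<Gamma> (branching \<Gamma>) ts) (V', b', M')" and M': "std_labels M'"
  obtains \<pi> where "bij \<pi>" "V' = \<pi> ` branching \<Gamma>"
    "M' = image_mset (\<lambda>t. ren_edge \<pi> (slabel (weight \<Gamma>) t)) ts"
    "\<forall>K. K \<subseteq> branching \<Gamma> \<longrightarrow> z_closed K (image_mset (slabel (weight \<Gamma>)) ts) \<longrightarrow>
      (\<Sum>v\<in>K. b' (\<pi> v)) = (\<Sum>v\<in>K. lweight \<Gamma> v)"
proof -
  let ?B = "branching \<Gamma>"
  let ?b = "\<lambda>v. if v \<in> ?B then lweight \<Gamma> v else 0"
  let ?M = "image_mset (slabel (weight \<Gamma>)) ts"
  note lab = slabel_std_labels[OF std dec]
  have finB: "finite ?B"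
    using std(1) by (simp add: standard_def weighted_graph_def branching_def)
  obtain \<pi> where \<pi>: "bij \<pi>" "gauge\<^sup>*\<^sup>* (ren \<pi> (dstate \<Gamma> ?B ts)) (V', b', M')"
    using equ by (rule equE)
  have inj: "inj \<pi>"
    using \<pi>(1) by (rule bij_is_inj)
  let ?M1 = "image_mset (ren_edge \<pi>) ?M"
  have g: "gauge\<^sup>*\<^sup>* (\<pi> ` ?B, ?b \<circ> inv \<pi>, ?M1) (V', b', M')"
    using \<pi>(2) by (simp add: dstate_def lab(2))
  have M1: "std_labels ?M1"
    using lab(1) by (fastforce simp: std_labels_def)
  note inv = gauges_invariants[OF g std_labels_det[OF M1]]
  show ?thesis
  proof (rule that[OF \<pi>(1)])
    show "V' = \<pi> ` ?B"
      using inv by blast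
    have "image_mset canon_edge M' = image_mset canon_edge ?M1"
      using inv by blast
    then show "M' = image_mset (\<lambda>t. ren_edge \<pi> (slabel (weight \<Gamma>) t)) ts"
      using std_labels_canon[OF M1] std_labels_canon[OF M'] by (simp add: multiset.map_comp comp_def)
    show "\<forall>K. K \<subseteq> ?B \<longrightarrow> z_closed K ?M \<longrightarrow> (\<Sum>v\<in>K. b' (\<pi> v)) = (\<Sum>v\<in>K. lweight \<Gamma> v)"
    proof (intro allI impI)
      fix K assume K: "K \<subseteq> ?B" "z_closed K ?M"
      have mem: "map_option \<pi> p \<in> Some ` \<pi> ` K \<longleftrightarrow> p \<in> Some ` K" for p
        using inj by (cases p) (auto dest: injD)
      have "z_closed (\<pi> ` K) ?M1"
        unfolding z_closed_def
      proof (intro ballI)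
        fix e d assume "e \<in># ?M1" "d \<in># e"
        then obtain e0 where e0: "e0 \<in># ?M" "d \<in># ren_edge \<pi> e0"
          by auto
        from e0(2) obtain p g q where d: "(p, g, q) \<in># e0" "d = (map_option \<pi> p, g, map_option \<pi> q)"
          unfolding ren_edge_def by auto
        have "is_z g \<longrightarrow> (p \<in> Some ` K \<longleftrightarrow> q \<in> Some ` K)"
          using K(2) e0(1) d(1) unfolding z_closed_def by blast
        then show "case d of (p, g, q) \<Rightarrow> is_z g \<longrightarrow> (p \<in> Some ` \<pi> ` K \<longleftrightarrow> q \<in> Some ` \<pi> ` K)"
          unfolding d(2) prod.case mem .
      qed
      moreover have "finite (\<pi> ` K)"
        using finB K(1) by (auto intro: finite_subset)
      ultimately have "pot (\<pi> ` K) b' M' = pot (\<pi> ` K) (?b \<circ> inv \<pi>) ?M1"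
        using inv by blast
      then have "(\<Sum>x\<in>\<pi> ` K. b' x) = (\<Sum>x\<in>\<pi> ` K. (?b \<circ> inv \<pi>) x)"
        by (simp add: std_labels_pot[OF M1] std_labels_pot[OF M'])
      then have "(\<Sum>v\<in>K. b' (\<pi> v)) = (\<Sum>v\<in>K. ?b v)"
        using inj by (simp add: sum.reindex inj_on_subset[OF inj] comp_def inv_f_f[OF inj] cong: if_cong)
      also have "\<dots> = (\<Sum>v\<in>K. lweight \<Gamma> v)"
        using K(1) by (intro sum.cong) auto
      finally show "(\<Sum>v\<in>K. b' (\<pi> v)) = (\<Sum>v\<in>K. lweight \<Gamma> v)" .
    qed
  qed
qed

text \<open>By \<open>is_z_std\<close> the labels through which weight can pass are those of the odd
  chains of zeros, that is, of the links. Without free links none of them leads out of the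
  class.\<close>

lemma z_closed_link_class:
  assumes std: "standard \<Gamma>" "\<not> circular \<Gamma>" and dec: "decomp \<Gamma> (branching \<Gamma>) ts"
    and free: "\<forall>v\<in>link_class \<Gamma> ts u. \<not> free_link \<Gamma> ts v"
  shows "z_closed (link_class \<Gamma> ts u) (image_mset (slabel (weight \<Gamma>)) ts)"
proof -
  let ?K = "link_class \<Gamma> ts u"
  have *: "p \<in> Some ` ?K \<longleftrightarrow> q \<in> Some ` ?K"
    if t: "(p, xs, q) \<in># ts" and z: "is_z (word (map (weight \<Gamma>) xs))" for p xs q
  proof -
    have "std (map (weight \<Gamma>) xs)"
      using std_triple[OF std dec t] by simp
    then obtain k where k: "map (weight \<Gamma>) xs = replicate (2 * k + 1) 0"
      using is_z_std z by blast
    have "length xs = 2 * k + 1" "\<forall>x\<in>set xs. weight \<Gamma> x = 0"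
      using arg_cong[OF k, of length] arg_cong[OF k, of set] by (auto simp del: replicate.simps)
    then have oz: "odd_zero \<Gamma> (p, xs, q)"
      by (simp add: odd_zero_def)
    have step: "p' \<in> Some ` ?K \<Longrightarrow> q' \<in> Some ` ?K"
      if pq: "p' = p \<and> q' = q \<or> p' = q \<and> q' = p" for p' q'
    proof -
      assume "p' \<in> Some ` ?K"
      then obtain v where v: "p' = Some v" "v \<in> ?K"
        by blast
      have "q' \<noteq> None"
      proof
        assume "q' = None"
        then have "free_link \<Gamma> ts v"
          using t oz pq v(1) unfolding free_link_def by blast
        then show False
          using free v(2) by blast
      qed
      then obtain x where x: "q' = Some x"
        by blast
      then have "linked \<Gamma> ts v x"
        using t oz pq v(1) unfolding linked_def by blast
      then show "q' \<in> Some ` ?K"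
        using link_class_linked[OF v(2)] x by blast
    qed
    show ?thesis
      using step by blast
  qed
  show ?thesis
    unfolding z_closed_def
  proof (intro ballI)
    fix e d assume "e \<in># image_mset (slabel (weight \<Gamma>)) ts" and d: "d \<in># e"
    then obtain p xs q where t: "(p, xs, q) \<in># ts" "e = slabel (weight \<Gamma>) (p, xs, q)"
      by auto
    let ?w = "word (map (weight \<Gamma>) xs)"
    have "d = (p, ?w, q) \<or> d = (q, star ?w, p)"
      using d t(2) by (auto simp: ledge_def)
    then show "case d of (p, g, q) \<Rightarrow> is_z g \<longrightarrow> (p \<in> Some ` ?K \<longleftrightarrow> q \<in> Some ` ?K)"
      using *[OF t(1)] by (auto simp del: image_iff)
  qed
qed

section \<open>Reconstruction\<close>

definition aligned :: "'a wgraph \<Rightarrow> 'a wgraph \<Rightarrow> ('a \<Rightarrow> 'a) \<Rightarrow> 'a triple \<Rightarrow> 'a triple \<Rightarrow> bool" where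
  "aligned \<Gamma> \<Gamma>' \<pi> = (\<lambda>(p, xs, q) (p', xs', q'). p' = map_option \<pi> p \<and> q' = map_option \<pi> q \<and>
     word (map (weight \<Gamma>) xs) = word (map (weight \<Gamma>') xs'))"

lemma aligned_or_flip:
  assumes "ren_edge \<pi> (slabel (weight \<Gamma>) t) = slabel (weight \<Gamma>') t'"
  shows "aligned \<Gamma> \<Gamma>' \<pi> t t' \<or> aligned \<Gamma> \<Gamma>' \<pi> t (flip t')"
  using assms by (cases t; cases t') (auto simp: aligned_def ledge_eq_iff star_word rev_map)

lemma aligned_decompositions:
  assumes std: "standard \<Gamma>" "\<not> circular \<Gamma>" and dec: "decomp \<Gamma> (branching \<Gamma>) ts"
    and std': "standard \<Gamma>'" "\<not> circular \<Gamma>'" and bir: "birationally_equivalent \<Gamma> \<Gamma>'"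
    and nf: "nf (init \<Gamma>) (dstate \<Gamma> (branching \<Gamma>) ts)"
  obtains \<pi> R where "bij \<pi>" "branching \<Gamma>' = \<pi> ` branching \<Gamma>"
    "image_mset fst R = ts" "decomp \<Gamma>' (branching \<Gamma>') (image_mset snd R)"
    "\<forall>(t, t')\<in>#R. aligned \<Gamma> \<Gamma>' \<pi> t t'"
    "\<forall>K. K \<subseteq> branching \<Gamma> \<longrightarrow> z_closed K (image_mset (slabel (weight \<Gamma>)) ts) \<longrightarrow>
      (\<Sum>v\<in>K. lweight \<Gamma>' (\<pi> v)) = (\<Sum>v\<in>K. lweight \<Gamma> v)"
proof -
  let ?B = "branching \<Gamma>" and ?B' = "branching \<Gamma>'"
  have wg: "weighted_graph \<Gamma>"
    using std(1) by (simp add: standard_def)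
  obtain ts0 where dec0: "decomp \<Gamma>' ?B' ts0" and nf0: "nf (init \<Gamma>') (dstate \<Gamma>' ?B' ts0)"
    using nf_init[OF std'] .
  note lab0 = slabel_std_labels[OF std' dec0]
  have "equ (dstate \<Gamma> ?B ts) (dstate \<Gamma>' ?B' ts0)"
    using simD[OF sim_birational[OF bir wg] nf nf0] .
  then have "equ (dstate \<Gamma> ?B ts) (?B', \<lambda>v. if v \<in> ?B' then lweight \<Gamma>' v else 0,
      image_mset (slabel (weight \<Gamma>')) ts0)"
    by (simp only: dstate_def[of \<Gamma>'] lab0(2))
  then obtain \<pi> where \<pi>: "bij \<pi>" "?B' = \<pi> ` ?B"
    "image_mset (slabel (weight \<Gamma>')) ts0 = image_mset (\<lambda>t. ren_edge \<pi> (slabel (weight \<Gamma>) t)) ts"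
    "\<forall>K. K \<subseteq> ?B \<longrightarrow> z_closed K (image_mset (slabel (weight \<Gamma>)) ts) \<longrightarrow>
      (\<Sum>v\<in>K. if \<pi> v \<in> ?B' then lweight \<Gamma>' (\<pi> v) else 0) = (\<Sum>v\<in>K. lweight \<Gamma> v)"
    using lab0(1) by (rule equ_dstate[OF std dec])
  obtain R0 where R0: "image_mset fst R0 = ts" "image_mset snd R0 = ts0"
    "\<And>t t'. (t, t') \<in># R0 \<Longrightarrow> ren_edge \<pi> (slabel (weight \<Gamma>) t) = slabel (weight \<Gamma>') t'"
    by (rule image_mset_eq_matching[OF \<pi>(3)[symmetric]]) blast
  \<comment> \<open>The labelled edges are unoriented, so a path of \<Gamma>' may have to be read
    backwards to match its partner.\<close>
  define h where "h r = (if aligned \<Gamma> \<Gamma>' \<pi> (fst r) (snd r) then snd r else flip (snd r))" for r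
  define R where "R = image_mset (\<lambda>r. (fst r, h r)) R0"
  show ?thesis
  proof (rule that[OF \<pi>(1,2)])
    show "image_mset fst R = ts"
      using R0(1) by (simp add: R_def multiset.map_comp comp_def)
    have "decomp \<Gamma>' ?B' (image_mset h R0)"
      using dec0 R0(2) by (intro decomp_reorient[of \<Gamma>' ?B' snd R0 h]) (auto simp: h_def)
    then show "decomp \<Gamma>' ?B' (image_mset snd R)"
      by (simp add: R_def multiset.map_comp comp_def)
    have "aligned \<Gamma> \<Gamma>' \<pi> (fst r) (h r)" if "r \<in># R0" for r
      using aligned_or_flip[OF R0(3), of "fst r" "snd r"] that by (auto simp: h_def)
    then show "\<forall>(t, t')\<in>#R. aligned \<Gamma> \<Gamma>' \<pi> t t'"
      unfolding R_def by simp
    show "\<forall>K. K \<subseteq> ?B \<longrightarrow> z_closed K (image_mset (slabel (weight \<Gamma>)) ts) \<longrightarrow>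
        (\<Sum>v\<in>K. lweight \<Gamma>' (\<pi> v)) = (\<Sum>v\<in>K. lweight \<Gamma> v)"
    proof (intro allI impI)
      fix K assume K: "K \<subseteq> ?B" "z_closed K (image_mset (slabel (weight \<Gamma>)) ts)"
      have "(\<Sum>v\<in>K. lweight \<Gamma>' (\<pi> v)) = (\<Sum>v\<in>K. if \<pi> v \<in> ?B' then lweight \<Gamma>' (\<pi> v) else 0)"
        using K(1) \<pi>(2) by (intro sum.cong) auto
      then show "(\<Sum>v\<in>K. lweight \<Gamma>' (\<pi> v)) = (\<Sum>v\<in>K. lweight \<Gamma> v)"
        using \<pi>(4) K by simp
    qed
  qed
qed

lemma length_even_std: "even_std k us ws \<Longrightarrow> length ws = 2 * k + length us"
  by (auto simp: even_std_def)

text \<open>The normal form determines the branching vertices and the label of each path, and a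
  label determines the length of a standard segment and its weights up to reversion. This suffices
  to rebuild the graph; weights at branching vertices are compared through the invariant
  sums.\<close>

lemma birational_standard:
  fixes \<Gamma> :: "'a::infinite wgraph"
  assumes std: "standard \<Gamma>" "\<not> circular \<Gamma>" and std': "standard \<Gamma>'"
    and bir: "birationally_equivalent \<Gamma> \<Gamma>'"
  shows "\<exists>\<Gamma>\<^sub>1 \<Gamma>\<^sub>2. branching_weight_change \<Gamma> \<Gamma>\<^sub>1 \<and> reversion\<^sup>*\<^sup>* \<Gamma>\<^sub>1 \<Gamma>\<^sub>2 \<and> isomorphic \<Gamma>\<^sub>2 \<Gamma>'"
proof -
  let ?B = "branching \<Gamma>" and ?B' = "branching \<Gamma>'"
  have wg: "weighted_graph \<Gamma>" "weighted_graph \<Gamma>'"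
    using std(1) std' by (simp_all add: standard_def)
  then have fin: "finite (verts \<Gamma>)" "finite (verts \<Gamma>')"
    by (simp_all add: weighted_graph_def)
  obtain ts where dec: "decomp \<Gamma> ?B ts" and nf: "nf (init \<Gamma>) (dstate \<Gamma> ?B ts)"
    using nf_init[OF std] .
  \<comment> \<open>A circular graph reduces to the empty state. If \<Gamma> had this normal form,
    it would have neither branching vertices nor paths, hence no vertices at all.\<close>
  have circ': "\<not> circular \<Gamma>'"
  proof
    assume "circular \<Gamma>'"
    then have "equ (dstate \<Gamma> ?B ts) ({}, \<lambda>_. 0, {#})"
      using simD[OF sim_birational[OF bir wg(1)] nf nf_init_circular[OF std']] by blast
    moreover have "std_labels {#}"
      by (simp add: std_labels_def)
    ultimately have "?B = {} \<and> ts = {#}"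
      by (rule equ_dstate[OF std dec]) auto
    then show False
      using decomp_nonempty[OF _ wg(1)] dec by simp
  qed
  obtain \<pi> R where \<pi>: "bij \<pi>" "?B' = \<pi> ` ?B" and R: "image_mset fst R = ts"
    and dec': "decomp \<Gamma>' ?B' (image_mset snd R)"
    and al': "\<forall>(t, t')\<in>#R. aligned \<Gamma> \<Gamma>' \<pi> t t'"
    and sums: "\<forall>K. K \<subseteq> ?B \<longrightarrow> z_closed K (image_mset (slabel (weight \<Gamma>)) ts) \<longrightarrow>
      (\<Sum>v\<in>K. lweight \<Gamma>' (\<pi> v)) = (\<Sum>v\<in>K. lweight \<Gamma> v)"
    by (rule aligned_decompositions[OF std dec std' circ' bir nf])
  have al: "aligned \<Gamma> \<Gamma>' \<pi> t t'" if "(t, t') \<in># R" for t t'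
    using al' that by blast
  have inj: "inj \<pi>"
    using \<pi>(1) by (rule bij_is_inj)
  have BV: "?B \<subseteq> verts \<Gamma>"
    by (auto simp: branching_def)
  have Rts: "t \<in># ts" "t' \<in># image_mset snd R" if "(t, t') \<in># R" for t t'
    using that unfolding R[symmetric] by (force, force)
  have weights: "map (weight \<Gamma>) (inner t) = map (weight \<Gamma>') (inner t') \<or>
      (\<exists>k us. even_std k us (map (weight \<Gamma>) (inner t)) \<and> even_std k us (map (weight \<Gamma>') (inner t')))"
    if tt: "(t, t') \<in># R" for t t'
  proof (rule word_eq_std)
    show "std (map (weight \<Gamma>) (inner t))"
      by (rule std_triple[OF std dec Rts(1)[OF tt]])
    show "std (map (weight \<Gamma>') (inner t'))"
      by (rule std_triple[OF std' circ' dec' Rts(2)[OF tt]])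
    show "word (map (weight \<Gamma>) (inner t)) = word (map (weight \<Gamma>') (inner t'))"
      using al[OF tt] by (cases t; cases t') (simp add: aligned_def)
  qed
  have len: "length (inner t) = length (inner t')" if "(t, t') \<in># R" for t t'
    using weights[OF that] length_even_std by (metis length_map)
  have "\<exists>f. \<forall>(xs, ys)\<in>#image_mset (\<lambda>(t, t'). (inner t, inner t')) R. map f xs = ys"
  proof (rule ex_common_map)
    show "length xs = length ys" if "(xs, ys) \<in># image_mset (\<lambda>(t, t'). (inner t, inner t')) R" for xs ys
      using that len by auto
    fix v
    have "(\<Sum>(xs, ys)\<in>#image_mset (\<lambda>(t, t'). (inner t, inner t')) R. mset xs) =
        (\<Sum>t\<in>#ts. mset (inner t))"
      unfolding R[symmetric] by (simp add: multiset.map_comp comp_def case_prod_beta)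
    then show "count (\<Sum>(xs, ys)\<in>#image_mset (\<lambda>(t, t'). (inner t, inner t')) R. mset xs) v \<le> 1"
      using decomp_inner_count[OF dec fin(1), of v] by simp
  qed
  then obtain f0 where f0: "\<And>t t'. (t, t') \<in># R \<Longrightarrow> map f0 (inner t) = inner t'"
    by fastforce
  \<comment> \<open>The renaming \<pi> is meaningful only on the branching vertices, the others
    having been suppressed; these are matched by their position in corresponding paths.\<close>
  define f where "f v = (if v \<in> ?B then \<pi> v else f0 v)" for v
  have f_inner: "map f (inner t) = inner t'" if tt: "(t, t') \<in># R" for t t'
  proof -
    have "map f (inner t) = map f0 (inner t)"
      using decomp_inner_notin[OF dec fin(1) Rts(1)[OF tt]] by (simp add: f_def)
    then show ?thesis
      using f0[OF tt] by simp
  qed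
  have f_full: "map f (full t) = full t'" if tt: "(t, t') \<in># R" for t t'
  proof -
    obtain p xs q p' xs' q' where t: "t = (p, xs, q)" "t' = (p', xs', q')"
      by (cases t; cases t')
    have "ok ?B t"
      using dec Rts(1)[OF tt] by (simp add: decomp_def)
    then have "map_option f p = map_option \<pi> p" "map_option f q = map_option \<pi> q"
      by (cases p; cases q; simp add: t f_def)+
    then show ?thesis
      using al[OF tt] f_inner[OF tt] by (simp add: t aligned_def)
  qed
  have "image_mset f (mset_set (verts \<Gamma>)) = mset_set (verts \<Gamma>')"
  proof -
    have "image_mset f (mset_set ?B) = mset_set ?B'"
    proof -
      have "image_mset f (mset_set ?B) = image_mset \<pi> (mset_set ?B)"
        using BV fin(1) by (intro image_mset_cong) (auto simp: f_def finite_subset)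
      also have "\<dots> = mset_set ?B'"
        unfolding \<pi>(2) by (intro image_mset_mset_set inj_on_subset[OF inj]) simp
      finally show ?thesis .
    qed
    moreover have "image_mset f (\<Sum>t\<in>#ts. mset (inner t)) = (\<Sum>t\<in>#image_mset snd R. mset (inner t))"
    proof -
      have "image_mset f (\<Sum>t\<in>#ts. mset (inner t)) = (\<Sum>r\<in>#R. mset (map f (inner (fst r))))"
        unfolding R[symmetric] by (induction R) auto
      also have "\<dots> = (\<Sum>r\<in>#R. mset (inner (snd r)))"
        using f_inner by (intro arg_cong[where f = sum_mset] image_mset_cong) (metis prod.collapse)
      finally show ?thesis
        by (simp add: multiset.map_comp comp_def)
    qed
    ultimately show ?thesis
      using dec dec' by (simp add: decomp_def)
  qed
  then have bij: "bij_betw f (verts \<Gamma>) (verts \<Gamma>')"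
    using fin by (rule bij_betw_mset_set)
  have edges: "image_mset (image_mset f) (edges \<Gamma>) = edges \<Gamma>'"
  proof -
    have "image_mset (image_mset f) (\<Sum>t\<in>#ts. path_edges (full t)) =
        (\<Sum>r\<in>#R. path_edges (map f (full (fst r))))"
      unfolding R[symmetric] by (induction R) (auto simp: path_edges_image)
    also have "\<dots> = (\<Sum>r\<in>#R. path_edges (full (snd r)))"
      using f_full by (intro arg_cong[where f = sum_mset] image_mset_cong) (metis prod.collapse)
    finally show ?thesis
      using dec dec' by (simp add: decomp_def multiset.map_comp comp_def)
  qed
  \<comment> \<open>The passage from \<Gamma> to \<Gamma>' is split: \<open>w1\<close> takes over
    the weights of \<Gamma>' at branching vertices only, and \<open>w2\<close> is the full pullback
    along f. Between the two only segments change.\<close>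
  define w1 where "w1 v = (if v \<in> ?B then weight \<Gamma>' (f v) else weight \<Gamma> v)" for v
  define w2 where "w2 v = (if v \<in> verts \<Gamma> then weight \<Gamma>' (f v) else weight \<Gamma> v)" for v
  have "isomorphic (\<Gamma>\<lparr>weight := w2\<rparr>) \<Gamma>'"
    unfolding isomorphic_def using bij edges by (intro exI[of _ f]) (simp add: w2_def)
  moreover have "branching_weight_change \<Gamma> (\<Gamma>\<lparr>weight := w1\<rparr>)"
    unfolding branching_weight_change_iff[OF wg(1) dec]
  proof (intro conjI allI ballI impI)
    fix u assume u: "u \<in> ?B" and free: "\<forall>v\<in>link_class \<Gamma> ts u. \<not> free_link \<Gamma> ts v"
    let ?K = "link_class \<Gamma> ts u"
    have K: "?K \<subseteq> ?B"
      by (rule link_class_subset[OF dec u])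
    \<comment> \<open>The invariant sums are formed with \<open>lweight\<close>. Since f preserves
      the number of loops at a vertex, the corrections cancel and the sums of the actual weights
      agree.\<close>
    have loops: "count (edges \<Gamma>') {#f v, f v#} = count (edges \<Gamma>) {#v, v#}" if v: "v \<in> verts \<Gamma>" for v
    proof -
      have "{e \<in> set_mset (edges \<Gamma>). image_mset f e = {#f v, f v#}} \<subseteq> {{#v, v#}}"
      proof
        fix e assume "e \<in> {e \<in> set_mset (edges \<Gamma>). image_mset f e = {#f v, f v#}}"
        then have e: "e \<in># edges \<Gamma>" "image_mset f e = {#f v, f v#}"
          by auto
        obtain a b where ab: "e = {#a, b#}" "a \<in> verts \<Gamma>" "b \<in> verts \<Gamma>"
          using edge_pair[OF wg(1) e(1)] .
        then have "f a = f v" "f b = f v"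
          using e(2) by (auto simp: pair_mset_eq_iff)
        then show "e \<in> {{#v, v#}}"
          using bij v ab by (auto simp: bij_betw_def dest: inj_onD)
      qed
      then have "{#e \<in># edges \<Gamma>. image_mset f e = {#f v, f v#}#} = {#e \<in># edges \<Gamma>. e = {#v, v#}#}"
        by (intro filter_mset_cong refl) auto
      then show ?thesis
        unfolding edges[symmetric] count_conv_size_mset
        by (simp add: filter_mset_image_mset)
    qed
    have lw: "lweight \<Gamma>' (\<pi> v) = weight \<Gamma>' (f v) - 2 * int (count (edges \<Gamma>) {#v, v#})"
      "lweight \<Gamma> v = weight \<Gamma> v - 2 * int (count (edges \<Gamma>) {#v, v#})" if v: "v \<in> ?K" for v
    proof -
      have vB: "v \<in> ?B" "v \<in> verts \<Gamma>"
        using v K BV by auto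
      then have "f v \<in> verts \<Gamma>'" "\<pi> v = f v"
        using bij by (auto simp: bij_betw_def f_def)
      then show "lweight \<Gamma>' (\<pi> v) = weight \<Gamma>' (f v) - 2 * int (count (edges \<Gamma>) {#v, v#})"
        "lweight \<Gamma> v = weight \<Gamma> v - 2 * int (count (edges \<Gamma>) {#v, v#})"
        using vB loops by (simp_all add: lweight_def)
    qed
    have "(\<Sum>v\<in>?K. lweight \<Gamma>' (\<pi> v)) = (\<Sum>v\<in>?K. lweight \<Gamma> v)"
      using sums K z_closed_link_class[OF std dec free] by blast
    then have "(\<Sum>v\<in>?K. weight \<Gamma>' (f v)) = (\<Sum>v\<in>?K. weight \<Gamma> v)"
      by (simp add: lw sum_subtractf)
    moreover have "(\<Sum>v\<in>?K. w1 v) = (\<Sum>v\<in>?K. weight \<Gamma>' (f v))"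
      using K by (intro sum.cong) (auto simp: w1_def)
    ultimately show "(\<Sum>b\<in>?K. weight (\<Gamma>\<lparr>weight := w1\<rparr>) b) = (\<Sum>b\<in>?K. weight \<Gamma> b)"
      by simp
  qed (simp_all add: w1_def)
  moreover have "reversion\<^sup>*\<^sup>* (\<Gamma>\<lparr>weight := w1\<rparr>) (\<Gamma>\<lparr>weight := w2\<rparr>)"
  proof (rule reversions[OF wg(1) dec])
    fix t assume t: "t \<in># ts"
    then obtain t' where tt: "(t, t') \<in># R"
      unfolding R[symmetric] by auto
    have "map w1 (inner t) = map (weight \<Gamma>) (inner t)"
      using decomp_inner_notin[OF dec fin(1) t] by (simp add: w1_def)
    moreover have "map w2 (inner t) = map (weight \<Gamma>') (map f (inner t))"
      using decomp_inner_notin[OF dec fin(1) t] by (simp add: w2_def)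
    ultimately show "map w1 (inner t) = map w2 (inner t) \<or>
        (\<exists>k us. even_std k us (map w1 (inner t)) \<and> even_std k us (map w2 (inner t)))"
      using weights[OF tt] by (simp only: f_inner[OF tt])
  next
    fix v assume v: "v \<notin> (\<Union>t\<in>set_mset ts. set (inner t))"
    show "w2 v = w1 v"
    proof (cases "v \<in> verts \<Gamma> - ?B")
      case True
      then have "count (\<Sum>t\<in>#ts. mset (inner t)) v = 1"
        using decomp_inner_count[OF dec fin(1), of v] by simp
      then have "v \<in># (\<Sum>t\<in>#ts. mset (inner t))"
        by (metis count_eq_zero_iff zero_neq_one)
      then show ?thesis
        using v by (auto simp: in_Union_mset_iff)
    next
      case False
      then show ?thesis
        using BV by (auto simp: w1_def w2_def)
    qed
  qed
  ultimately show ?thesis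
    by blast
qed

theorem corollary3:
  fixes \<Gamma> :: "'a::infinite wgraph"
  assumes "standard \<Gamma>" and "\<not> circular \<Gamma>"
  shows
    "(\<forall>\<Gamma>'. standard \<Gamma>' \<and> birationally_equivalent \<Gamma> \<Gamma>' \<longrightarrow>
        (\<exists>\<Gamma>\<^sub>1 \<Gamma>\<^sub>2. branching_weight_change \<Gamma> \<Gamma>\<^sub>1 \<and> reversion\<^sup>*\<^sup>* \<Gamma>\<^sub>1 \<Gamma>\<^sub>2 \<and> isomorphic \<Gamma>\<^sub>2 \<Gamma>')) \<and>
     (\<forall>\<Gamma>'. branching_weight_change \<Gamma> \<Gamma>' \<longrightarrow>
        standard \<Gamma>' \<and> birationally_equivalent \<Gamma> \<Gamma>') \<and>
     (\<exists>\<Gamma>'. branching_weight_change \<Gamma> \<Gamma>' \<and> birationally_equivalent \<Gamma> \<Gamma>' \<and>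
        (\<forall>G\<in>components (zero_part \<Gamma>).
           (has_end_vertex \<Gamma> G \<longrightarrow> (\<forall>b\<in>verts G \<inter> branching \<Gamma>. weight \<Gamma>' b = 0)) \<and>
           (\<not> has_end_vertex \<Gamma> G \<and> verts G \<inter> branching \<Gamma> \<noteq> {} \<longrightarrow>
              (\<exists>b\<in>verts G \<inter> branching \<Gamma>.
                 weight \<Gamma>' b = (\<Sum>c\<in>verts G \<inter> branching \<Gamma>. weight \<Gamma> c) \<and>
                 (\<forall>c\<in>verts G \<inter> branching \<Gamma> - {b}. weight \<Gamma>' c = 0)))))"
proof (intro conjI allI impI)
  fix \<Gamma>' assume "standard \<Gamma>' \<and> birationally_equivalent \<Gamma> \<Gamma>'"
  then show "\<exists>\<Gamma>\<^sub>1 \<Gamma>\<^sub>2. branching_weight_change \<Gamma> \<Gamma>\<^sub>1 \<and> reversion\<^sup>*\<^sup>* \<Gamma>\<^sub>1 \<Gamma>\<^sub>2 \<and> isomorphic \<Gamma>\<^sub>2 \<Gamma>'"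
    using birational_standard[OF assms] by blast
next
  fix \<Gamma>' assume ch: "branching_weight_change \<Gamma> \<Gamma>'"
  then show "standard \<Gamma>'"
    by (intro standard_weight_change[OF assms]) (simp_all add: branching_weight_change_def)
  show "birationally_equivalent \<Gamma> \<Gamma>'"
    by (rule branching_weight_change_birational[OF assms ch])
next
  show "\<exists>\<Gamma>'. branching_weight_change \<Gamma> \<Gamma>' \<and> birationally_equivalent \<Gamma> \<Gamma>' \<and>
        (\<forall>G\<in>components (zero_part \<Gamma>).
           (has_end_vertex \<Gamma> G \<longrightarrow> (\<forall>b\<in>verts G \<inter> branching \<Gamma>. weight \<Gamma>' b = 0)) \<and>
           (\<not> has_end_vertex \<Gamma> G \<and> verts G \<inter> branching \<Gamma> \<noteq> {} \<longrightarrow>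
              (\<exists>b\<in>verts G \<inter> branching \<Gamma>.
                 weight \<Gamma>' b = (\<Sum>c\<in>verts G \<inter> branching \<Gamma>. weight \<Gamma> c) \<and>
                 (\<forall>c\<in>verts G \<inter> branching \<Gamma> - {b}. weight \<Gamma>' c = 0))))"
    using normalized_weight_change[OF assms] branching_weight_change_birational[OF assms] by blast
qed

end
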